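(* Let $(X_j)_{j\in\mathbb Z}$ be a real Gaussian process with $EX_j=0$ for all $j$, with covariance matrix $\Sigma=(\sigma_{ij})_{i,j\in\mathbb Z}$, $\sigma_{ij}=EX_iX_j$. Suppose that $\Sigma$ acts as a bounded operator on $\ell^2(\mathbb Z)$ and is invertible. Then $(X_j)_{j\in\mathbb Z}$ is beta mixing if and only if $$\sup_{n\in\mathbb Z}\ \sum_{i=-\infty}^{n}\ \sum_{j=p+n}^{\infty}\sigma_{ij}^2\ \to\ 0\qquad\text{as } p\to\infty.$$
   Context: A Gaussian process is a sequence of random variables $(X_j)_{j\in\mathbb Z}$ on a probability space whose finite-dimensional joint distributions are Gaussian. "Invertible" means bijective as an operator on $\ell^2(\mathbb Z)$ (so the inverse is bounded). For $-\infty\le m\le n\le\infty$, $\mathcal B_m^n$ denotes the $\sigma$-field generated by the $X_j$ with $m\le j\le n$ ($j\in\mathbb Z$), and $P_{m,n}$ denotes the probability measure induced on $\mathcal B_m^n$ by $P$ (the joint law of those variables). For $m\in\mathbb Z$, $p\ge1$, let $P_m^{m+p}$ be the regular conditional probability measure on $\mathcal B_{m+p}^{\infty}$ given $\mathcal B_{-\infty}^m$, and let $\|\mu\|_{TV}$ denote the total variation of a signed measure $\mu$. Put $\beta(m,p):=E\,\|P_m^{m+p}-P_{m+p,\infty}\|_{TV}$. The process is called beta mixing (absolutely regular) if $\lim_{p\to\infty}\sup_{m\in\mathbb Z}\beta(m,p)=0$. *)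

theory Defs
  imports "HOL-Probability.Probability"
begin

section \<open>Gaussian processes indexed by the integers\<close>

text \<open>Point masses count as (degenerate) normal laws.\<close>

definition normal_law :: "real measure \<Rightarrow> bool" where
  "normal_law \<mu> \<longleftrightarrow>
     (\<exists>m. \<mu> = return borel m) \<or>
     (\<exists>m s. s > 0 \<and> \<mu> = density lborel (\<lambda>x. ennreal (normal_density m s x)))"

text \<open>A law on \<open>\<real>\<^sup>J\<close>, with \<open>J\<close> finite, is Gaussian if every linear functional of it is normal.\<close>

definition gaussian_law :: "int set \<Rightarrow> (int \<Rightarrow> real) measure \<Rightarrow> bool" where
  "gaussian_law J \<mu> \<longleftrightarrow>
     (\<forall>c :: int \<Rightarrow> real. normal_law (distr \<mu> borel (\<lambda>x. \<Sum>j\<in>J. c j * x j)))"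

definition joint_law :: "'a measure \<Rightarrow> (int \<Rightarrow> 'a \<Rightarrow> real) \<Rightarrow> int set \<Rightarrow> (int \<Rightarrow> real) measure" where
  "joint_law M X J = distr M (\<Pi>\<^sub>M j\<in>J. borel) (\<lambda>\<omega>. \<lambda>j\<in>J. X j \<omega>)"

definition gaussian_process :: "'a measure \<Rightarrow> (int \<Rightarrow> 'a \<Rightarrow> real) \<Rightarrow> bool" where
  "gaussian_process M X \<longleftrightarrow>
     prob_space M \<and> (\<forall>j. X j \<in> borel_measurable M) \<and>
     (\<forall>J. finite J \<longrightarrow> gaussian_law J (joint_law M X J))"


section \<open>Infinite matrices as operators on the square-summable sequences\<close>

definition ell2 :: "(int \<Rightarrow> real) set" where
  "ell2 = {x. (\<lambda>i. (x i)\<^sup>2) summable_on UNIV}"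

definition ell2_norm :: "(int \<Rightarrow> real) \<Rightarrow> real" where
  "ell2_norm x = sqrt (\<Sum>\<^sub>\<infinity>i. (x i)\<^sup>2)"

definition matrix_apply :: "(int \<Rightarrow> int \<Rightarrow> real) \<Rightarrow> (int \<Rightarrow> real) \<Rightarrow> int \<Rightarrow> real" where
  "matrix_apply A x = (\<lambda>i. \<Sum>\<^sub>\<infinity>j. A i j * x j)"

definition bounded_on_ell2 :: "(int \<Rightarrow> int \<Rightarrow> real) \<Rightarrow> bool" where
  "bounded_on_ell2 A \<longleftrightarrow>
     (\<forall>x\<in>ell2. (\<forall>i. (\<lambda>j. A i j * x j) summable_on UNIV) \<and> matrix_apply A x \<in> ell2) \<and>
     (\<exists>C. \<forall>x\<in>ell2. ell2_norm (matrix_apply A x) \<le> C * ell2_norm x)"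

definition invertible_on_ell2 :: "(int \<Rightarrow> int \<Rightarrow> real) \<Rightarrow> bool" where
  "invertible_on_ell2 A \<longleftrightarrow> bij_betw (matrix_apply A) ell2 ell2"


section \<open>Beta mixing\<close>

text \<open>Total variation of the signed measure \<open>\<mu>\<close> on the measurable space underlying \<open>N\<close>
  (the measure carried by \<open>N\<close> plays no role). For \<open>\<mu> = P - Q\<close> with probability measures
  \<open>P\<close> and \<open>Q\<close> this ranges over \<open>[0, 2]\<close>.\<close>

definition total_variation :: "'b measure \<Rightarrow> ('b set \<Rightarrow> real) \<Rightarrow> ennreal" where
  "total_variation N \<mu> =
     (SUP \<A> \<in> {\<A>. finite \<A> \<and> \<A> \<subseteq> sets N \<and> disjoint \<A> \<and> \<Union>\<A> = space N}.
        \<Sum>A\<in>\<A>. ennreal \<bar>\<mu> A\<bar>)"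

definition generated_field :: "'a measure \<Rightarrow> (int \<Rightarrow> 'a \<Rightarrow> real) \<Rightarrow> int set \<Rightarrow> 'a measure" where
  "generated_field M X J = sigma (space M) (\<Union>j\<in>J. {X j -` A \<inter> space M | A. A \<in> sets borel})"

text \<open>\<open>K\<close> is a regular conditional distribution, given the sub-sigma-field \<open>F\<close> of \<open>M\<close>, of the
  random element \<open>Y\<close> of the measurable space \<open>N\<close>.\<close>

definition is_regular_cond_law ::
  "'a measure \<Rightarrow> 'a measure \<Rightarrow> 'b measure \<Rightarrow> ('a \<Rightarrow> 'b) \<Rightarrow> ('a \<Rightarrow> 'b measure) \<Rightarrow> bool" where
  "is_regular_cond_law M F N Y K \<longleftrightarrow>
     K \<in> F \<rightarrow>\<^sub>M prob_algebra N \<and>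
     (\<forall>A\<in>sets N. AE \<omega> in M.
        measure (K \<omega>) A = real_cond_exp M F (indicator (Y -` A \<inter> space M)) \<omega>)"

text \<open>The conditional law of \<open>(X\<^sub>j)\<close>, \<open>j \<ge> m + p\<close>, given \<open>(X\<^sub>j)\<close>, \<open>j \<le> m\<close>. Conditional laws are
  taken on the sequence space \<open>\<real>\<^sup>J\<close>, \<open>J = {m + p..}\<close>, rather than on the sigma-field generated by
  these variables in the sample space: they always exist there, and any two versions agree almost
  surely, since \<open>\<real>\<^sup>J\<close> is a standard Borel space.\<close>

definition future_cond_law ::
  "'a measure \<Rightarrow> (int \<Rightarrow> 'a \<Rightarrow> real) \<Rightarrow> int \<Rightarrow> nat \<Rightarrow> 'a \<Rightarrow> (int \<Rightarrow> real) measure" where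
  "future_cond_law M X m p =
     (SOME K. is_regular_cond_law M (generated_field M X {..m})
        (\<Pi>\<^sub>M j\<in>{m + int p..}. borel) (\<lambda>\<omega>. \<lambda>j\<in>{m + int p..}. X j \<omega>) K)"

definition beta_coeff :: "'a measure \<Rightarrow> (int \<Rightarrow> 'a \<Rightarrow> real) \<Rightarrow> int \<Rightarrow> nat \<Rightarrow> ennreal" where
  "beta_coeff M X m p =
     (\<integral>\<^sup>+ \<omega>. total_variation (\<Pi>\<^sub>M j\<in>{m + int p..}. borel)
        (\<lambda>A. measure (future_cond_law M X m p \<omega>) A - measure (joint_law M X {m + int p..}) A) \<partial>M)"

definition beta_mixing :: "'a measure \<Rightarrow> (int \<Rightarrow> 'a \<Rightarrow> real) \<Rightarrow> bool" where
  "beta_mixing M X \<longleftrightarrow> (\<lambda>p. SUP m. beta_coeff M X m p) \<longlonglongrightarrow> 0"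

end

(* Let m be the present. Write P for the joint law of the past (X_i, i <= m) and the future
   (X_j, j >= m + p), and Q for the product of their marginal laws; beta(m, p) is the total variation
   of P - Q. Finitely many variables suffice, since events of the infinite product are approximated
   by events that depend on finitely many coordinates. Boundedness and invertibility of the
   covariance operator make the variances of linear combinations comparable to the squared norm of
   the coefficients.

   If the off-diagonal block of the covariance matrix is small in Hilbert--Schmidt norm, let e_k and
   e'_k be the innovations of the future variable X_k given everything before it and given only the
   earlier future. Their densities give the relative entropy of P with respect to Q as
   sum_k ln (|e'_k| / |e_k|), which is at most a constant times the squared Hilbert--Schmidt norm;
   small relative entropy makes the total variation small.

   Conversely, the quadratic form W = sum sigma_ij X_i X_j over past i and future j has mean 0 under Q
   and mean h, the squared Hilbert--Schmidt norm of the block, under P. Its second moments are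
   O(h) and h^2 + O(h), so truncating W at a height of order h + O(1) bounds h by a multiple of
   beta(m, p) as soon as the latter is small. *)

theory Submission
  imports Defs
begin

section \<open>Quadratic forms on square-summable sequences\<close>

text \<open>Three obstacles shape the argument. Invertibility is given only as bijectivity, so a
  positive lower bound for the quadratic form has to be extracted from it; a single vector built
  from nearly degenerate directions does this. Densities are written without determinants or inverse
  matrices: in the order of time, the map from coordinates to innovations is unit triangular, so a
  Gaussian density is the product of the densities of its innovations, and relative entropy becomes
  a sum of logarithms of variance ratios. Finally, \<open>beta_coeff\<close> integrates a supremum
  over uncountably many events, for a conditional law picked by choice. That such a law exists has
  to be shown; it arises by translating the law of the residuals of the future by the projection on
  the past. The supremum is then taken over a countable algebra. Entropy \<open>D\<close> yields
  total variation through a test function u times an indicator, with error D / u + u; this is of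
  order sqrt D for the best u, which suffices for a limit.\<close>

definition bil :: "(int \<Rightarrow> int \<Rightarrow> real) \<Rightarrow> int set \<Rightarrow> (int \<Rightarrow> real) \<Rightarrow> (int \<Rightarrow> real) \<Rightarrow> real" where
  "bil \<sigma> F a b = (\<Sum>i\<in>F. \<Sum>j\<in>F. a i * b j * \<sigma> i j)"

lemma bil_add_left: "bil \<sigma> F (\<lambda>i. a i + b i) c = bil \<sigma> F a c + bil \<sigma> F b c"
  by (simp add: bil_def algebra_simps sum.distrib)

lemma bil_add_right: "bil \<sigma> F c (\<lambda>i. a i + b i) = bil \<sigma> F c a + bil \<sigma> F c b"
  by (simp add: bil_def algebra_simps sum.distrib)

lemma bil_scale_left: "bil \<sigma> F (\<lambda>i. r * a i) c = r * bil \<sigma> F a c"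
  by (simp add: bil_def sum_distrib_left mult.assoc)

lemma bil_scale_right: "bil \<sigma> F c (\<lambda>i. r * a i) = r * bil \<sigma> F c a"
  by (simp add: bil_def sum_distrib_left algebra_simps)

lemma bil_commute:
  assumes "\<And>i j. \<sigma> i j = \<sigma> j i"
  shows "bil \<sigma> F a b = bil \<sigma> F b a"
  unfolding bil_def
proof (subst sum.swap, intro sum.cong refl)
  fix i j show "a j * b i * \<sigma> j i = b i * a j * \<sigma> i j"
    using assms[of i j] by simp
qed

lemma bil_mono_neutral:
  assumes "finite G" "F \<subseteq> G" "\<And>i. i \<in> G - F \<Longrightarrow> a i = 0" "\<And>i. i \<in> G - F \<Longrightarrow> b i = 0"
  shows "bil \<sigma> G a b = bil \<sigma> F a b"
proof -
  have "bil \<sigma> G a b = (\<Sum>i\<in>F. \<Sum>j\<in>G. a i * b j * \<sigma> i j)"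
    unfolding bil_def using assms by (intro sum.mono_neutral_right) auto
  also have "\<dots> = bil \<sigma> F a b"
    unfolding bil_def using assms by (intro sum.cong refl sum.mono_neutral_right) auto
  finally show ?thesis .
qed

text \<open>The discriminant argument, for a form that is only semidefinite: if
  \<open>bil \<sigma> F b b\<close> vanishes, the polynomial in t is linear and can stay nonnegative
  only if it is constant.\<close>

lemma bil_Cauchy_Schwarz:
  assumes sym: "\<And>i j. \<sigma> i j = \<sigma> j i" and psd: "\<And>a. 0 \<le> bil \<sigma> F a a"
  shows "(bil \<sigma> F a b)\<^sup>2 \<le> bil \<sigma> F a a * bil \<sigma> F b b"
proof -
  let ?A = "bil \<sigma> F a a" and ?B = "bil \<sigma> F b b" and ?C = "bil \<sigma> F a b"
  have q: "0 \<le> ?A + 2 * t * ?C + t\<^sup>2 * ?B" for t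
  proof -
    have "bil \<sigma> F (\<lambda>i. a i + t * b i) (\<lambda>i. a i + t * b i) = ?A + 2 * t * ?C + t\<^sup>2 * ?B"
      using bil_commute[of \<sigma> F b a] sym
      by (simp add: bil_add_left bil_add_right bil_scale_left bil_scale_right power2_eq_square algebra_simps)
    then show ?thesis using psd by metis
  qed
  show ?thesis
  proof (cases "?B = 0")
    case True
    have "?C = 0"
    proof (rule ccontr)
      assume "?C \<noteq> 0"
      \<comment> \<open>At this value of t the polynomial equals -1, against
        \<open>q\<close>.\<close>
      then have "2 * (- (?A + 1) / (2 * ?C)) * ?C = - (?A + 1)" by simp
      then show False using q[of "- (?A + 1) / (2 * ?C)"] True by simp
    qed
    then show ?thesis using True by simp
  next
    case False
    then have B: "?B > 0" using psd[of b] by simp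
    \<comment> \<open>The minimiser of the polynomial.\<close>
    have "0 \<le> ?A + 2 * (- ?C / ?B) * ?C + (- ?C / ?B)\<^sup>2 * ?B" by (rule q)
    also have "\<dots> = ?A - ?C\<^sup>2 / ?B" using B by (simp add: field_simps power2_eq_square)
    finally show ?thesis using B by (simp add: field_simps)
  qed
qed

section \<open>Two-sided bounds for the covariance form\<close>

text \<open>A finite vector is extended by zero to \<open>x\<close>; Cauchy-Schwarz then bounds the
  form by the norm of \<open>a\<close> times the norm of \<open>matrix_apply \<sigma> x\<close> over
  \<open>F\<close>, and the operator bound controls the latter.\<close>

lemma bounded_on_ell2_quad_upper:
  assumes "bounded_on_ell2 \<sigma>"
  shows "\<exists>\<Lambda>>0. \<forall>F a. finite F \<longrightarrow> bil \<sigma> F a a \<le> \<Lambda> * (\<Sum>i\<in>F. (a i)\<^sup>2)"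
proof -
  obtain C where C: "\<And>x. x \<in> ell2 \<Longrightarrow> ell2_norm (matrix_apply \<sigma> x) \<le> C * ell2_norm x"
    using assms unfolding bounded_on_ell2_def by blast
  have range: "\<And>x. x \<in> ell2 \<Longrightarrow> matrix_apply \<sigma> x \<in> ell2"
    using assms unfolding bounded_on_ell2_def by blast
  \<comment> \<open>Nothing is known about the sign of \<open>C\<close>, and the final bound is to
    be positive.\<close>
  have "bil \<sigma> F a a \<le> (\<bar>C\<bar> + 1) * (\<Sum>i\<in>F. (a i)\<^sup>2)" if F: "finite F" for F a
  proof -
    define x where "x i = (if i \<in> F then a i else 0)" for i
    have x2: "(\<lambda>i. (x i)\<^sup>2) summable_on UNIV" "(\<Sum>\<^sub>\<infinity>i. (x i)\<^sup>2) = (\<Sum>i\<in>F. (a i)\<^sup>2)"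
    proof -
      have "((\<lambda>i. (a i)\<^sup>2) has_sum (\<Sum>i\<in>F. (a i)\<^sup>2)) F" using F by (rule has_sum_finite)
      moreover have "((\<lambda>i. (x i)\<^sup>2) has_sum (\<Sum>i\<in>F. (a i)\<^sup>2)) UNIV \<longleftrightarrow>
          ((\<lambda>i. (a i)\<^sup>2) has_sum (\<Sum>i\<in>F. (a i)\<^sup>2)) F"
        by (rule has_sum_cong_neutral) (auto simp: x_def)
      ultimately have *: "((\<lambda>i. (x i)\<^sup>2) has_sum (\<Sum>i\<in>F. (a i)\<^sup>2)) UNIV" by blast
      then show "(\<lambda>i. (x i)\<^sup>2) summable_on UNIV" "(\<Sum>\<^sub>\<infinity>i. (x i)\<^sup>2) = (\<Sum>i\<in>F. (a i)\<^sup>2)"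
        by (auto intro: has_sum_imp_summable infsumI)
    qed
    have x: "x \<in> ell2" using x2 by (simp add: ell2_def)
    have app: "matrix_apply \<sigma> x i = (\<Sum>j\<in>F. \<sigma> i j * a j)" for i
    proof -
      have "(\<Sum>\<^sub>\<infinity>j. \<sigma> i j * x j) = (\<Sum>\<^sub>\<infinity>j\<in>F. \<sigma> i j * a j)"
        by (rule infsum_cong_neutral) (auto simp: x_def)
      then show ?thesis using F by (simp add: matrix_apply_def)
    qed
    let ?y = "matrix_apply \<sigma> x"
    have "L2_set ?y F \<le> ell2_norm ?y"
      using range[OF x] F unfolding L2_set_def ell2_norm_def ell2_def
      by (auto intro!: real_sqrt_le_mono finite_sum_le_infsum)
    also have "\<dots> \<le> C * ell2_norm x" by (rule C[OF x])
    also have "\<dots> \<le> (\<bar>C\<bar> + 1) * L2_set a F"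
      unfolding ell2_norm_def x2 L2_set_def by (intro mult_right_mono) (auto simp: sum_nonneg)
    finally have y: "L2_set ?y F \<le> (\<bar>C\<bar> + 1) * L2_set a F" .
    have "bil \<sigma> F a a = (\<Sum>i\<in>F. a i * ?y i)"
      unfolding bil_def app by (simp add: sum_distrib_left algebra_simps)
    also have "\<dots> \<le> (\<Sum>i\<in>F. \<bar>a i\<bar> * \<bar>?y i\<bar>)"
      by (intro sum_mono) (metis abs_ge_self abs_mult)
    also have "\<dots> \<le> L2_set a F * L2_set ?y F" by (rule L2_set_mult_ineq)
    also have "\<dots> \<le> L2_set a F * ((\<bar>C\<bar> + 1) * L2_set a F)"
      using y by (intro mult_left_mono) auto
    also have "\<dots> = (\<bar>C\<bar> + 1) * (L2_set a F)\<^sup>2" by (simp add: power2_eq_square)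
    also have "(L2_set a F)\<^sup>2 = (\<Sum>i\<in>F. (a i)\<^sup>2)" by (simp add: L2_set_def sum_nonneg)
    finally show ?thesis .
  qed
  then show ?thesis by (intro exI[of _ "\<bar>C\<bar> + 1"]) auto
qed

text \<open>Boundedness of the inverse, by a gliding hump: if unit vectors \<open>a\<^sub>n\<close> had energies at most
  \<open>16\<^sup>-\<^sup>n\<close>, then every vector in the range of the operator would pair with \<open>a\<^sub>n\<close> to
  \<open>O(4\<^sup>-\<^sup>n)\<close>, but \<open>\<Sum>k. \<plusminus>3\<^sup>-\<^sup>k a\<^sub>k\<close> with suitable signs does not.\<close>

lemma ell2_gliding_hump:
  fixes a :: "nat \<Rightarrow> int \<Rightarrow> real"
  assumes F: "\<And>n. finite (F n)" and supp: "\<And>n i. i \<notin> F n \<Longrightarrow> a n i = 0"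
    and unit: "\<And>n. (\<Sum>i\<in>F n. (a n i)\<^sup>2) = 1"
  shows "\<exists>b\<in>ell2. \<forall>n. \<bar>\<Sum>i\<in>F n. b i * a n i\<bar> \<ge> 1 / (2 * 3 ^ n)"
proof -
  \<comment> \<open>The sign of the pairing built up so far: the next term, taken with this sign,
    cannot cancel it and leaves at least 3^-n in absolute value.\<close>
  define sg :: "nat \<Rightarrow> (int \<Rightarrow> real) \<Rightarrow> real" where
    "sg n x = (if (\<Sum>i\<in>F n. x i * a n i) \<ge> 0 then 1 else - 1)" for n x
  define x where "x = rec_nat (\<lambda>i. 0) (\<lambda>n x i. x i + sg n x / 3 ^ n * a n i)"
  have x0: "x 0 = (\<lambda>i. 0)" and xS: "\<And>n i. x (Suc n) i = x n i + sg n (x n) / 3 ^ n * a n i"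
    by (simp_all add: x_def)
  define e where "e n = sg n (x n)" for n
  have e: "\<bar>e n\<bar> = 1" for n by (simp add: e_def sg_def)
  have x_sum: "x n i = (\<Sum>k<n. e k / 3 ^ k * a k i)" for n i
    by (induction n) (simp_all add: x0 xS e_def)
  have L2_le1: "L2_set (a k) G \<le> 1" if "finite G" for k G
  proof -
    have "(\<Sum>i\<in>G. (a k i)\<^sup>2) = (\<Sum>i\<in>G \<inter> F k. (a k i)\<^sup>2)"
      using that by (intro sum.mono_neutral_right) (auto simp: supp)
    also have "\<dots> \<le> 1" unfolding unit[of k, symmetric] using F by (intro sum_mono2) auto
    finally show ?thesis by (simp add: L2_set_def)
  qed
  have abs_a: "\<bar>a k i\<bar> \<le> 1" for k i
    using L2_le1[of "{i}" k] by (simp add: L2_set_def)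
  have summ: "summable (\<lambda>k. e k / 3 ^ k * a k i)" for i
  proof (rule summable_comparison_test'[of "\<lambda>k. (1/3) ^ k" 0])
    show "summable (\<lambda>k. (1/3::real) ^ k)" by (simp add: summable_geometric)
    show "norm (e k / 3 ^ k * a k i) \<le> (1/3) ^ k" for k
      using abs_a[of k i] e[of k] by (simp add: abs_mult power_divide divide_simps)
  qed
  define b where "b i = (\<Sum>k. e k / 3 ^ k * a k i)" for i
  have lim: "(\<lambda>n. x n i) \<longlonglongrightarrow> b i" for i
    unfolding x_sum b_def using summ by (rule summable_LIMSEQ)
  \<comment> \<open>The right-hand side is the partial sum of the geometric series with ratio
    1/3.\<close>
  have L2x: "L2_set (x n) G \<le> 3 / 2 * (1 - 1 / 3 ^ n)" if G: "finite G" for n G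
  proof (induction n)
    case 0 then show ?case by (simp add: x0 L2_set_def)
  next
    case (Suc n)
    have "L2_set (x (Suc n)) G \<le> L2_set (x n) G + L2_set (\<lambda>i. e n / 3 ^ n * a n i) G"
      unfolding xS e_def by (rule L2_set_triangle_ineq)
    also have "L2_set (\<lambda>i. e n / 3 ^ n * a n i) G = \<bar>e n / 3 ^ n\<bar> * L2_set (a n) G"
    proof -
      have "L2_set (\<lambda>i. e n / 3 ^ n * a n i) G = sqrt ((e n / 3 ^ n)\<^sup>2 * (\<Sum>i\<in>G. (a n i)\<^sup>2))"
        unfolding L2_set_def power_mult_distrib sum_distrib_left ..
      then show ?thesis by (simp only: real_sqrt_mult real_sqrt_abs L2_set_def)
    qed
    also have "\<dots> \<le> 1 / 3 ^ n" using L2_le1[OF G, of n] e[of n] by (simp add: divide_simps)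
    finally show ?case using Suc by (simp add: field_simps)
  qed
  have "b \<in> ell2"
  proof -
    have "(\<Sum>i\<in>G. (b i)\<^sup>2) \<le> 9 / 4" if G: "finite G" for G
    proof -
      have "(\<lambda>n. L2_set (x n) G) \<longlonglongrightarrow> L2_set b G"
        unfolding L2_set_def by (intro tendsto_intros lim)
      moreover have "L2_set (x n) G \<le> 3 / 2" for n using L2x[OF G, of n] by (rule order_trans) simp
      ultimately have "L2_set b G \<le> 3 / 2" by (intro LIMSEQ_le_const2) auto
      then have "(L2_set b G)\<^sup>2 \<le> (3 / 2)\<^sup>2" by (intro power_mono) auto
      then show ?thesis by (simp add: L2_set_def sum_nonneg power2_eq_square)
    qed
    then have "(\<lambda>i. (b i)\<^sup>2) summable_on UNIV"
      by (intro nonneg_bdd_above_summable_on bdd_aboveI[of _ "9/4"]) auto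
    then show ?thesis by (simp add: ell2_def)
  qed
  moreover have "\<bar>\<Sum>i\<in>F n. b i * a n i\<bar> \<ge> 1 / (2 * 3 ^ n)" for n
  proof -
    define d where "d k = (\<Sum>i\<in>F n. a k i * a n i)" for k
    have d: "\<bar>d k\<bar> \<le> 1" for k
    proof -
      have "(d k)\<^sup>2 \<le> (\<Sum>i\<in>F n. (a k i)\<^sup>2) * (\<Sum>i\<in>F n. (a n i)\<^sup>2)"
        unfolding d_def by (rule Cauchy_Schwarz_ineq_sum)
      also have "\<dots> = (L2_set (a k) (F n))\<^sup>2" by (simp add: unit L2_set_def sum_nonneg)
      also have "\<dots> \<le> 1" using L2_le1[OF F, of k n] by (intro power_le_one) auto
      finally show ?thesis by (simp add: abs_square_le_1)
    qed
    have dn: "d n = 1" using unit[of n] by (simp add: d_def power2_eq_square)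
    let ?f = "\<lambda>k. e k / 3 ^ k * d k"
    have summ_i: "summable (\<lambda>k. e k / 3 ^ k * a k i * a n i)" for i
      by (rule summable_mult2[OF summ])
    have f_eq: "?f k = (\<Sum>i\<in>F n. e k / 3 ^ k * a k i * a n i)" for k
      unfolding d_def sum_distrib_left by (simp add: mult.assoc)
    have summ_f: "summable ?f" unfolding f_eq using summ_i by (intro summable_sum) auto
    have "(\<Sum>i\<in>F n. b i * a n i) = (\<Sum>k. ?f k)"
      unfolding f_eq b_def using summ_i summ by (subst suminf_sum) (auto simp: suminf_mult2)
    also have "\<dots> = (\<Sum>k. ?f (k + Suc n)) + (\<Sum>k<Suc n. ?f k)"
      using summ_f by (rule suminf_split_initial_segment)
    finally have eq: "(\<Sum>i\<in>F n. b i * a n i) = (\<Sum>k. ?f (k + Suc n)) + (\<Sum>k<Suc n. ?f k)" .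
    have xn: "(\<Sum>i\<in>F n. x n i * a n i) = (\<Sum>k<n. ?f k)"
      unfolding x_sum f_eq by (subst sum.swap) (simp add: sum_distrib_right)
    have en: "e n = (if (\<Sum>k<n. ?f k) \<ge> 0 then 1 else - 1)"
      by (simp add: e_def sg_def xn)
    have head: "\<bar>\<Sum>k<Suc n. ?f k\<bar> \<ge> 1 / 3 ^ n"
      using en dn by (auto split: if_splits)
    have fb: "\<bar>?f (k + Suc n)\<bar> \<le> (1 / 3 ^ Suc n) * (1/3) ^ k" for k
      using d[of "k + Suc n"] e[of "k + Suc n"] by (simp add: abs_mult power_add divide_simps)
    have geo: "summable (\<lambda>k. (1 / 3 ^ Suc n) * (1/3::real) ^ k)"
      by (intro summable_mult summable_geometric) simp
    \<comment> \<open>The tail is at most half of the lower bound for the head. With ratio 1/2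
      instead of 1/3 it could cancel the head.\<close>
    have "\<bar>\<Sum>k. ?f (k + Suc n)\<bar> \<le> (\<Sum>k. (1 / 3 ^ Suc n) * (1/3::real) ^ k)"
      using norm_suminf_le[of "\<lambda>k. ?f (k + Suc n)", OF _ geo] fb by simp
    also have "\<dots> = (1 / 3 ^ Suc n) * (3 / 2)"
      by (subst suminf_mult) (auto simp: suminf_geometric summable_geometric)
    also have "\<dots> = 1 / (2 * 3 ^ n)" by simp
    finally have "\<bar>\<Sum>k. ?f (k + Suc n)\<bar> \<le> 1 / (2 * 3 ^ n)" .
    moreover have "1 / (2 * 3 ^ n) = 1 / 3 ^ n / (2::real)" by simp
    ultimately show ?thesis unfolding eq using head by linarith
  qed
  ultimately show ?thesis by blast
qed

text \<open>Cauchy-Schwarz for the energy contradicts the gliding hump: if \<open>b\<close> is the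
  image of \<open>y\<close>, the square of its pairing with a_n is at most the energy of a_n times
  that of \<open>y\<close>, hence at most \<Lambda> |y|^2 / 16^n, whereas the hump keeps it above 1
  / (4 * 9^n).\<close>

lemma bounded_invertible_coercive:
  assumes bdd: "bounded_on_ell2 \<sigma>" and inv: "invertible_on_ell2 \<sigma>"
    and sym: "\<And>i j. \<sigma> i j = \<sigma> j i"
    and psd: "\<And>F a. finite F \<Longrightarrow> 0 \<le> bil \<sigma> F a a"
  shows "\<exists>\<mu>>0. \<forall>F a. finite F \<longrightarrow> \<mu> * (\<Sum>i\<in>F. (a i)\<^sup>2) \<le> bil \<sigma> F a a"
proof (rule ccontr)
  assume contra: "\<not> ?thesis"
  obtain \<Lambda> where \<Lambda>: "\<Lambda> > 0" "\<And>F a. finite F \<Longrightarrow> bil \<sigma> F a a \<le> \<Lambda> * (\<Sum>i\<in>F. (a i)\<^sup>2)"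
    using bounded_on_ell2_quad_upper[OF bdd] by blast
  have "\<exists>F a. finite F \<and> (\<forall>i. i \<notin> F \<longrightarrow> a i = 0) \<and> (\<Sum>i\<in>F. (a i)\<^sup>2) = 1 \<and> bil \<sigma> F a a \<le> 1 / 16 ^ n"
    for n :: nat
  proof -
    have "\<not> ((0::real) < 1 / 16 ^ n \<and>
        (\<forall>F a. finite F \<longrightarrow> 1 / 16 ^ n * (\<Sum>i\<in>F. (a i)\<^sup>2) \<le> bil \<sigma> F a a))"
      using contra by blast
    then have "\<exists>F a. finite F \<and> bil \<sigma> F a a < 1 / 16 ^ n * (\<Sum>i\<in>F. (a i)\<^sup>2)"
      by (simp add: not_le)
    then obtain F a where F: "finite F" and a: "bil \<sigma> F a a < 1 / 16 ^ n * (\<Sum>i\<in>F. (a i)\<^sup>2)"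
      by blast
    let ?s = "\<Sum>i\<in>F. (a i)\<^sup>2"
    have s: "?s > 0"
    proof (rule ccontr)
      assume "\<not> ?s > 0"
      moreover have "?s \<ge> 0" by (intro sum_nonneg) auto
      ultimately have "?s = 0" by linarith
      then show False using a psd[OF F, of a] by simp
    qed
    define b where "b i = (if i \<in> F then a i / sqrt ?s else 0)" for i
    have "(\<Sum>i\<in>F. (b i)\<^sup>2) = (\<Sum>i\<in>F. (a i)\<^sup>2 / ?s)"
      using s by (intro sum.cong) (auto simp: b_def power_divide)
    also have "\<dots> = 1" using s by (simp add: sum_divide_distrib[symmetric])
    finally have 1: "(\<Sum>i\<in>F. (b i)\<^sup>2) = 1" .
    have "bil \<sigma> F b b = (\<Sum>i\<in>F. \<Sum>j\<in>F. a i * a j * \<sigma> i j / ?s)"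
    proof -
      have "b i * b j * \<sigma> i j = a i * a j * \<sigma> i j / ?s" if "i \<in> F" "j \<in> F" for i j
      proof -
        have "sqrt ?s * sqrt ?s = ?s" using s by simp
        moreover have "b i * b j * \<sigma> i j = a i * a j * \<sigma> i j / (sqrt ?s * sqrt ?s)"
          using that by (simp add: b_def)
        ultimately show ?thesis by simp
      qed
      then show ?thesis unfolding bil_def by (intro sum.cong refl) auto
    qed
    also have "\<dots> = bil \<sigma> F a a / ?s" by (simp add: bil_def sum_divide_distrib)
    also have "\<dots> \<le> 1 / 16 ^ n" using a s by (simp add: field_simps)
    finally show ?thesis using F 1 by (intro exI[of _ F] exI[of _ b]) (auto simp: b_def)
  qed
  then obtain F a where F: "\<And>n. finite (F n)" and supp: "\<And>n i. i \<notin> F n \<Longrightarrow> a n i = 0"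
    and unit: "\<And>n. (\<Sum>i\<in>F n. (a n i)\<^sup>2) = 1" and small: "\<And>n::nat. bil \<sigma> (F n) (a n) (a n) \<le> 1 / 16 ^ n"
    by metis
  obtain b where b: "b \<in> ell2" "\<And>n. \<bar>\<Sum>i\<in>F n. b i * a n i\<bar> \<ge> 1 / (2 * 3 ^ n)"
    using ell2_gliding_hump[of F a] F supp unit by blast
  obtain y where y: "y \<in> ell2" "b = matrix_apply \<sigma> y"
    using inv b(1) unfolding invertible_on_ell2_def bij_betw_def by blast
  let ?Y = "\<Sum>\<^sub>\<infinity>i. (y i)\<^sup>2"
  have bound: "(\<Sum>i\<in>F n. b i * a n i)\<^sup>2 \<le> \<Lambda> * ?Y / 16 ^ n" for n
  proof -
    have sm: "(\<lambda>j. \<sigma> i j * y j) summable_on UNIV" for i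
      using bdd y(1) unfolding bounded_on_ell2_def by blast
    \<comment> \<open>The vector \<open>y\<close> may have infinite support, and \<open>bil\<close>
      sees finite sets only. So the bound is shown for all finite \<open>G\<close> containing
      \<open>F n\<close> and passed to the limit along finite subsets.\<close>
    have lim: "((\<lambda>G. \<Sum>i\<in>F n. (\<Sum>j\<in>G. \<sigma> i j * y j) * a n i) \<longlongrightarrow> (\<Sum>i\<in>F n. b i * a n i))
        (finite_subsets_at_top UNIV)"
      unfolding y(2) matrix_apply_def
      by (intro tendsto_intros infsum_tendsto sm)
    have ev: "\<forall>\<^sub>F G in finite_subsets_at_top UNIV.
        (\<Sum>i\<in>F n. (\<Sum>j\<in>G. \<sigma> i j * y j) * a n i)\<^sup>2 \<le> \<Lambda> * ?Y / 16 ^ n"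
      unfolding eventually_finite_subsets_at_top
    proof (intro exI[of _ "F n"] conjI allI impI)
      fix G assume G: "finite G \<and> F n \<subseteq> G \<and> G \<subseteq> UNIV"
      have "(\<Sum>i\<in>F n. (\<Sum>j\<in>G. \<sigma> i j * y j) * a n i) = (\<Sum>i\<in>G. (\<Sum>j\<in>G. \<sigma> i j * y j) * a n i)"
        using G by (intro sum.mono_neutral_left) (auto simp: supp)
      also have "\<dots> = bil \<sigma> G (a n) y"
        unfolding bil_def sum_distrib_right by (intro sum.cong refl) (simp add: algebra_simps)
      finally have "(\<Sum>i\<in>F n. (\<Sum>j\<in>G. \<sigma> i j * y j) * a n i)\<^sup>2 = (bil \<sigma> G (a n) y)\<^sup>2" by simp
      also have "\<dots> \<le> bil \<sigma> G (a n) (a n) * bil \<sigma> G y y"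
        using sym psd G by (intro bil_Cauchy_Schwarz) auto
      also have "bil \<sigma> G (a n) (a n) = bil \<sigma> (F n) (a n) (a n)"
        using G by (intro bil_mono_neutral) (auto simp: supp)
      also have "\<dots> * bil \<sigma> G y y \<le> 1 / 16 ^ n * (\<Lambda> * ?Y)"
      proof (intro mult_mono small)
        have "bil \<sigma> G y y \<le> \<Lambda> * (\<Sum>i\<in>G. (y i)\<^sup>2)" using \<Lambda> G by auto
        also have "\<dots> \<le> \<Lambda> * ?Y"
          using \<Lambda>(1) G y(1) unfolding ell2_def by (intro mult_left_mono finite_sum_le_infsum) auto
        finally show "bil \<sigma> G y y \<le> \<Lambda> * ?Y" .
      qed (use psd G in auto)
      finally show "(\<Sum>i\<in>F n. (\<Sum>j\<in>G. \<sigma> i j * y j) * a n i)\<^sup>2 \<le> \<Lambda> * ?Y / 16 ^ n" by simp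
    qed (use F in auto)
    show ?thesis
      by (rule tendsto_upperbound[OF tendsto_power[OF lim] ev]) simp
  qed
  have "(16/9 :: real) ^ n \<le> 4 * \<Lambda> * ?Y" for n
  proof -
    have "(1 / (2 * 3 ^ n))\<^sup>2 \<le> (\<bar>\<Sum>i\<in>F n. b i * a n i\<bar>)\<^sup>2"
      by (intro power_mono b(2)) simp
    also have "\<dots> \<le> \<Lambda> * ?Y / 16 ^ n" using bound[of n] by simp
    finally have "(1 / (2 * 3 ^ n))\<^sup>2 * 16 ^ n \<le> \<Lambda> * ?Y" by (simp add: field_simps)
    moreover have "(1 / (2 * 3 ^ n))\<^sup>2 * 16 ^ n = (16/9 :: real) ^ n / 4"
    proof -
      have "((3::real) ^ n)\<^sup>2 = 9 ^ n" by (simp add: power2_eq_square power_mult_distrib[symmetric])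
      then show ?thesis by (simp add: power_divide power_mult_distrib)
    qed
    ultimately show ?thesis by simp
  qed
  moreover obtain n where "4 * \<Lambda> * ?Y < (16/9 :: real) ^ n"
    using real_arch_pow[of "16/9" "4 * \<Lambda> * ?Y"] by auto
  ultimately show False by (meson not_le)
qed

section \<open>Innovations\<close>

text \<open>The covariance of X_l with the random variable that \<open>v\<close> represents;
  orthogonality to X_l is its vanishing.\<close>

definition pairing :: "(int \<Rightarrow> int \<Rightarrow> real) \<Rightarrow> int set \<Rightarrow> (int \<Rightarrow> real) \<Rightarrow> int \<Rightarrow> real" where
  "pairing \<sigma> T v l = (\<Sum>i\<in>T. v i * \<sigma> i l)"

lemma bil_eq_pairing: "bil \<sigma> T v w = (\<Sum>l\<in>T. w l * pairing \<sigma> T v l)"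
  unfolding bil_def pairing_def by (subst sum.swap) (simp add: sum_distrib_left algebra_simps)

lemma pairing_diff: "pairing \<sigma> T (\<lambda>i. v i - w i) l = pairing \<sigma> T v l - pairing \<sigma> T w l"
  by (simp add: pairing_def algebra_simps sum_subtractf)

lemma pairing_scale: "pairing \<sigma> T (\<lambda>i. r * v i) l = r * pairing \<sigma> T v l"
  by (simp add: pairing_def sum_distrib_left mult.assoc)

text \<open>For a covariance matrix \<open>\<sigma>\<close>, a vector \<open>v\<close> stands for the random variable
  \<open>\<Sum>i. v i * X i\<close>. An innovation at \<open>k\<close> with respect to \<open>A\<close> represents \<open>X k\<close> minus its orthogonal
  projection onto the span of the \<open>X l\<close> with \<open>l \<in> A\<close>, \<open>l < k\<close>.\<close>

definition innovation :: "(int \<Rightarrow> int \<Rightarrow> real) \<Rightarrow> int set \<Rightarrow> int \<Rightarrow> (int \<Rightarrow> real) \<Rightarrow> bool" where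
  "innovation \<sigma> A k v \<longleftrightarrow> v k = 1 \<and> (\<forall>i. i \<noteq> k \<and> \<not> (i \<in> A \<and> i < k) \<longrightarrow> v i = 0) \<and>
     (\<forall>l\<in>A. l < k \<longrightarrow> pairing \<sigma> (insert k A) v l = 0)"

context
  fixes \<sigma> :: "int \<Rightarrow> int \<Rightarrow> real" and T :: "int set" and A :: "int set" and k :: int and v :: "int \<Rightarrow> real"
  assumes T: "finite T" "A \<subseteq> T" "k \<in> T" and v: "innovation \<sigma> A k v"
begin

text \<open>An innovation is supported in \<open>insert k A\<close>, so the ambient index set may be
  enlarged. Innovations with respect to different sets can thus be compared inside one
  \<open>T\<close>.\<close>

lemma innovation_pairing: "pairing \<sigma> T v l = pairing \<sigma> (insert k A) v l"
  unfolding pairing_def using T v unfolding innovation_def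
  by (intro sum.mono_neutral_right) auto

lemma innovation_orthogonal:
  assumes "\<And>l. l \<in> T \<Longrightarrow> \<not> (l \<in> A \<and> l < k) \<Longrightarrow> w l = 0"
  shows "bil \<sigma> T v w = 0"
  unfolding bil_eq_pairing
proof (rule sum.neutral, rule ballI)
  fix l assume "l \<in> T"
  then show "w l * pairing \<sigma> T v l = 0"
    using assms[of l] innovation_pairing[of l] v unfolding innovation_def
    by (cases "l \<in> A \<and> l < k") auto
qed

text \<open>An innovation is orthogonal to every other coordinate it involves and has coefficient 1
  at \<open>k\<close>, so a single term survives.\<close>

lemma innovation_variance: "bil \<sigma> T v v = pairing \<sigma> T v k"
proof -
  have "bil \<sigma> T v v = (\<Sum>l\<in>{k}. v l * pairing \<sigma> T v l)"
    unfolding bil_eq_pairing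
  proof (rule sum.mono_neutral_right)
    show "\<forall>i\<in>T - {k}. v i * pairing \<sigma> T v i = 0"
    proof
      fix i assume "i \<in> T - {k}"
      then show "v i * pairing \<sigma> T v i = 0"
        using innovation_pairing[of i] v unfolding innovation_def
        by (cases "i \<in> A \<and> i < k") auto
    qed
  qed (use T in auto)
  then show ?thesis using v by (simp add: innovation_def)
qed

end

locale covariance_form =
  fixes \<sigma> :: "int \<Rightarrow> int \<Rightarrow> real" and \<mu> \<Lambda> :: real
  assumes sym: "\<sigma> i j = \<sigma> j i"
    and \<mu>_pos: "\<mu> > 0" and \<Lambda>_pos: "\<Lambda> > 0"
    and lower: "finite F \<Longrightarrow> \<mu> * (\<Sum>i\<in>F. (a i)\<^sup>2) \<le> bil \<sigma> F a a"
    and upper: "finite F \<Longrightarrow> bil \<sigma> F a a \<le> \<Lambda> * (\<Sum>i\<in>F. (a i)\<^sup>2)"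
begin

lemma psd: "finite F \<Longrightarrow> 0 \<le> bil \<sigma> F a a"
  using lower[of F a] \<mu>_pos by (meson mult_nonneg_nonneg order.trans order_less_imp_le sum_nonneg zero_le_power2)

text \<open>Gram-Schmidt, one index at a time: a residual over \<open>A\<close> is corrected by a
  multiple of the residual of the new coordinate \<open>b\<close>. Coercivity keeps the latter
  nonzero, because its coefficient at \<open>b\<close> stays 1. The induction hypothesis is applied
  to two vectors, hence \<open>arbitrary: v\<close>.\<close>

lemma exists_residual:
  assumes "finite T" "A \<subseteq> T"
  shows "\<exists>w. (\<forall>i. i \<notin> A \<longrightarrow> w i = v i) \<and> (\<forall>l\<in>A. pairing \<sigma> T w l = 0)"
proof -
  have "finite A" using assms finite_subset by blast
  then show ?thesis using assms(2)
  proof (induction A arbitrary: v rule: finite_induct)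
    case empty
    then show ?case by auto
  next
    case (insert b A)
    define \<delta> where "\<delta> i = (if i = b then 1 else 0 :: real)" for i
    obtain u where u: "\<And>i. i \<notin> A \<Longrightarrow> u i = \<delta> i" "\<And>l. l \<in> A \<Longrightarrow> pairing \<sigma> T u l = 0"
      using insert.IH[of \<delta>] insert.prems by auto
    obtain w where w: "\<And>i. i \<notin> A \<Longrightarrow> w i = v i" "\<And>l. l \<in> A \<Longrightarrow> pairing \<sigma> T w l = 0"
      using insert.IH[of v] insert.prems by auto
    have ub: "u b = 1" using u(1)[of b] insert by (simp add: \<delta>_def)
    have bT: "b \<in> T" using insert by simp
    have "bil \<sigma> T u u = (\<Sum>l\<in>{b}. u l * pairing \<sigma> T u l)"
      unfolding bil_eq_pairing
    proof (rule sum.mono_neutral_right)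
      show "\<forall>i\<in>T - {b}. u i * pairing \<sigma> T u i = 0"
      proof
        fix i assume "i \<in> T - {b}"
        then show "u i * pairing \<sigma> T u i = 0" using u[of i] by (cases "i \<in> A") (auto simp: \<delta>_def)
      qed
    qed (use assms bT in auto)
    also have "\<dots> = pairing \<sigma> T u b" by (simp add: ub)
    finally have "bil \<sigma> T u u = pairing \<sigma> T u b" .
    moreover have "\<mu> * (u b)\<^sup>2 \<le> \<mu> * (\<Sum>i\<in>T. (u i)\<^sup>2)"
      using \<mu>_pos assms bT by (intro mult_left_mono member_le_sum) auto
    ultimately have "\<mu> * (u b)\<^sup>2 \<le> pairing \<sigma> T u b"
      using lower[OF assms(1), of u] by linarith
    then have pos: "pairing \<sigma> T u b > 0" using ub \<mu>_pos by simp
    \<comment> \<open>The denominator is the variance of \<open>u\<close>; the correction becomes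
      orthogonal to X_b as well.\<close>
    define t where "t = pairing \<sigma> T w b / pairing \<sigma> T u b"
    have "pairing \<sigma> T (\<lambda>i. w i - t * u i) l = 0" if "l \<in> insert b A" for l
      using that u(2) w(2) pos unfolding pairing_diff pairing_scale by (auto simp: t_def)
    then show ?case
      using u(1) w(1) by (intro exI[of _ "\<lambda>i. w i - t * u i"]) (auto simp: \<delta>_def)
  qed
qed

lemma exists_innovation:
  assumes "finite A" shows "\<exists>v. innovation \<sigma> A k v"
proof -
  obtain w where w: "\<And>i. \<not> (i \<in> A \<and> i < k) \<Longrightarrow> w i = (if i = k then 1 else 0)"
    "\<And>l. l \<in> A \<and> l < k \<Longrightarrow> pairing \<sigma> (insert k A) w l = 0"
    using exists_residual[of "insert k A" "{l\<in>A. l < k}" "\<lambda>i. if i = k then 1 else 0"] assms by auto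
  then show ?thesis unfolding innovation_def by (intro exI[of _ w]) auto
qed

lemma sum_sq_le: "finite F \<Longrightarrow> (\<Sum>i\<in>F. (a i)\<^sup>2) \<le> bil \<sigma> F a a / \<mu>"
  using lower[of F a] \<mu>_pos by (simp add: field_simps)

context
  fixes T :: "int set" and A :: "int set" and k :: int and v :: "int \<Rightarrow> real"
  assumes T: "finite T" "A \<subseteq> T" "k \<in> T" and v: "innovation \<sigma> A k v"
begin

lemma innovation_variance_lower: "\<mu> \<le> bil \<sigma> T v v"
proof -
  have "\<mu> * (v k)\<^sup>2 \<le> \<mu> * (\<Sum>i\<in>T. (v i)\<^sup>2)"
    using \<mu>_pos T by (intro mult_left_mono member_le_sum) auto
  then show ?thesis using lower[OF T(1), of v] v by (auto simp: innovation_def)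
qed

text \<open>Projection does not increase variance: the covariance of the innovation with X_k is its
  own variance, so Cauchy-Schwarz bounds it by the variance of X_k.\<close>

lemma innovation_variance_upper: "bil \<sigma> T v v \<le> \<Lambda>"
proof -
  define \<delta> where "\<delta> i = (if i = k then 1 else 0 :: real)" for i
  have *: "bil \<sigma> T v \<delta> = pairing \<sigma> T v k"
    unfolding bil_eq_pairing \<delta>_def using T by (simp add: if_distrib[of "\<lambda>x. x * _"] sum.delta cong: if_cong)
  have "(bil \<sigma> T v v)\<^sup>2 \<le> bil \<sigma> T v v * bil \<sigma> T \<delta> \<delta>"
    using bil_Cauchy_Schwarz[of \<sigma> T v \<delta>] sym psd[OF T(1)] unfolding * innovation_variance[OF T v] by blast
  moreover have pos: "bil \<sigma> T v v > 0" using innovation_variance_lower \<mu>_pos by linarith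
  ultimately have "bil \<sigma> T v v \<le> bil \<sigma> T \<delta> \<delta>" by (simp add: power2_eq_square)
  also have "\<dots> \<le> \<Lambda> * (\<Sum>i\<in>T. (\<delta> i)\<^sup>2)" by (rule upper[OF T(1)])
  also have "(\<Sum>i\<in>T. (\<delta> i)\<^sup>2) = 1" using T by (simp add: \<delta>_def if_distrib[of "\<lambda>x. x\<^sup>2"] sum.delta cong: if_cong)
  finally show ?thesis by simp
qed

end

section \<open>Bessel's inequality and the logarithms of variance ratios\<close>

text \<open>Let a_k be the covariances and \<alpha> the sum of their squares. The innovations are
  orthogonal with variances at most \<Lambda>, so w = sum a_k e_k has variance at most \<Lambda>
  \<alpha>, and by coercivity squared coefficient norm at most \<Lambda> \<alpha> / \<mu>. Since
  \<alpha> is the covariance of w with X_l, Cauchy-Schwarz against the row of \<sigma> gives a bound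
  on \<alpha>^2 with a factor \<alpha> to cancel.\<close>

lemma innovations_Bessel:
  assumes T: "finite T" "J \<subseteq> T" and e: "\<And>k. k \<in> J \<Longrightarrow> innovation \<sigma> J k (e k)"
  shows "(\<Sum>k\<in>J. (pairing \<sigma> T (e k) l)\<^sup>2) \<le> \<Lambda> / \<mu> * (\<Sum>j\<in>J. (\<sigma> l j)\<^sup>2)"
proof -
  have J: "finite J" using T finite_subset by blast
  define a where "a k = pairing \<sigma> T (e k) l" for k
  define w where "w i = (\<Sum>k\<in>J. a k * e k i)" for i
  define \<alpha> where "\<alpha> = (\<Sum>k\<in>J. (a k)\<^sup>2)"
  have \<alpha>0: "\<alpha> \<ge> 0" by (simp add: \<alpha>_def sum_nonneg)
  \<comment> \<open>The earlier of two innovations is supported on indices before the later one, to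
    which the later one is orthogonal.\<close>
  have orth: "bil \<sigma> T (e k) (e k') = 0" if "k \<in> J" "k' \<in> J" "k \<noteq> k'" for k k'
  proof -
    have *: "bil \<sigma> T (e k) (e k') = 0" if "k \<in> J" "k' \<in> J" "k' < k" for k k'
    proof (rule innovation_orthogonal[OF T _ e])
      fix l assume "l \<in> T" "\<not> (l \<in> J \<and> l < k)"
      then show "e k' l = 0" using e[OF that(2)] that by (auto simp: innovation_def)
    qed (use that T in auto)
    show ?thesis using *[of k k'] *[of k' k] that bil_commute[of \<sigma> T "e k" "e k'"] sym
      by (cases "k < k'") auto
  qed
  have w_supp: "w i = 0" if "i \<notin> J" for i
    unfolding w_def
  proof (rule sum.neutral, rule ballI)
    fix k assume "k \<in> J"
    then have "e k i = 0" using e[of k] that by (auto simp: innovation_def)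
    then show "a k * e k i = 0" by simp
  qed
  have bil_sum: "bil \<sigma> T w w = (\<Sum>k\<in>J. \<Sum>k'\<in>J. a k * a k' * bil \<sigma> T (e k) (e k'))"
  proof -
    have "bil \<sigma> T w w = (\<Sum>i\<in>T. \<Sum>j\<in>T. \<Sum>k\<in>J. \<Sum>k'\<in>J. a k * a k' * (e k i * e k' j * \<sigma> i j))"
      unfolding bil_def w_def sum_product by (simp add: sum_distrib_right mult.assoc mult.left_commute)
    also have "\<dots> = (\<Sum>i\<in>T. \<Sum>k\<in>J. \<Sum>j\<in>T. \<Sum>k'\<in>J. a k * a k' * (e k i * e k' j * \<sigma> i j))"
      by (intro sum.cong refl sum.swap)
    also have "\<dots> = (\<Sum>k\<in>J. \<Sum>i\<in>T. \<Sum>j\<in>T. \<Sum>k'\<in>J. a k * a k' * (e k i * e k' j * \<sigma> i j))"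
      by (rule sum.swap)
    also have "\<dots> = (\<Sum>k\<in>J. \<Sum>i\<in>T. \<Sum>k'\<in>J. \<Sum>j\<in>T. a k * a k' * (e k i * e k' j * \<sigma> i j))"
      by (intro sum.cong refl sum.swap)
    also have "\<dots> = (\<Sum>k\<in>J. \<Sum>k'\<in>J. \<Sum>i\<in>T. \<Sum>j\<in>T. a k * a k' * (e k i * e k' j * \<sigma> i j))"
      by (intro sum.cong refl sum.swap)
    finally show ?thesis unfolding bil_def by (simp add: sum_distrib_left)
  qed
  have "bil \<sigma> T w w = (\<Sum>k\<in>J. (a k)\<^sup>2 * bil \<sigma> T (e k) (e k))"
    unfolding bil_sum
  proof (rule sum.cong[OF refl])
    fix k assume k: "k \<in> J"
    have "(\<Sum>k'\<in>J. a k * a k' * bil \<sigma> T (e k) (e k')) = (\<Sum>k'\<in>{k}. a k * a k' * bil \<sigma> T (e k) (e k'))"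
      using J k by (intro sum.mono_neutral_right) (auto simp: orth)
    then show "(\<Sum>k'\<in>J. a k * a k' * bil \<sigma> T (e k) (e k')) = (a k)\<^sup>2 * bil \<sigma> T (e k) (e k)"
      by (simp add: power2_eq_square)
  qed
  also have "\<dots> \<le> (\<Sum>k\<in>J. (a k)\<^sup>2 * \<Lambda>)"
    using e T by (intro sum_mono mult_left_mono innovation_variance_upper[where A = J]) auto
  finally have ww: "bil \<sigma> T w w \<le> \<Lambda> * \<alpha>" by (simp add: \<alpha>_def sum_distrib_left mult.commute)
  have "\<alpha> = (\<Sum>k\<in>J. a k * (\<Sum>i\<in>T. e k i * \<sigma> i l))"
    unfolding \<alpha>_def by (simp add: a_def pairing_def power2_eq_square)
  also have "\<dots> = (\<Sum>i\<in>T. w i * \<sigma> i l)"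
    unfolding w_def sum_distrib_left sum_distrib_right by (subst sum.swap) (simp add: mult.assoc)
  also have "\<dots> = (\<Sum>i\<in>J. w i * \<sigma> l i)"
    using T by (subst sum.mono_neutral_right[of T J]) (auto simp: w_supp sym[of l])
  finally have "\<alpha>\<^sup>2 = (\<Sum>i\<in>J. w i * \<sigma> l i)\<^sup>2" by simp
  also have "\<dots> \<le> (\<Sum>i\<in>J. (w i)\<^sup>2) * (\<Sum>i\<in>J. (\<sigma> l i)\<^sup>2)" by (rule Cauchy_Schwarz_ineq_sum)
  also have "\<dots> \<le> (\<Lambda> * \<alpha> / \<mu>) * (\<Sum>i\<in>J. (\<sigma> l i)\<^sup>2)"
  proof (intro mult_right_mono)
    have "(\<Sum>i\<in>J. (w i)\<^sup>2) = (\<Sum>i\<in>T. (w i)\<^sup>2)"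
      using T by (intro sum.mono_neutral_left) (auto simp: w_supp)
    also have "\<dots> \<le> bil \<sigma> T w w / \<mu>" by (rule sum_sq_le[OF T(1)])
    also have "\<dots> \<le> \<Lambda> * \<alpha> / \<mu>" using ww \<mu>_pos by (simp add: divide_right_mono)
    finally show "(\<Sum>i\<in>J. (w i)\<^sup>2) \<le> \<Lambda> * \<alpha> / \<mu>" .
  qed (auto intro: sum_nonneg)
  finally have "\<alpha> * \<alpha> \<le> \<alpha> * (\<Lambda> / \<mu> * (\<Sum>i\<in>J. (\<sigma> l i)\<^sup>2))" by (simp add: power2_eq_square field_simps)
  then have "\<alpha> \<le> \<Lambda> / \<mu> * (\<Sum>i\<in>J. (\<sigma> l i)\<^sup>2)"
  proof (cases "\<alpha> = 0")
    case True
    then show ?thesis using \<mu>_pos \<Lambda>_pos by (simp add: sum_nonneg)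
  next
    case False
    then have "\<alpha> > 0" using \<alpha>0 by simp
    with \<open>\<alpha> * \<alpha> \<le> _\<close> show ?thesis by (rule mult_left_le_imp_le)
  qed
  then show ?thesis by (simp add: \<alpha>_def a_def)
qed

text \<open>The difference v = e' - e is orthogonal to e, so the variances satisfy Var e' = Var e +
  Var v, and ln x \<le> x - 1 leaves Var v / Var e. Of the three factors 1 / \<mu>, one bounds the
  coefficients of v, one bounds 1 / Var e, and one comes together with \<Lambda> from
  \<open>innovations_Bessel\<close>.\<close>

lemma sum_ln_innovation_variance_le:
  assumes fin: "finite I" "finite J" and less: "\<And>i j. i \<in> I \<Longrightarrow> j \<in> J \<Longrightarrow> i < j"
    and e: "\<And>k. k \<in> J \<Longrightarrow> innovation \<sigma> (I \<union> J) k (e k)"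
    and e': "\<And>k. k \<in> J \<Longrightarrow> innovation \<sigma> J k (e' k)"
  shows "(\<Sum>k\<in>J. ln (bil \<sigma> (I \<union> J) (e' k) (e' k) / bil \<sigma> (I \<union> J) (e k) (e k)))
    \<le> \<Lambda> / \<mu> ^ 3 * (\<Sum>i\<in>I. \<Sum>j\<in>J. (\<sigma> i j)\<^sup>2)"
proof -
  let ?T = "I \<union> J"
  have T: "finite ?T" using fin by simp
  have step: "ln (bil \<sigma> ?T (e' k) (e' k) / bil \<sigma> ?T (e k) (e k)) \<le> (\<Sum>l\<in>I. (pairing \<sigma> ?T (e' k) l)\<^sup>2) / \<mu>\<^sup>2"
    if k: "k \<in> J" for k
  proof -
    let ?s = "bil \<sigma> ?T (e k) (e k)" and ?t = "bil \<sigma> ?T (e' k) (e' k)"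
    let ?S = "\<Sum>l\<in>I. (pairing \<sigma> ?T (e' k) l)\<^sup>2"
    define v where "v i = e' k i - e k i" for i
    let ?v = "bil \<sigma> ?T v v"
    have v_supp: "v l = 0" if "\<not> (l \<in> ?T \<and> l < k)" for l
    proof -
      have "e k l = e' k l"
        using that e[OF k] e'[OF k] unfolding innovation_def by (cases "l = k") auto
      then show ?thesis by (simp add: v_def)
    qed
    have ev: "bil \<sigma> ?T (e k) v = 0"
      using T k by (intro innovation_orthogonal[OF _ _ _ e] v_supp) auto
    have split: "e' k = (\<lambda>i. e k i + v i)" by (auto simp: v_def)
    have t_eq: "?t = ?s + ?v"
      unfolding split using ev bil_commute[of \<sigma> ?T "e k" v] sym
      by (simp add: bil_add_left bil_add_right)
    have s: "\<mu> \<le> ?s" by (rule innovation_variance_lower[OF T _ _ e]) (use k in auto)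
    \<comment> \<open>Here e' is orthogonal to the earlier future, so only its covariances with the
      past contribute to the variance of \<open>v\<close>.\<close>
    have "?v = bil \<sigma> ?T (e' k) v"
      unfolding split by (simp add: bil_add_left ev)
    also have "\<dots> = (\<Sum>l\<in>I. v l * pairing \<sigma> ?T (e' k) l)"
      unfolding bil_eq_pairing
    proof (rule sum.mono_neutral_right[OF T])
      show "\<forall>i\<in>?T - I. v i * pairing \<sigma> ?T (e' k) i = 0"
      proof
        fix i assume i: "i \<in> ?T - I"
        show "v i * pairing \<sigma> ?T (e' k) i = 0"
        proof (cases "i < k")
          case True
          then have "pairing \<sigma> ?T (e' k) i = 0"
            using innovation_pairing[OF T _ _ e'[OF k], of i] e'[OF k] i k by (auto simp: innovation_def)
          then show ?thesis by simp
        qed (auto simp: v_supp)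
      qed
    qed auto
    finally have "?v\<^sup>2 = (\<Sum>l\<in>I. v l * pairing \<sigma> ?T (e' k) l)\<^sup>2" by simp
    also have "\<dots> \<le> (\<Sum>l\<in>I. (v l)\<^sup>2) * ?S" by (rule Cauchy_Schwarz_ineq_sum)
    also have "\<dots> \<le> (?v / \<mu>) * ?S"
    proof (intro mult_right_mono)
      have "(\<Sum>l\<in>I. (v l)\<^sup>2) \<le> (\<Sum>l\<in>?T. (v l)\<^sup>2)" using T by (intro sum_mono2) auto
      also have "\<dots> \<le> ?v / \<mu>" by (rule sum_sq_le[OF T])
      finally show "(\<Sum>l\<in>I. (v l)\<^sup>2) \<le> ?v / \<mu>" .
    qed (auto intro: sum_nonneg)
    finally have "?v * ?v \<le> ?v * (?S / \<mu>)" by (simp add: power2_eq_square)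
    then have v_le: "?v \<le> ?S / \<mu>"
    proof (cases "?v = 0")
      case True
      then show ?thesis using \<mu>_pos by (simp add: sum_nonneg)
    next
      case False
      then have "?v > 0" using psd[OF T, of v] by simp
      with \<open>?v * ?v \<le> ?v * (?S / \<mu>)\<close> show ?thesis by (rule mult_left_le_imp_le)
    qed
    have "ln (?t / ?s) \<le> ?t / ?s - 1"
      using s t_eq psd[OF T, of v] \<mu>_pos by (intro ln_le_minus_one divide_pos_pos) linarith+
    also have "\<dots> = ?v / ?s" using s \<mu>_pos by (simp add: t_eq field_simps)
    also have "\<dots> \<le> (?S / \<mu>) / \<mu>"
      using v_le s psd[OF T, of v] \<mu>_pos by (intro frac_le) auto
    finally show ?thesis by (simp add: power2_eq_square)
  qed
  have "(\<Sum>k\<in>J. ln (bil \<sigma> ?T (e' k) (e' k) / bil \<sigma> ?T (e k) (e k)))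
    \<le> (\<Sum>k\<in>J. (\<Sum>l\<in>I. (pairing \<sigma> ?T (e' k) l)\<^sup>2) / \<mu>\<^sup>2)"
    by (intro sum_mono step)
  \<comment> \<open>With the sum over the future innermost, Bessel's inequality applies for each
    past index \<open>l\<close>.\<close>
  also have "\<dots> = (\<Sum>l\<in>I. \<Sum>k\<in>J. (pairing \<sigma> ?T (e' k) l)\<^sup>2) / \<mu>\<^sup>2"
    by (subst sum.swap) (simp add: sum_divide_distrib)
  also have "\<dots> \<le> (\<Sum>l\<in>I. \<Lambda> / \<mu> * (\<Sum>j\<in>J. (\<sigma> l j)\<^sup>2)) / \<mu>\<^sup>2"
    using T e' by (intro divide_right_mono sum_mono innovations_Bessel) auto
  also have "\<dots> = \<Lambda> / \<mu> ^ 3 * (\<Sum>i\<in>I. \<Sum>j\<in>J. (\<sigma> i j)\<^sup>2)"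
    by (simp add: sum_distrib_left sum_divide_distrib power2_eq_square power3_eq_cube mult.assoc)
  finally show ?thesis .
qed

end

section \<open>Uniqueness of characteristic functionals\<close>

lemma integrable_bounded_iexp:
  assumes "finite_measure M" and [measurable]: "p \<in> borel_measurable M" "g \<in> borel_measurable M"
    and "\<And>x. x \<in> space M \<Longrightarrow> \<bar>p x\<bar> \<le> C"
  shows "integrable M (\<lambda>x. complex_of_real (p x) * iexp (g x))"
proof -
  interpret finite_measure M by fact
  show ?thesis
    by (rule integrable_const_bound[of _ C]) (auto simp: norm_mult assms)
qed

text \<open>Divided by its mass \<open>c\<close>, a bounded nonnegative weight is a probability
  density, and the uniqueness theorem on the line applies to the images. At t = 0 the hypothesis
  says that both masses agree; if they are 0, both weights vanish almost everywhere.\<close>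

lemma Levy_uniqueness_weighted:
  assumes "prob_space M" "prob_space N"
    and [measurable]: "u \<in> borel_measurable M" "Y \<in> borel_measurable M"
      "w \<in> borel_measurable N" "Z \<in> borel_measurable N"
    and u: "\<And>x. 0 \<le> u x" "\<And>x. u x \<le> C" and w: "\<And>x. 0 \<le> w x" "\<And>x. w x \<le> C"
    and eq: "\<And>t. (CLINT x|M. complex_of_real (u x) * iexp (t * Y x)) =
      (CLINT x|N. complex_of_real (w x) * iexp (t * Z x))"
    and B[measurable]: "B \<in> sets borel"
  shows "(LINT x|M. u x * indicator B (Y x)) = (LINT x|N. w x * indicator B (Z x))"
proof -
  interpret M: prob_space M by fact
  interpret N: prob_space N by fact
  have iu: "integrable M u" using u by (intro M.integrable_const_bound[of _ C]) auto
  have iw: "integrable N w" using w by (intro N.integrable_const_bound[of _ C]) auto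
  define c where "c = (LINT x|M. u x)"
  have cw: "c = (LINT x|N. w x)" using eq[of 0] by (simp add: c_def)
  have c0: "c \<ge> 0" unfolding c_def using u by (intro integral_nonneg_AE) auto
  show ?thesis
  proof (cases "c = 0")
    case True
    have "AE x in M. u x = 0" using True u iu integral_nonneg_eq_0_iff_AE[of M u] by (auto simp: c_def)
    then have "(LINT x|M. u x * indicator B (Y x)) = (LINT x|M. 0)"
      by (intro integral_cong_AE) auto
    moreover have "AE x in N. w x = 0" using True w iw integral_nonneg_eq_0_iff_AE[of N w] by (auto simp: cw)
    then have "(LINT x|N. w x * indicator B (Z x)) = (LINT x|N. 0)"
      by (intro integral_cong_AE) auto
    ultimately show ?thesis by simp
  next
    case False
    then have c: "c > 0" using c0 by simp
    have norm: "real_distribution (distr (density L (\<lambda>x. v x / c)) borel V)"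
      if [measurable]: "v \<in> borel_measurable L" "V \<in> borel_measurable L" and "\<And>x. 0 \<le> v x" "integrable L v"
        "c = (LINT x|L. v x)" for L and v V :: "'x \<Rightarrow> real"
    proof -
      have "emeasure (density L (\<lambda>x. v x / c)) (space L) = (\<integral>\<^sup>+x. ennreal (v x / c) \<partial>L)"
        by (subst emeasure_density) (auto intro!: nn_integral_cong)
      also have "\<dots> = ennreal (LINT x|L. v x / c)"
        using that c by (intro nn_integral_eq_integral) auto
      also have "\<dots> = 1" using that(5) c by simp
      finally have "prob_space (density L (\<lambda>x. v x / c))" by (intro prob_spaceI) simp
      then have "prob_space (distr (density L (\<lambda>x. v x / c)) borel V)"
        by (rule prob_space.prob_space_distr) simp
      then show ?thesis by (simp add: real_distribution_def real_distribution_axioms_def)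
    qed
    have char: "char (distr (density L (\<lambda>x. v x / c)) borel V) t =
        (CLINT x|L. complex_of_real (v x) * iexp (t * V x)) / c"
      if [measurable]: "v \<in> borel_measurable L" "V \<in> borel_measurable L" and "\<And>x. 0 \<le> v x"
      for L t and v V :: "'x \<Rightarrow> real"
    proof -
      have "char (distr (density L (\<lambda>x. v x / c)) borel V) t
          = (CLINT x|L. (v x / c) *\<^sub>R iexp (t * V x))"
        unfolding char_def using c that
        by (subst integral_distr, simp, simp) (subst integral_density, auto)
      also have "\<dots> = (CLINT x|L. complex_of_real (v x) * iexp (t * V x) / c)"
        by (simp add: scaleR_conv_of_real)
      finally show ?thesis by simp
    qed
    have "distr (density M (\<lambda>x. u x / c)) borel Y = distr (density N (\<lambda>x. w x / c)) borel Z"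
    proof (rule Levy_uniqueness)
      show "char (distr (density M (\<lambda>x. u x / c)) borel Y) = char (distr (density N (\<lambda>x. w x / c)) borel Z)"
        by (rule ext) (simp only: char[OF _ _ u(1)] char[OF _ _ w(1)] eq assms)
      show "real_distribution (distr (density M (\<lambda>x. u x / c)) borel Y)"
        by (rule norm) (use u iu in \<open>auto simp: c_def\<close>)
      show "real_distribution (distr (density N (\<lambda>x. w x / c)) borel Z)"
        by (rule norm) (use w iw cw in auto)
    qed
    then have "measure (distr (density M (\<lambda>x. u x / c)) borel Y) B
      = measure (distr (density N (\<lambda>x. w x / c)) borel Z) B" by simp
    moreover have meas: "measure (distr (density L (\<lambda>x. v x / c)) borel V) B
        = (LINT x|L. v x * indicator B (V x)) / c"
      if [measurable]: "v \<in> borel_measurable L" "V \<in> borel_measurable L" and "\<And>x. 0 \<le> v x" "integrable L v"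
      for L and v V :: "'x \<Rightarrow> real"
    proof -
      have "measure (distr (density L (\<lambda>x. v x / c)) borel V) B
          = (LINT x|distr (density L (\<lambda>x. v x / c)) borel V. indicator B x)"
        by simp
      also have "\<dots> = (LINT x|L. (v x / c) *\<^sub>R indicator B (V x))"
        using c that by (subst integral_distr, simp, simp) (subst integral_density, auto)
      finally show ?thesis by simp
    qed
    ultimately show ?thesis
      using c meas[of u M Y] meas[of w N Z] u(1) w(1) iu iw by simp
  qed
qed

text \<open>The coordinates in \<open>C\<close> are moved to \<open>D\<close> one at a time: against the nonnegative weights
  \<open>1 + cos (s + \<theta>)\<close>, the one-dimensional uniqueness theorem applies to the next coordinate.\<close>

lemma char_functional_uniqueness_boxes:
  fixes f :: "'i \<Rightarrow> 'a \<Rightarrow> real" and g :: "'i \<Rightarrow> 'b \<Rightarrow> real"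
  assumes M: "prob_space M" and N: "prob_space N"
    and f: "\<And>k. k \<in> D \<union> C \<Longrightarrow> f k \<in> borel_measurable M"
    and g: "\<And>k. k \<in> D \<union> C \<Longrightarrow> g k \<in> borel_measurable N"
    and fin: "finite D" "finite C" and disj: "D \<inter> C = {}"
    and eq: "\<And>a. (CLINT x|M. iexp (\<Sum>k\<in>D \<union> C. a k * f k x)) = (CLINT x|N. iexp (\<Sum>k\<in>D \<union> C. a k * g k x))"
    and B: "\<And>k. B k \<in> sets borel"
  shows "(CLINT x|M. complex_of_real (\<Prod>k\<in>D. indicator (B k) (f k x)) * iexp (\<Sum>k\<in>C. a k * f k x)) =
    (CLINT x|N. complex_of_real (\<Prod>k\<in>D. indicator (B k) (g k x)) * iexp (\<Sum>k\<in>C. a k * g k x))"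
  using fin(1) fin(2) f g disj eq
proof (induction D arbitrary: C a rule: finite_induct)
  case empty
  then show ?case by simp
next
  case (insert d D)
  interpret M: prob_space M by fact
  interpret N: prob_space N by fact
  have [measurable]: "f k \<in> borel_measurable M" if "k \<in> insert d (D \<union> C)" for k using that insert.prems by auto
  have [measurable]: "g k \<in> borel_measurable N" if "k \<in> insert d (D \<union> C)" for k using that insert.prems by auto
  have [measurable]: "f d \<in> borel_measurable M" "g d \<in> borel_measurable N"
    "B k \<in> sets borel" for k using B by auto
  have dC: "d \<notin> C" "d \<notin> D" using insert by auto
  define p where "p x = (\<Prod>k\<in>D. indicator (B k) (f k x) :: real)" for x
  define q where "q x = (\<Prod>k\<in>D. indicator (B k) (g k x) :: real)" for x
  have pm[measurable]: "p \<in> borel_measurable M" and qm[measurable]: "q \<in> borel_measurable N"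
    unfolding p_def[abs_def] q_def[abs_def] by auto
  have p01: "0 \<le> p x" "p x \<le> 1" for x unfolding p_def by (auto intro!: prod_nonneg prod_le_1)
  have q01: "0 \<le> q x" "q x \<le> 1" for x unfolding q_def by (auto intro!: prod_nonneg prod_le_1)
  define s where "s a x = (\<Sum>k\<in>C. a k * f k x)" for a x
  define r where "r a x = (\<Sum>k\<in>C. a k * g k x)" for a x
  have [measurable]: "s a \<in> borel_measurable M" "r a \<in> borel_measurable N" for a
    unfolding s_def[abs_def] r_def[abs_def] by auto
  \<comment> \<open>In the induction hypothesis \<open>d\<close> is still among the frequencies: it
    is used for \<open>insert d C\<close> with a free coefficient \<open>t\<close> at
    \<open>d\<close>.\<close>
  have base: "(CLINT x|M. complex_of_real (p x) * iexp (t * f d x + s a x)) =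
      (CLINT x|N. complex_of_real (q x) * iexp (t * g d x + r a x))" for t a
  proof -
    have sum1: "(\<Sum>k\<in>insert d C. (a(d := t)) k * f k x) = t * f d x + s a x" for x
      using dC insert.prems(1) unfolding s_def by (subst sum.insert) (auto intro!: sum.cong)
    have sum2: "(\<Sum>k\<in>insert d C. (a(d := t)) k * g k x) = t * g d x + r a x" for x
      using dC insert.prems(1) unfolding r_def by (subst sum.insert) (auto intro!: sum.cong)
    show ?thesis
      using insert.IH[of "insert d C" "a(d := t)"] insert.prems dC
      unfolding sum1 sum2 p_def[symmetric] q_def[symmetric] by auto
  qed
  have trig: "(LINT x|M. p x * (1 + cos (s a x + \<theta>)) * indicator (B d) (f d x)) =
      (LINT x|N. q x * (1 + cos (r a x + \<theta>)) * indicator (B d) (g d x))" for a \<theta>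
  proof (rule Levy_uniqueness_weighted[where C = 2])
    show "0 \<le> p x * (1 + cos (s a x + \<theta>))" "p x * (1 + cos (s a x + \<theta>)) \<le> 2" for x
    proof -
      have c: "0 \<le> 1 + cos (s a x + \<theta>)" "1 + cos (s a x + \<theta>) \<le> 2"
        using cos_ge_minus_one[of "s a x + \<theta>"] cos_le_one[of "s a x + \<theta>"] by linarith+
      show "0 \<le> p x * (1 + cos (s a x + \<theta>))" using p01 c by (intro mult_nonneg_nonneg)
      show "p x * (1 + cos (s a x + \<theta>)) \<le> 2" using mult_mono[OF p01(2) c(2)] p01 c by simp
    qed
    show "0 \<le> q x * (1 + cos (r a x + \<theta>))" "q x * (1 + cos (r a x + \<theta>)) \<le> 2" for x
    proof -
      have c: "0 \<le> 1 + cos (r a x + \<theta>)" "1 + cos (r a x + \<theta>) \<le> 2"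
        using cos_ge_minus_one[of "r a x + \<theta>"] cos_le_one[of "r a x + \<theta>"] by linarith+
      show "0 \<le> q x * (1 + cos (r a x + \<theta>))" using q01 c by (intro mult_nonneg_nonneg)
      show "q x * (1 + cos (r a x + \<theta>)) \<le> 2" using mult_mono[OF q01(2) c(2)] q01 c by simp
    qed
    show "(CLINT x|M. complex_of_real (p x * (1 + cos (s a x + \<theta>))) * iexp (t * f d x)) =
      (CLINT x|N. complex_of_real (q x * (1 + cos (r a x + \<theta>))) * iexp (t * g d x))" for t
    proof -
      \<comment> \<open>The cosine becomes two exponentials, so the weighted integral combines three
        values of \<open>base\<close>, with the frequencies 0, \<open>a\<close> and
        -\<open>a\<close> on \<open>C\<close>.\<close>
      have expand: "complex_of_real (p * (1 + cos (S + \<theta>))) * iexp (t * y) =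
          complex_of_real p * iexp (t * y + 0) +
          (iexp \<theta> / 2) * (complex_of_real p * iexp (t * y + S)) +
          (iexp (- \<theta>) / 2) * (complex_of_real p * iexp (t * y + - S))" for p S y :: real
      proof -
        have "complex_of_real (cos (S + \<theta>)) = (iexp (S + \<theta>) + iexp (- (S + \<theta>))) / 2"
          by (simp only: cos_of_real[symmetric] cos_exp_eq of_real_minus mult_minus_right)
        also have "\<dots> = (iexp S * iexp \<theta> + iexp (- S) * iexp (- \<theta>)) / 2"
          by (simp only: exp_add[symmetric] of_real_add of_real_minus minus_add_distrib distrib_left)
        finally have 1: "complex_of_real (cos (S + \<theta>)) = (iexp S * iexp \<theta> + iexp (- S) * iexp (- \<theta>)) / 2" .
        have 2: "iexp (t * y + 0) = iexp (t * y)" "iexp (t * y + S) = iexp (t * y) * iexp S"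
          "iexp (t * y + - S) = iexp (t * y) * iexp (- S)"
          by (simp_all only: of_real_add distrib_left exp_add) simp
        have 3: "P * (1 + (a * b + c * d) / 2) * e = P * e + (b / 2) * (P * (e * a)) + (d / 2) * (P * (e * c))"
          for P a b c d e :: complex
          by (simp add: field_simps)
        show ?thesis unfolding 2 of_real_mult[of p] of_real_add[of 1] of_real_1 1 by (rule 3)
      qed
      have zero: "s (\<lambda>_. 0) x = 0" "r (\<lambda>_. 0) y = 0" "s (\<lambda>k. - a k) x = - s a x" "r (\<lambda>k. - a k) y = - r a y" for x y
        by (simp_all add: s_def r_def sum_negf)
      have int1: "integrable M (\<lambda>x. complex_of_real (p x) * iexp (h x))" if [measurable]: "h \<in> borel_measurable M" for h
        by (rule integrable_bounded_iexp[where C = 1]) (use p01 M.finite_measure_axioms in auto)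
      have int2: "integrable N (\<lambda>x. complex_of_real (q x) * iexp (h x))" if [measurable]: "h \<in> borel_measurable N" for h
        by (rule integrable_bounded_iexp[where C = 1]) (use q01 N.finite_measure_axioms in auto)
      have "(CLINT x|M. complex_of_real (p x * (1 + cos (s a x + \<theta>))) * iexp (t * f d x)) =
        (CLINT x|M. complex_of_real (p x) * iexp (t * f d x + 0)) +
        (iexp \<theta> / 2) * (CLINT x|M. complex_of_real (p x) * iexp (t * f d x + s a x)) +
        (iexp (- \<theta>) / 2) * (CLINT x|M. complex_of_real (p x) * iexp (t * f d x + - s a x))"
        unfolding expand
        by (subst Bochner_Integration.integral_add Bochner_Integration.integral_mult_right
            | (intro Bochner_Integration.integrable_add integrable_mult_right int1; measurable))+ simp
      also have "\<dots> = (CLINT x|N. complex_of_real (q x) * iexp (t * g d x + 0)) +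
        (iexp \<theta> / 2) * (CLINT x|N. complex_of_real (q x) * iexp (t * g d x + r a x)) +
        (iexp (- \<theta>) / 2) * (CLINT x|N. complex_of_real (q x) * iexp (t * g d x + - r a x))"
        using base[of t "\<lambda>_. 0"] base[of t a] base[of t "\<lambda>k. - a k"] unfolding zero by simp
      also have "\<dots> = (CLINT x|N. complex_of_real (q x * (1 + cos (r a x + \<theta>))) * iexp (t * g d x))"
        unfolding expand
        by (subst Bochner_Integration.integral_add Bochner_Integration.integral_mult_right
            | (intro Bochner_Integration.integrable_add integrable_mult_right int2; measurable))+ simp
      finally show ?thesis .
    qed
  qed (use M N in auto)
  define p' where "p' x = p x * indicator (B d) (f d x)" for x
  define q' where "q' x = q x * indicator (B d) (g d x)" for x
  have [measurable]: "p' \<in> borel_measurable M" "q' \<in> borel_measurable N"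
    unfolding p'_def[abs_def] q'_def[abs_def] by auto
  have p'01: "0 \<le> p' x" "p' x \<le> 1" for x using p01 by (auto simp: p'_def indicator_def)
  have q'01: "0 \<le> q' x" "q' x \<le> 1" for x using q01 by (auto simp: q'_def indicator_def)
  have intp: "integrable M (\<lambda>x. p' x * h x)" if [measurable]: "h \<in> borel_measurable M" and "\<And>x. \<bar>h x\<bar> \<le> 1" for h
    using p'01 that by (intro M.integrable_const_bound[of _ 1]) (auto simp: abs_mult mult_le_one)
  have intq: "integrable N (\<lambda>x. q' x * h x)" if [measurable]: "h \<in> borel_measurable N" and "\<And>x. \<bar>h x\<bar> \<le> 1" for h
    using q'01 that by (intro N.integrable_const_bound[of _ 1]) (auto simp: abs_mult mult_le_one)
  \<comment> \<open>\<open>trig\<close> split into the constant and the cosine. Frequency 0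
    determines the constant; afterwards \<theta> = 0 and \<theta> = -\<pi>/2 give the cosine and the
    sine, that is, real and imaginary part.\<close>
  have cos1: "(LINT x|M. p' x * 1) + (LINT x|M. p' x * cos (s a x + \<theta>)) =
      (LINT x|N. q' x * 1) + (LINT x|N. q' x * cos (r a x + \<theta>))" for a \<theta>
  proof -
    have "(LINT x|M. p' x * 1) + (LINT x|M. p' x * cos (s a x + \<theta>)) =
        (LINT x|M. p' x * 1 + p' x * cos (s a x + \<theta>))"
      by (rule Bochner_Integration.integral_add[symmetric]; rule intp) auto
    also have "\<dots> = (LINT x|M. p x * (1 + cos (s a x + \<theta>)) * indicator (B d) (f d x))"
      by (simp add: p'_def algebra_simps)
    also have "\<dots> = (LINT x|N. q x * (1 + cos (r a x + \<theta>)) * indicator (B d) (g d x))" by (rule trig)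
    also have "\<dots> = (LINT x|N. q' x * 1 + q' x * cos (r a x + \<theta>))"
      by (simp add: q'_def algebra_simps)
    also have "\<dots> = (LINT x|N. q' x * 1) + (LINT x|N. q' x * cos (r a x + \<theta>))"
      by (rule Bochner_Integration.integral_add; rule intq) auto
    finally show ?thesis .
  qed
  have "(LINT x|M. p' x) = (LINT x|N. q' x)"
    using cos1[of "\<lambda>_. 0" 0] by (simp add: s_def r_def)
  then have cs: "(LINT x|M. p' x * cos (s a x + \<theta>)) = (LINT x|N. q' x * cos (r a x + \<theta>))" for a \<theta>
    using cos1[of a \<theta>] by simp
  have "(LINT x|M. p' x * sin (s a x)) = (LINT x|N. q' x * sin (r a x))"
    using cs[of a "- (pi / 2)"] by (simp add: cos_diff)
  moreover have "(LINT x|M. p' x * cos (s a x)) = (LINT x|N. q' x * cos (r a x))"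
    using cs[of a 0] by simp
  moreover have "(CLINT x|M. complex_of_real (p' x) * iexp (s a x)) =
      Complex (LINT x|M. p' x * cos (s a x)) (LINT x|M. p' x * sin (s a x))"
  proof -
    have "integrable M (\<lambda>x. complex_of_real (p' x) * iexp (s a x))"
      by (rule integrable_bounded_iexp[where C = 1]) (use p'01 M.finite_measure_axioms in auto)
    then show ?thesis
      by (intro complex_eqI) (simp_all flip: integral_Re integral_Im add: Re_exp Im_exp)
  qed
  moreover have "(CLINT x|N. complex_of_real (q' x) * iexp (r a x)) =
      Complex (LINT x|N. q' x * cos (r a x)) (LINT x|N. q' x * sin (r a x))"
  proof -
    have "integrable N (\<lambda>x. complex_of_real (q' x) * iexp (r a x))"
      by (rule integrable_bounded_iexp[where C = 1]) (use q'01 N.finite_measure_axioms in auto)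
    then show ?thesis
      by (intro complex_eqI) (simp_all flip: integral_Re integral_Im add: Re_exp Im_exp)
  qed
  ultimately have "(CLINT x|M. complex_of_real (p' x) * iexp (s a x)) =
    (CLINT x|N. complex_of_real (q' x) * iexp (r a x))" by simp
  then show ?case
    using insert.hyps unfolding p'_def q'_def p_def q_def s_def r_def by (simp add: mult.commute mult.left_commute)
qed

text \<open>Once all coordinates are on the indicator side, the preceding lemma equates the
  probabilities of boxes, and these determine a law on a finite product.\<close>

theorem char_functional_uniqueness:
  fixes f :: "'i \<Rightarrow> 'a \<Rightarrow> real" and g :: "'i \<Rightarrow> 'b \<Rightarrow> real"
  assumes M: "prob_space M" and N: "prob_space N" and fin: "finite A"
    and f: "\<And>k. k \<in> A \<Longrightarrow> f k \<in> borel_measurable M"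
    and g: "\<And>k. k \<in> A \<Longrightarrow> g k \<in> borel_measurable N"
    and eq: "\<And>a. (CLINT x|M. iexp (\<Sum>k\<in>A. a k * f k x)) = (CLINT x|N. iexp (\<Sum>k\<in>A. a k * g k x))"
  shows "distr M (\<Pi>\<^sub>M k\<in>A. borel) (\<lambda>x. \<lambda>k\<in>A. f k x) = distr N (\<Pi>\<^sub>M k\<in>A. borel) (\<lambda>x. \<lambda>k\<in>A. g k x)"
proof -
  interpret M: prob_space M by fact
  interpret N: prob_space N by fact
  have fm: "(\<lambda>x. \<lambda>k\<in>A. f k x) \<in> measurable M (\<Pi>\<^sub>M k\<in>A. borel)"
    and gm: "(\<lambda>x. \<lambda>k\<in>A. g k x) \<in> measurable N (\<Pi>\<^sub>M k\<in>A. borel)"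
    using f g by (auto intro!: measurable_restrict)
  have box: "measure L ((\<lambda>x. \<lambda>k\<in>A. h k x) -` Pi\<^sub>E A B \<inter> space L)
      = Re (CLINT x|L. complex_of_real (\<Prod>k\<in>A. indicator (B k) (h k x)))"
    if "prob_space L" "\<And>k. k \<in> A \<Longrightarrow> h k \<in> borel_measurable L" "\<And>k. B k \<in> sets borel"
    for L B and h :: "'i \<Rightarrow> 'x \<Rightarrow> real"
  proof -
    interpret L: prob_space L by fact
    have "(\<Prod>k\<in>A. indicator (B k) (h k x)) = (indicator ((\<lambda>x. \<lambda>k\<in>A. h k x) -` Pi\<^sub>E A B) x :: real)" for x
      using fin by (auto simp: indicator_def PiE_iff prod_eq_1_iff intro!: prod.neutral)
    then show ?thesis by (simp add: Int_commute)
  qed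
  show ?thesis
  proof (rule measure_eqI_PiM_finite[OF fin])
    fix B :: "'i \<Rightarrow> real set" assume B: "\<And>i. i \<in> A \<Longrightarrow> B i \<in> sets borel"
    \<comment> \<open>The lemma on boxes asks for a Borel set at every index, also outside
      \<open>A\<close>.\<close>
    define B' where "B' k = (if k \<in> A then B k else UNIV)" for k
    have B': "B' k \<in> sets borel" for k using B by (auto simp: B'_def)
    have BE: "Pi\<^sub>E A B = Pi\<^sub>E A B'" by (auto simp: B'_def PiE_iff)
    have [measurable]: "Pi\<^sub>E A B \<in> sets (\<Pi>\<^sub>M k\<in>A. borel)" using fin B by (intro sets_PiM_I_finite) auto
    have "measure M ((\<lambda>x. \<lambda>k\<in>A. f k x) -` Pi\<^sub>E A B' \<inter> space M) = measure N ((\<lambda>x. \<lambda>k\<in>A. g k x) -` Pi\<^sub>E A B' \<inter> space N)"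
      using char_functional_uniqueness_boxes[where D = A and C = "{}" and B = B' and f = f and g = g, OF M N] f g fin eq B'
      by (simp add: box M N)
    then show "emeasure (distr M (\<Pi>\<^sub>M k\<in>A. borel) (\<lambda>x. \<lambda>k\<in>A. f k x)) (Pi\<^sub>E A B) =
        emeasure (distr N (\<Pi>\<^sub>M k\<in>A. borel) (\<lambda>x. \<lambda>k\<in>A. g k x)) (Pi\<^sub>E A B)"
      by (simp add: emeasure_distr fm gm M.emeasure_eq_measure N.emeasure_eq_measure BE[symmetric])
  next
    show "range (\<lambda>_::nat. Pi\<^sub>E A (\<lambda>_. UNIV)) \<subseteq> prod_algebra A (\<lambda>k. borel)"
      using fin by (auto simp: prod_algebra_eq_finite)
    show "(\<Union>i::nat. Pi\<^sub>E A (\<lambda>_. UNIV)) = space (\<Pi>\<^sub>M k\<in>A. (borel :: real measure))"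
      by (auto simp: space_PiM)
    show "emeasure (distr M (\<Pi>\<^sub>M k\<in>A. borel) (\<lambda>x. \<lambda>k\<in>A. f k x)) (Pi\<^sub>E A (\<lambda>_. UNIV)) \<noteq> \<infinity>" for i :: nat
      by (subst emeasure_distr[OF fm]) (use fin in \<open>auto intro!: sets_PiM_I_finite\<close>)
  qed (auto)
qed

section \<open>Moments of Gaussian processes\<close>

lemma char_normal_density:
  assumes s: "s > 0"
  shows "(CLINT x|lborel. complex_of_real (normal_density m s x) * iexp (t * x)) =
    iexp (t * m) * complex_of_real (exp (- (s\<^sup>2 * t\<^sup>2) / 2))"
proof -
  have "(CLINT x|lborel. complex_of_real (normal_density m s x) * iexp (t * x)) =
    \<bar>s\<bar> *\<^sub>R (CLINT x|lborel. complex_of_real (normal_density m s (m + s * x)) * iexp (t * (m + s * x)))"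
    using s by (intro lborel_integral_real_affine) simp
  also have "\<dots> = (CLINT x|lborel. iexp (t * m) * (std_normal_density x *\<^sub>R iexp (t * s * x)))"
    unfolding integral_scaleR_right[symmetric]
  proof (rule Bochner_Integration.integral_cong[OF refl])
    fix x :: real
    have "s * normal_density m s (m + s * x) = std_normal_density x"
      using s by (simp add: normal_density_def power_mult_distrib real_sqrt_mult field_simps)
    moreover have "iexp (t * (m + s * x)) = iexp (t * m) * iexp (t * s * x)"
      by (simp add: exp_add[symmetric] algebra_simps)
    ultimately show "\<bar>s\<bar> *\<^sub>R (complex_of_real (normal_density m s (m + s * x)) * iexp (t * (m + s * x))) =
        iexp (t * m) * (std_normal_density x *\<^sub>R iexp (t * s * x))"
      using s by (simp add: scaleR_conv_of_real mult.assoc[symmetric] of_real_mult[symmetric] del: of_real_mult)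
  qed
  also have "\<dots> = iexp (t * m) * (CLINT x|lborel. std_normal_density x *\<^sub>R iexp (t * s * x))"
    by (rule integral_mult_right_zero)
  also have "(CLINT x|lborel. std_normal_density x *\<^sub>R iexp (t * s * x)) = char std_normal_distribution (t * s)"
    unfolding char_def by (subst integral_density) auto
  also have "char std_normal_distribution (t * s) = complex_of_real (exp (- (s\<^sup>2 * t\<^sup>2) / 2))"
    by (simp add: char_std_normal_distribution power_mult_distrib mult.commute)
  finally show ?thesis .
qed

lemma normal_law_moment_integrable:
  assumes "normal_law \<nu>"
  shows "integrable \<nu> (\<lambda>x. x ^ k)"
  using assms unfolding normal_law_def
proof (elim disjE exE conjE)
  fix m assume \<nu>: "\<nu> = return borel m"
  interpret prob_space \<nu> unfolding \<nu> by (rule prob_space_return) simp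
  show ?thesis
  proof (rule integrable_const_bound)
    show "AE x in \<nu>. norm (x ^ k) \<le> \<bar>m ^ k\<bar>" unfolding \<nu> by (subst AE_return) auto
  qed (simp add: \<nu>)
next
  fix m s :: real assume s: "s > 0" and \<nu>: "\<nu> = density lborel (\<lambda>x. ennreal (normal_density m s x))"
  have "integrable lborel (\<lambda>x. normal_density m s x * x ^ k)"
  proof -
    have "integrable lborel (\<lambda>x. \<Sum>j\<le>k. of_nat (k choose j) * (m ^ (k - j)) * (normal_density m s x * (x - m) ^ j))"
      using s by (intro Bochner_Integration.integrable_sum integrable_mult_right integrable_normal_moment)
    also have "(\<lambda>x. \<Sum>j\<le>k. of_nat (k choose j) * (m ^ (k - j)) * (normal_density m s x * (x - m) ^ j)) =
      (\<lambda>x. normal_density m s x * x ^ k)"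
    proof
      fix x
      have "x ^ k = ((x - m) + m) ^ k" by simp
      also have "\<dots> = (\<Sum>j\<le>k. of_nat (k choose j) * (x - m) ^ j * m ^ (k - j))" by (rule binomial_ring)
      finally show "(\<Sum>j\<le>k. of_nat (k choose j) * (m ^ (k - j)) * (normal_density m s x * (x - m) ^ j)) = normal_density m s x * x ^ k"
        by (simp add: sum_distrib_left algebra_simps)
    qed
    finally show ?thesis .
  qed
  then show ?thesis unfolding \<nu> by (subst integrable_density) auto
qed

text \<open>A point mass at 0 obeys both formulas with variance 0, so degenerate linear combinations
  need no separate treatment later on.\<close>

lemma centred_normal_law:
  assumes "normal_law \<nu>" and mean: "(LINT x|\<nu>. x) = 0"
  shows "(CLINT x|\<nu>. iexp x) = complex_of_real (exp (- (LINT x|\<nu>. x\<^sup>2) / 2))" (is ?char)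
    and "(LINT x|\<nu>. x ^ 4) = 3 * (LINT x|\<nu>. x\<^sup>2)\<^sup>2" (is ?four)
proof -
  have "?char \<and> ?four"
    using assms(1) unfolding normal_law_def
  proof (elim disjE exE conjE)
    fix m assume \<nu>: "\<nu> = return borel m"
    have "m = 0" using mean unfolding \<nu> by (subst (asm) integral_return) auto
    then show ?thesis unfolding \<nu> by (simp add: integral_return)
  next
    fix m s :: real assume s: "s > 0" and \<nu>: "\<nu> = density lborel (\<lambda>x. ennreal (normal_density m s x))"
    have m: "m = 0" using mean s unfolding \<nu> by (subst (asm) integral_density) (auto simp: integral_normal_moment_nz_1)
    have two: "(LINT x|\<nu>. x\<^sup>2) = s\<^sup>2"
      unfolding \<nu> m using integral_normal_moment_even[OF s, of 0 1] s
      by (subst integral_density) (auto simp: field_simps power2_eq_square)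
    have four: "(LINT x|\<nu>. x ^ 4) = 3 * s ^ 4"
      unfolding \<nu> m using integral_normal_moment_even[OF s, of 0 2] s
      by (subst integral_density) (auto simp: field_simps fact_numeral)
    have "(CLINT x|\<nu>. iexp x) = (CLINT x|lborel. complex_of_real (normal_density m s x) * iexp (1 * x))"
      unfolding \<nu> by (subst integral_density) (auto simp: scaleR_conv_of_real)
    also have "\<dots> = complex_of_real (exp (- (s\<^sup>2) / 2))"
      unfolding char_normal_density[OF s] by (simp add: m)
    finally show ?thesis unfolding two four by (simp add: power_mult[symmetric])
  qed
  then show ?char ?four by auto
qed

section \<open>Fourth moments by polarisation\<close>

text \<open>Inclusion-exclusion over the nonempty subsets of the four numbers isolates the monomial
  abcd, which has coefficient 4! in the fourth power of the full sum.\<close>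

lemma polarization_quartic:
  fixes a b c d :: real
  shows "24 * (a * b * c * d) = (a + b + c + d) ^ 4
    - ((a + b + c) ^ 4 + (a + b + d) ^ 4 + (a + c + d) ^ 4 + (b + c + d) ^ 4)
    + ((a + b) ^ 4 + (a + c) ^ 4 + (a + d) ^ 4 + (b + c) ^ 4 + (b + d) ^ 4 + (c + d) ^ 4)
    - (a ^ 4 + b ^ 4 + c ^ 4 + d ^ 4)"
  by algebra

lemma abs_prod4_le:
  fixes a b c d :: real
  shows "\<bar>a * b * c * d\<bar> \<le> a ^ 4 + b ^ 4 + c ^ 4 + d ^ 4"
proof -
  have am: "\<bar>x * y\<bar> \<le> x\<^sup>2 + y\<^sup>2" for x y :: real
    using sum_squares_bound[of "\<bar>x\<bar>" "\<bar>y\<bar>"] zero_le_power2[of x] zero_le_power2[of y]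
    by (simp add: abs_mult mult.assoc) (smt (verit) abs_ge_zero mult_nonneg_nonneg)
  have "\<bar>a * b * c * d\<bar> = \<bar>(a * b) * (c * d)\<bar>" by (simp add: mult.assoc)
  also have "2 * \<bar>(a * b) * (c * d)\<bar> \<le> (a * b)\<^sup>2 + (c * d)\<^sup>2"
    using sum_squares_bound[of "\<bar>a * b\<bar>" "\<bar>c * d\<bar>"] unfolding power2_abs abs_mult[of "a * b" "c * d"] by linarith
  also have "(a * b)\<^sup>2 \<le> a ^ 4 + b ^ 4" using am[of "a\<^sup>2" "b\<^sup>2"] by (simp add: power_mult_distrib)
  also have "(c * d)\<^sup>2 \<le> c ^ 4 + d ^ 4" using am[of "c\<^sup>2" "d\<^sup>2"] by (simp add: power_mult_distrib)
  finally show ?thesis by linarith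
qed

lemma (in finite_measure) integrable_square_of_fourth:
  fixes Y :: "'a \<Rightarrow> real"
  assumes "integrable M (\<lambda>x. Y x ^ 4)" and [measurable]: "Y \<in> borel_measurable M"
  shows "integrable M (\<lambda>x. (Y x)\<^sup>2)"
proof (rule Bochner_Integration.integrable_bound[of M "\<lambda>x. 1 + Y x ^ 4"])
  show "integrable M (\<lambda>x. 1 + Y x ^ 4)" using assms by auto
  have "y\<^sup>2 \<le> 1 + y ^ 4" for y :: real
  proof -
    have "2 * y\<^sup>2 \<le> 1 + y ^ 4" using sum_squares_bound[of 1 "y\<^sup>2"] by (simp add: power_mult[symmetric])
    moreover have "0 \<le> y\<^sup>2" by simp
    ultimately show ?thesis by linarith
  qed
  then show "AE x in M. norm ((Y x)\<^sup>2) \<le> norm (1 + Y x ^ 4)" by (auto simp: abs_of_nonneg)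
qed auto

lemma integrable_mult_of_squares:
  fixes Y Z :: "'a \<Rightarrow> real"
  assumes "integrable M (\<lambda>x. (Y x)\<^sup>2)" "integrable M (\<lambda>x. (Z x)\<^sup>2)"
    and [measurable]: "Y \<in> borel_measurable M" "Z \<in> borel_measurable M"
  shows "integrable M (\<lambda>x. Y x * Z x)"
proof (rule Bochner_Integration.integrable_bound[of M "\<lambda>x. (Y x)\<^sup>2 + (Z x)\<^sup>2"])
  show "integrable M (\<lambda>x. (Y x)\<^sup>2 + (Z x)\<^sup>2)" using assms by auto
  have "\<bar>y * z\<bar> \<le> y\<^sup>2 + z\<^sup>2" for y z :: real
    using abs_prod4_le[of 1 1 y z] sum_squares_bound[of "\<bar>y\<bar>" "\<bar>z\<bar>"]
    by (simp add: abs_mult mult.assoc) (smt (verit) abs_ge_zero mult_nonneg_nonneg)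
  then show "AE x in M. norm (Y x * Z x) \<le> norm ((Y x)\<^sup>2 + (Z x)\<^sup>2)" by (auto simp: abs_of_nonneg)
qed auto

lemma integrable_mult4:
  fixes Y1 Y2 Y3 Y4 :: "'a \<Rightarrow> real"
  assumes "integrable M (\<lambda>x. Y1 x ^ 4)" "integrable M (\<lambda>x. Y2 x ^ 4)"
    "integrable M (\<lambda>x. Y3 x ^ 4)" "integrable M (\<lambda>x. Y4 x ^ 4)"
    and [measurable]: "Y1 \<in> borel_measurable M" "Y2 \<in> borel_measurable M"
      "Y3 \<in> borel_measurable M" "Y4 \<in> borel_measurable M"
  shows "integrable M (\<lambda>x. Y1 x * Y2 x * Y3 x * Y4 x)"
proof (rule Bochner_Integration.integrable_bound[of M "\<lambda>x. Y1 x ^ 4 + Y2 x ^ 4 + Y3 x ^ 4 + Y4 x ^ 4"])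
  show "integrable M (\<lambda>x. Y1 x ^ 4 + Y2 x ^ 4 + Y3 x ^ 4 + Y4 x ^ 4)" using assms by auto
  show "AE x in M. norm (Y1 x * Y2 x * Y3 x * Y4 x) \<le> norm (Y1 x ^ 4 + Y2 x ^ 4 + Y3 x ^ 4 + Y4 x ^ 4)"
    using abs_prod4_le by (auto simp: abs_of_nonneg)
qed auto

text \<open>The fourth moment of each linear combination is 3 times the square of a quadratic form
  in the coefficients; polarising both sides gives the mixed moment as a sum over pairings. No
  density enters, so singular covariances are covered.\<close>

lemma (in prob_space) Isserlis:
  fixes Y1 Y2 Y3 Y4 :: "'a \<Rightarrow> real"
  assumes four: "\<And>a b c d. expectation (\<lambda>x. (a * Y1 x + b * Y2 x + c * Y3 x + d * Y4 x) ^ 4)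
      = 3 * (expectation (\<lambda>x. (a * Y1 x + b * Y2 x + c * Y3 x + d * Y4 x)\<^sup>2))\<^sup>2"
    and int4: "\<And>a b c d. integrable M (\<lambda>x. (a * Y1 x + b * Y2 x + c * Y3 x + d * Y4 x) ^ 4)"
    and [measurable]: "Y1 \<in> borel_measurable M" "Y2 \<in> borel_measurable M"
      "Y3 \<in> borel_measurable M" "Y4 \<in> borel_measurable M"
  shows "expectation (\<lambda>x. Y1 x * Y2 x * Y3 x * Y4 x) =
    expectation (\<lambda>x. Y1 x * Y2 x) * expectation (\<lambda>x. Y3 x * Y4 x) +
    expectation (\<lambda>x. Y1 x * Y3 x) * expectation (\<lambda>x. Y2 x * Y4 x) +
    expectation (\<lambda>x. Y1 x * Y4 x) * expectation (\<lambda>x. Y2 x * Y3 x)"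
proof -
  define B where "B Y Z = expectation (\<lambda>x. Y x * Z x)" for Y Z :: "'a \<Rightarrow> real"
  define F where "F a b c d = expectation (\<lambda>x. (a * Y1 x + b * Y2 x + c * Y3 x + d * Y4 x) ^ 4)" for a b c d
  have i1: "integrable M (\<lambda>x. Y1 x ^ 4)" "integrable M (\<lambda>x. Y2 x ^ 4)"
    "integrable M (\<lambda>x. Y3 x ^ 4)" "integrable M (\<lambda>x. Y4 x ^ 4)"
    using int4[of 1 0 0 0] int4[of 0 1 0 0] int4[of 0 0 1 0] int4[of 0 0 0 1] by simp_all
  note i2 = i1[THEN integrable_square_of_fourth]
  have prods: "integrable M (\<lambda>x. Y x * Z x)" if "Y \<in> {Y1, Y2, Y3, Y4}" "Z \<in> {Y1, Y2, Y3, Y4}" for Y Z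
    using that i2 by (auto intro!: integrable_mult_of_squares)
  have G: "expectation (\<lambda>x. (a * Y1 x + b * Y2 x + c * Y3 x + d * Y4 x)\<^sup>2) =
      a\<^sup>2 * B Y1 Y1 + b\<^sup>2 * B Y2 Y2 + c\<^sup>2 * B Y3 Y3 + d\<^sup>2 * B Y4 Y4 + 2 * a * b * B Y1 Y2 + 2 * a * c * B Y1 Y3
      + 2 * a * d * B Y1 Y4 + 2 * b * c * B Y2 Y3 + 2 * b * d * B Y2 Y4 + 2 * c * d * B Y3 Y4" for a b c d
  proof -
    have "(\<lambda>x. (a * Y1 x + b * Y2 x + c * Y3 x + d * Y4 x)\<^sup>2) =
      (\<lambda>x. a\<^sup>2 * (Y1 x * Y1 x) + b\<^sup>2 * (Y2 x * Y2 x) + c\<^sup>2 * (Y3 x * Y3 x) + d\<^sup>2 * (Y4 x * Y4 x)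
      + 2 * a * b * (Y1 x * Y2 x) + 2 * a * c * (Y1 x * Y3 x)
      + 2 * a * d * (Y1 x * Y4 x) + 2 * b * c * (Y2 x * Y3 x) + 2 * b * d * (Y2 x * Y4 x) + 2 * c * d * (Y3 x * Y4 x))"
      by (rule ext) algebra
    then show ?thesis unfolding B_def using prods
      by (simp add: Bochner_Integration.integral_add Bochner_Integration.integrable_add)
  qed
  have F: "F a b c d = 3 * (a\<^sup>2 * B Y1 Y1 + b\<^sup>2 * B Y2 Y2 + c\<^sup>2 * B Y3 Y3 + d\<^sup>2 * B Y4 Y4 + 2 * a * b * B Y1 Y2 + 2 * a * c * B Y1 Y3
      + 2 * a * d * B Y1 Y4 + 2 * b * c * B Y2 Y3 + 2 * b * d * B Y2 Y4 + 2 * c * d * B Y3 Y4)\<^sup>2" for a b c d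
    unfolding F_def four G ..
  define L where "L a b c d x = (a * Y1 x + b * Y2 x + c * Y3 x + d * Y4 x) ^ 4" for a b c d x
  have intL: "integrable M (L a b c d)" for a b c d
    using int4[of a b c d] by (simp add: L_def[abs_def])
  have FL: "expectation (L a b c d) = F a b c d" for a b c d by (simp add: F_def L_def[abs_def])
  have "24 * expectation (\<lambda>x. Y1 x * Y2 x * Y3 x * Y4 x) = expectation (\<lambda>x. 24 * (Y1 x * Y2 x * Y3 x * Y4 x))"
    by simp
  also have "\<dots> = expectation (\<lambda>x. L 1 1 1 1 x
      - (L 1 1 1 0 x + L 1 1 0 1 x + L 1 0 1 1 x + L 0 1 1 1 x)
      + (L 1 1 0 0 x + L 1 0 1 0 x + L 1 0 0 1 x + L 0 1 1 0 x + L 0 1 0 1 x + L 0 0 1 1 x)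
      - (L 1 0 0 0 x + L 0 1 0 0 x + L 0 0 1 0 x + L 0 0 0 1 x))"
    unfolding polarization_quartic by (simp add: L_def)
  also have "\<dots> = F 1 1 1 1 - (F 1 1 1 0 + F 1 1 0 1 + F 1 0 1 1 + F 0 1 1 1)
      + (F 1 1 0 0 + F 1 0 1 0 + F 1 0 0 1 + F 0 1 1 0 + F 0 1 0 1 + F 0 0 1 1)
      - (F 1 0 0 0 + F 0 1 0 0 + F 0 0 1 0 + F 0 0 0 1)"
    using intL by (simp add: FL Bochner_Integration.integral_add Bochner_Integration.integral_diff)
  also have "\<dots> = 24 * (B Y1 Y2 * B Y3 Y4 + B Y1 Y3 * B Y2 Y4 + B Y1 Y4 * B Y2 Y3)"
    unfolding F by simp algebra
  finally show ?thesis by (simp add: B_def)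
qed

locale centred_gaussian = prob_space M for M :: "'a measure" +
  fixes X :: "int \<Rightarrow> 'a \<Rightarrow> real" and \<sigma> :: "int \<Rightarrow> int \<Rightarrow> real"
  assumes X_measurable[measurable]: "X j \<in> borel_measurable M"
    and normal: "finite J \<Longrightarrow> normal_law (distr M borel (\<lambda>\<omega>. \<Sum>j\<in>J. c j * X j \<omega>))"
    and mean: "expectation (X j) = 0"
    and cov: "\<sigma> i j = expectation (\<lambda>\<omega>. X i \<omega> * X j \<omega>)"
begin

definition lin :: "int set \<Rightarrow> (int \<Rightarrow> real) \<Rightarrow> 'a \<Rightarrow> real" where
  "lin J c \<omega> = (\<Sum>j\<in>J. c j * X j \<omega>)"

lemma lin_measurable[measurable]: "lin J c \<in> borel_measurable M"
  unfolding lin_def[abs_def] by measurable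

lemma cov_sym: "\<sigma> i j = \<sigma> j i"
  by (simp add: cov mult.commute)

lemma integrable_lin_power:
  assumes "finite J" shows "integrable M (\<lambda>\<omega>. lin J c \<omega> ^ k)"
proof -
  have "integrable (distr M borel (lin J c)) (\<lambda>x. x ^ k)"
    using normal[OF assms, of c] unfolding lin_def[abs_def] by (rule normal_law_moment_integrable)
  then show ?thesis by (subst (asm) integrable_distr_eq) auto
qed

lemma integrable_X_power: "integrable M (\<lambda>\<omega>. X j \<omega> ^ k)"
  using integrable_lin_power[of "{j}" "\<lambda>_. 1" k] by (simp add: lin_def)

lemma integrable_X: "integrable M (X j)"
  using integrable_X_power[of j 1] by simp

lemma integrable_X_mult: "integrable M (\<lambda>\<omega>. X i \<omega> * X j \<omega>)"
  by (intro integrable_mult_of_squares integrable_X_power) auto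

lemma lin_mult: "lin J a \<omega> * lin J b \<omega> = (\<Sum>i\<in>J. \<Sum>j\<in>J. a i * b j * (X i \<omega> * X j \<omega>))"
  unfolding lin_def sum_product by (intro sum.cong refl) (simp add: algebra_simps)

lemma expectation_lin_mult:
  "expectation (\<lambda>\<omega>. lin J a \<omega> * lin J b \<omega>) = bil \<sigma> J a b"
  unfolding lin_mult bil_def cov using integrable_X_mult
  by (simp add: Bochner_Integration.integral_sum Bochner_Integration.integrable_sum)

lemma expectation_lin_square: "expectation (\<lambda>\<omega>. (lin J a \<omega>)\<^sup>2) = bil \<sigma> J a a"
  by (simp add: power2_eq_square expectation_lin_mult)

lemma expectation_lin: "expectation (lin J a) = 0"
  unfolding lin_def[abs_def] using integrable_X by (simp add: mean)

lemma bil_nonneg: "0 \<le> bil \<sigma> J a a"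
  unfolding expectation_lin_square[symmetric] by simp

lemma
  assumes "finite J"
  shows char_functional: "(CLINT \<omega>|M. iexp (lin J a \<omega>)) = complex_of_real (exp (- bil \<sigma> J a a / 2))"
    and expectation_lin_four: "expectation (\<lambda>\<omega>. lin J a \<omega> ^ 4) = 3 * (bil \<sigma> J a a)\<^sup>2"
proof -
  let ?\<nu> = "distr M borel (lin J a)"
  have n: "normal_law ?\<nu>" using normal[OF assms, of a] by (simp add: lin_def[abs_def])
  have m: "(LINT x|?\<nu>. x) = 0" by (subst integral_distr) (auto simp: expectation_lin)
  have two: "(LINT x|?\<nu>. x\<^sup>2) = bil \<sigma> J a a"
    by (subst integral_distr) (auto simp: expectation_lin_square)
  have "(CLINT \<omega>|M. iexp (lin J a \<omega>)) = (CLINT x|?\<nu>. iexp x)" by (subst integral_distr) auto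
  then show "(CLINT \<omega>|M. iexp (lin J a \<omega>)) = complex_of_real (exp (- bil \<sigma> J a a / 2))"
    by (simp add: centred_normal_law(1)[OF n m] two)
  have "expectation (\<lambda>\<omega>. lin J a \<omega> ^ 4) = (LINT x|?\<nu>. x ^ 4)" by (subst integral_distr) auto
  then show "expectation (\<lambda>\<omega>. lin J a \<omega> ^ 4) = 3 * (bil \<sigma> J a a)\<^sup>2"
    by (simp add: centred_normal_law(2)[OF n m] two)
qed

lemma lin_Isserlis:
  assumes J: "finite J"
  shows "expectation (\<lambda>\<omega>. lin J a \<omega> * lin J b \<omega> * lin J c \<omega> * lin J d \<omega>) =
    bil \<sigma> J a b * bil \<sigma> J c d + bil \<sigma> J a c * bil \<sigma> J b d + bil \<sigma> J a d * bil \<sigma> J b c"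
proof -
  have comb: "s * lin J a \<omega> + t * lin J b \<omega> + u * lin J c \<omega> + v * lin J d \<omega> =
      lin J (\<lambda>j. s * a j + t * b j + u * c j + v * d j) \<omega>" for s t u v \<omega>
    by (simp add: lin_def sum_distrib_left sum.distrib[symmetric] algebra_simps)
  show ?thesis
    unfolding expectation_lin_mult[symmetric]
    by (rule Isserlis) (simp_all only: comb expectation_lin_four[OF J] expectation_lin_square
        integrable_lin_power[OF J] lin_measurable)
qed

lemma integrable_lin_mult4:
  assumes J: "finite J"
  shows "integrable M (\<lambda>\<omega>. lin J a \<omega> * lin J b \<omega> * lin J c \<omega> * lin J d \<omega>)"
  using J by (intro integrable_mult4 integrable_lin_power) auto

end

lemma gaussian_process_imp_centred:
  assumes "gaussian_process M X" and "\<And>j. integral\<^sup>L M (X j) = 0"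
    and "\<And>i j. \<sigma> i j = integral\<^sup>L M (\<lambda>\<omega>. X i \<omega> * X j \<omega>)"
  shows "centred_gaussian M X \<sigma>"
proof -
  interpret prob_space M using assms(1) by (simp add: gaussian_process_def)
  have [measurable]: "X j \<in> borel_measurable M" for j using assms(1) by (simp add: gaussian_process_def)
  show ?thesis
  proof
    fix J :: "int set" and c assume J: "finite J"
    then have "normal_law (distr (joint_law M X J) borel (\<lambda>x. \<Sum>j\<in>J. c j * x j))"
      using assms(1) by (simp add: gaussian_process_def gaussian_law_def)
    also have "distr (joint_law M X J) borel (\<lambda>x. \<Sum>j\<in>J. c j * x j) =
        distr M borel (\<lambda>\<omega>. \<Sum>j\<in>J. c j * X j \<omega>)"
      unfolding joint_law_def by (subst distr_distr) (auto simp: o_def intro!: arg_cong[where f = "distr M borel"])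
    finally show "normal_law (distr M borel (\<lambda>\<omega>. \<Sum>j\<in>J. c j * X j \<omega>))" .
  qed (use assms in auto)
qed

section \<open>Gaussian densities\<close>

text \<open>The Gaussian density in innovation coordinates. When row \<open>k\<close> of
  \<open>e\<close> is an innovation at \<open>k\<close>, the change of variables is unit triangular,
  so no determinant appears.\<close>

definition innovation_density ::
  "(int \<Rightarrow> int \<Rightarrow> real) \<Rightarrow> (int \<Rightarrow> real) \<Rightarrow> int set \<Rightarrow> (int \<Rightarrow> real) \<Rightarrow> real" where
  "innovation_density e s A y = (\<Prod>k\<in>A. normal_density 0 (s k) (\<Sum>l\<in>A. e k l * y l))"

lemma innovation_density_measurable[measurable]:
  "innovation_density e s A \<in> borel_measurable (\<Pi>\<^sub>M k\<in>A. lborel)"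
  unfolding innovation_density_def[abs_def] by measurable

lemma innovation_density_nonneg: "0 \<le> innovation_density e s A y"
  by (simp add: innovation_density_def prod_nonneg)

lemma innovation_density_pos: "(\<And>k. k \<in> A \<Longrightarrow> s k > 0) \<Longrightarrow> 0 < innovation_density e s A y"
  by (simp add: innovation_density_def prod_pos normal_density_pos)

interpretation lborel_product: product_sigma_finite "\<lambda>_::int. lborel :: real measure"
  by standard

lemma innovation_subset:
  assumes "innovation \<sigma> A k v" "B \<subseteq> A" "\<And>l. l \<in> A \<Longrightarrow> l < k \<Longrightarrow> l \<in> B" "finite A"
  shows "innovation \<sigma> B k v"
proof -
  have "pairing \<sigma> (insert k A) v l = pairing \<sigma> (insert k B) v l" for l
    unfolding pairing_def using assms by (intro sum.mono_neutral_right) (auto simp: innovation_def)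
  then show ?thesis using assms unfolding innovation_def by auto
qed

text \<open>Induction on the largest index, which is integrated out first: its conditional law given
  the earlier coordinates is a one-dimensional normal law. Total mass and characteristic functional
  share one induction because the mass supplies the integrability that Fubini needs.\<close>

lemma innovation_density_char:
  assumes "finite A" and e: "\<And>k. k \<in> A \<Longrightarrow> innovation \<sigma> A k (e k)"
    and s: "\<And>k. k \<in> A \<Longrightarrow> s k > 0" "\<And>k. k \<in> A \<Longrightarrow> (s k)\<^sup>2 = bil \<sigma> A (e k) (e k)"
    and sym: "\<And>i j. \<sigma> i j = \<sigma> j i"
  shows "(\<integral>\<^sup>+y. innovation_density e s A y \<partial>(\<Pi>\<^sub>M k\<in>A. lborel)) = 1 \<and>
    (\<forall>a. (CLINT y|(\<Pi>\<^sub>M k\<in>A. lborel). complex_of_real (innovation_density e s A y) * iexp (\<Sum>k\<in>A. a k * y k)) =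
      complex_of_real (exp (- bil \<sigma> A a a / 2)))"
  using assms(1) e s
proof (induction A rule: finite_linorder_max_induct)
  case empty
  then show ?case by (simp add: innovation_density_def bil_def PiM_empty nn_integral_count_space_finite
        lebesgue_integral_count_space_finite)
next
  case (insert b A)
  let ?A = "insert b A"
  have bA: "b \<notin> A" using insert.hyps by auto
  have e_A: "innovation \<sigma> A k (e k)" if "k \<in> A" for k
    using insert.prems(1)[of k] that insert.hyps by (auto intro!: innovation_subset[where A = ?A])
  have ekb: "e k b = 0" if "k \<in> A" for k
    using insert.prems(1)[of k] that insert.hyps bA by (fastforce simp: innovation_def)
  have ebb: "e b b = 1" using insert.prems(1)[of b] by (simp add: innovation_def)
  have s_A: "(s k)\<^sup>2 = bil \<sigma> A (e k) (e k)" if "k \<in> A" for k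
  proof -
    have "bil \<sigma> ?A (e k) (e k) = bil \<sigma> A (e k) (e k)"
      using that ekb insert.hyps by (intro bil_mono_neutral) auto
    then show ?thesis using insert.prems(3)[of k] that by simp
  qed
  have sb: "s b > 0" using insert.prems by simp
  have s_pos_A: "s k > 0" if "k \<in> A" for k using insert.prems that by simp
  note IH = insert.IH[OF e_A s_pos_A s_A]
  define c where "c x = (\<Sum>l\<in>A. e b l * x l)" for x
  \<comment> \<open>The other innovations have coefficient 0 at the largest index \<open>b\<close>,
    so only the factor at \<open>b\<close> depends on \<open>t\<close>: a normal density with mean
    -c(x).\<close>
  have split: "innovation_density e s ?A (x(b := t)) = innovation_density e s A x * normal_density (- c x) (s b) t" for x t
  proof -
    have 1: "(\<Sum>l\<in>?A. e k l * (x(b := t)) l) = e k b * t + (\<Sum>l\<in>A. e k l * x l)" for k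
      using insert.hyps bA by (subst sum.insert) (auto intro!: sum.cong)
    have "normal_density 0 (s b) (t + c x) = normal_density (- c x) (s b) t"
      by (simp add: normal_density_def)
    then show ?thesis
      unfolding innovation_density_def 1 using insert.hyps bA ekb by (simp add: ebb c_def mult.commute)
  qed
  have [measurable]: "c \<in> borel_measurable (\<Pi>\<^sub>M k\<in>A. lborel)" unfolding c_def[abs_def] by measurable
  have nn: "(\<integral>\<^sup>+y. innovation_density e s ?A y \<partial>(\<Pi>\<^sub>M k\<in>?A. lborel)) = 1"
  proof -
    have "(\<integral>\<^sup>+y. innovation_density e s ?A y \<partial>(\<Pi>\<^sub>M k\<in>?A. lborel)) =
      (\<integral>\<^sup>+x. (\<integral>\<^sup>+t. innovation_density e s ?A (x(b := t)) \<partial>lborel) \<partial>(\<Pi>\<^sub>M k\<in>A. lborel))"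
      by (rule lborel_product.product_nn_integral_insert[OF insert.hyps(1) bA]) measurable
    also have "\<dots> = (\<integral>\<^sup>+x. innovation_density e s A x \<partial>(\<Pi>\<^sub>M k\<in>A. lborel))"
    proof (rule nn_integral_cong)
      fix x
      have "(\<integral>\<^sup>+t. innovation_density e s ?A (x(b := t)) \<partial>lborel) =
          innovation_density e s A x * (\<integral>\<^sup>+t. normal_density (- c x) (s b) t \<partial>lborel)"
        unfolding split by (simp add: ennreal_mult innovation_density_nonneg nn_integral_cmult)
      also have "(\<integral>\<^sup>+t. normal_density (- c x) (s b) t \<partial>lborel) = 1"
        using sb by (subst nn_integral_eq_integral) auto
      finally show "(\<integral>\<^sup>+t. innovation_density e s ?A (x(b := t)) \<partial>lborel) = innovation_density e s A x"
        by (simp only: mult_1_right)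
    qed
    finally show ?thesis using IH by simp
  qed
  moreover have "(CLINT y|(\<Pi>\<^sub>M k\<in>?A. lborel). complex_of_real (innovation_density e s ?A y) * iexp (\<Sum>k\<in>?A. a k * y k)) =
      complex_of_real (exp (- bil \<sigma> ?A a a / 2))" for a
  proof -
    \<comment> \<open>Integrating out the last coordinate puts its conditional mean -c(x) in its
      place; \<open>a'\<close> collects the resulting coefficients and vanishes at
      \<open>b\<close>.\<close>
    define a' where "a' l = a l - a b * e b l" for l
    have int: "integrable (\<Pi>\<^sub>M k\<in>?A. lborel) (\<lambda>y. complex_of_real (innovation_density e s ?A y) * iexp (\<Sum>k\<in>?A. a k * y k))"
    proof (rule integrableI_bounded)
      show "(\<integral>\<^sup>+x. ennreal (cmod (complex_of_real (innovation_density e s ?A x) * iexp (\<Sum>k\<in>?A. a k * x k)))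
          \<partial>Pi\<^sub>M ?A (\<lambda>k. lborel)) < \<infinity>"
        using nn innovation_density_nonneg by (simp add: norm_mult)
    qed measurable
    have "(CLINT y|(\<Pi>\<^sub>M k\<in>?A. lborel). complex_of_real (innovation_density e s ?A y) * iexp (\<Sum>k\<in>?A. a k * y k)) =
      (CLINT x|(\<Pi>\<^sub>M k\<in>A. lborel). CLINT t|lborel. complex_of_real (innovation_density e s ?A (x(b := t)))
          * iexp (\<Sum>k\<in>?A. a k * (x(b := t)) k))"
      by (rule lborel_product.product_integral_insert[OF insert.hyps(1) bA int])
    also have "\<dots> = (CLINT x|(\<Pi>\<^sub>M k\<in>A. lborel). complex_of_real (exp (- ((s b)\<^sup>2 * (a b)\<^sup>2) / 2)) *
        (complex_of_real (innovation_density e s A x) * iexp (\<Sum>k\<in>A. a' k * x k)))"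
    proof (rule Bochner_Integration.integral_cong[OF refl])
      fix x
      have 1: "(\<Sum>k\<in>?A. a k * (x(b := t)) k) = a b * t + (\<Sum>k\<in>A. a k * x k)" for t
        using insert.hyps bA by (subst sum.insert) (auto intro!: sum.cong)
      have 2: "(\<Sum>k\<in>A. a k * x k) + a b * - c x = (\<Sum>k\<in>A. a' k * x k)"
        unfolding c_def a'_def by (simp add: sum_distrib_left algebra_simps sum_subtractf)
      have "(CLINT t|lborel. complex_of_real (innovation_density e s ?A (x(b := t)))
          * iexp (\<Sum>k\<in>?A. a k * (x(b := t)) k)) =
        (CLINT t|lborel. (complex_of_real (innovation_density e s A x) * iexp (\<Sum>k\<in>A. a k * x k)) *
          (complex_of_real (normal_density (- c x) (s b) t) * iexp (a b * t)))"
        unfolding split 1 of_real_add distrib_left exp_add by (simp add: mult.assoc mult.left_commute mult.commute)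
      also have "\<dots> = (complex_of_real (innovation_density e s A x) * iexp (\<Sum>k\<in>A. a k * x k)) *
          (iexp (a b * - c x) * complex_of_real (exp (- ((s b)\<^sup>2 * (a b)\<^sup>2) / 2)))"
        unfolding char_normal_density[OF sb, symmetric] by (rule integral_mult_right_zero)
      also have "iexp (\<Sum>k\<in>A. a' k * x k) = iexp (\<Sum>k\<in>A. a k * x k) * iexp (a b * - c x)"
        unfolding 2[symmetric] of_real_add distrib_left exp_add ..
      then have "(complex_of_real (innovation_density e s A x) * iexp (\<Sum>k\<in>A. a k * x k)) *
          (iexp (a b * - c x) * complex_of_real (exp (- ((s b)\<^sup>2 * (a b)\<^sup>2) / 2))) =
        complex_of_real (exp (- ((s b)\<^sup>2 * (a b)\<^sup>2) / 2)) *
        (complex_of_real (innovation_density e s A x) * iexp (\<Sum>k\<in>A. a' k * x k))"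
        by (simp only: mult.assoc mult.left_commute mult.commute)
      finally show "(CLINT t|lborel. complex_of_real (innovation_density e s ?A (x(b := t)))
          * iexp (\<Sum>k\<in>?A. a k * (x(b := t)) k)) =
        complex_of_real (exp (- ((s b)\<^sup>2 * (a b)\<^sup>2) / 2)) *
        (complex_of_real (innovation_density e s A x) * iexp (\<Sum>k\<in>A. a' k * x k))" .
    qed
    also have "\<dots> = complex_of_real (exp (- ((s b)\<^sup>2 * (a b)\<^sup>2) / 2)) * complex_of_real (exp (- bil \<sigma> A a' a' / 2))"
    proof -
      have "(CLINT x|(\<Pi>\<^sub>M k\<in>A. lborel). complex_of_real (innovation_density e s A x) * iexp (\<Sum>k\<in>A. a' k * x k)) =
          complex_of_real (exp (- bil \<sigma> A a' a' / 2))"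
        using IH[THEN conjunct2] by (rule spec)
      then show ?thesis by (subst integral_mult_right_zero) (rule arg_cong)
    qed
    also have "\<dots> = complex_of_real (exp (- bil \<sigma> ?A a a / 2))"
    proof -
      have a'b: "a' b = 0" by (simp add: a'_def ebb)
      have finA: "finite ?A" using insert.hyps by simp
      \<comment> \<open>On \<open>insert b A\<close> the vector \<open>a'\<close> lives on indices
        before \<open>b\<close>, hence is uncorrelated with the innovation at \<open>b\<close>, and
        variances add.\<close>
      have orth: "bil \<sigma> ?A (e b) a' = 0"
        using insert.prems(1)[of b] insert.hyps finA a'b
        by (intro innovation_orthogonal[where A = ?A]) auto
      have "bil \<sigma> ?A a a = bil \<sigma> ?A (\<lambda>l. a' l + a b * e b l) (\<lambda>l. a' l + a b * e b l)"
        by (simp add: a'_def)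
      also have "\<dots> = bil \<sigma> ?A a' a' + (a b)\<^sup>2 * bil \<sigma> ?A (e b) (e b)"
        using orth bil_commute[of \<sigma> ?A "e b" a'] sym
        by (simp add: bil_add_left bil_add_right bil_scale_left bil_scale_right power2_eq_square)
      also have "bil \<sigma> ?A a' a' = bil \<sigma> A a' a'"
        using finA a'b by (intro bil_mono_neutral) auto
      finally have "bil \<sigma> ?A a a = bil \<sigma> A a' a' + (s b)\<^sup>2 * (a b)\<^sup>2"
        using insert.prems(3)[of b] by simp
      then have "- bil \<sigma> ?A a a / 2 = - ((s b)\<^sup>2 * (a b)\<^sup>2) / 2 + - bil \<sigma> A a' a' / 2" by simp
      then show ?thesis by (simp only: exp_add of_real_mult)
    qed
    finally show ?thesis .
  qed
  ultimately show ?case by blast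
qed

theorem gaussian_law_innovation_density:
  fixes Z :: "int \<Rightarrow> 'a \<Rightarrow> real"
  assumes M: "prob_space M" and T: "finite T"
    and Z: "\<And>k. k \<in> T \<Longrightarrow> Z k \<in> borel_measurable M"
    and char: "\<And>a. (CLINT x|M. iexp (\<Sum>k\<in>T. a k * Z k x)) = complex_of_real (exp (- bil \<sigma> T a a / 2))"
    and e: "\<And>k. k \<in> T \<Longrightarrow> innovation \<sigma> T k (e k)"
    and s: "\<And>k. k \<in> T \<Longrightarrow> s k > 0" "\<And>k. k \<in> T \<Longrightarrow> (s k)\<^sup>2 = bil \<sigma> T (e k) (e k)"
    and sym: "\<And>i j. \<sigma> i j = \<sigma> j i"
  shows "distr M (\<Pi>\<^sub>M k\<in>T. borel) (\<lambda>x. \<lambda>k\<in>T. Z k x) =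
    density (\<Pi>\<^sub>M k\<in>T. lborel) (\<lambda>y. ennreal (innovation_density e s T y))"
proof -
  let ?N = "density (\<Pi>\<^sub>M k\<in>T. lborel) (\<lambda>y. ennreal (innovation_density e s T y))"
  note D = innovation_density_char[OF T e s sym]
  have N: "prob_space ?N"
    by (rule prob_spaceI) (simp add: emeasure_density D cong: nn_integral_cong_simp)
  have sets_eq: "sets (\<Pi>\<^sub>M k\<in>T. (lborel :: real measure)) = sets (\<Pi>\<^sub>M k\<in>T. borel)"
    by (intro sets_PiM_cong) auto
  have "distr M (\<Pi>\<^sub>M k\<in>T. borel) (\<lambda>x. \<lambda>k\<in>T. Z k x) = distr ?N (\<Pi>\<^sub>M k\<in>T. borel) (\<lambda>y. \<lambda>k\<in>T. y k)"
  proof (rule char_functional_uniqueness[OF M N T Z])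
    fix a
    have "(CLINT y|?N. iexp (\<Sum>k\<in>T. a k * y k)) =
      (CLINT y|(\<Pi>\<^sub>M k\<in>T. lborel). complex_of_real (innovation_density e s T y) * iexp (\<Sum>k\<in>T. a k * y k))"
      by (subst integral_density) (auto simp: innovation_density_nonneg scaleR_conv_of_real)
    then show "(CLINT x|M. iexp (\<Sum>k\<in>T. a k * Z k x)) = (CLINT y|?N. iexp (\<Sum>k\<in>T. a k * y k))"
      using char D by (simp only:)
  qed auto
  also have "\<dots> = ?N"
  proof (rule measure_eqI)
    fix B assume "B \<in> sets (distr ?N (\<Pi>\<^sub>M k\<in>T. borel) (\<lambda>y. \<lambda>k\<in>T. y k))"
    then have B: "B \<in> sets ?N" by (simp add: sets_eq)
    then have "emeasure (distr ?N (\<Pi>\<^sub>M k\<in>T. borel) (\<lambda>y. \<lambda>k\<in>T. y k)) B = emeasure ?N ((\<lambda>y. \<lambda>k\<in>T. y k) -` B \<inter> space ?N)"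
      by (intro emeasure_distr) (auto simp: sets_eq intro!: measurable_restrict)
    also have "(\<lambda>y. \<lambda>k\<in>T. y k) -` B \<inter> space ?N = B"
    proof -
      have "(\<lambda>k\<in>T. y k) = y" if "y \<in> space ?N" for y
        using that by (auto simp: space_PiM PiE_def extensional_restrict)
      then show ?thesis using sets.sets_into_space[OF B] by auto
    qed
    finally show "emeasure (distr ?N (\<Pi>\<^sub>M k\<in>T. borel) (\<lambda>y. \<lambda>k\<in>T. y k)) B = emeasure ?N B" .
  qed (simp add: sets_eq)
  finally show ?thesis .
qed

section \<open>Relative entropy of past and future\<close>

text \<open>The Donsker--Varadhan inequality for the test function \<open>u * indicator B\<close>.\<close>

lemma event_difference_le_relative_entropy:
  fixes f g :: "'a \<Rightarrow> real"
  assumes [measurable]: "f \<in> borel_measurable L" "g \<in> borel_measurable L" "B \<in> sets L"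
    and pos: "\<And>x. 0 < f x" "\<And>x. 0 < g x"
    and P: "prob_space (density L f)" and Q: "prob_space (density L g)"
    and int: "integrable (density L f) (\<lambda>x. ln (f x / g x))"
    and D: "(LINT x|density L f. ln (f x / g x)) \<le> D"
    and u: "0 < u" "u \<le> 1"
  shows "measure (density L f) B - measure (density L g) B \<le> D / u + u"
proof -
  let ?P = "density L f" and ?Q = "density L g"
  interpret P: prob_space ?P by fact
  interpret Q: prob_space ?Q by fact
  define h where "h x = u * indicator B x" for x
  have h: "0 \<le> h x" "h x \<le> 1" for x using u by (auto simp: h_def indicator_def)
  have [measurable]: "h \<in> borel_measurable L" unfolding h_def[abs_def] by measurable
  have intQ: "integrable ?Q (\<lambda>x. exp (h x))"
    using h by (intro Q.integrable_const_bound[of _ "exp 1"]) auto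
  have f0: "AE x in L. 0 \<le> f x" "AE x in L. 0 \<le> g x" using pos by (auto intro: less_imp_le)
  have swap: "f x *\<^sub>R ((g x / f x) * exp (h x)) = g x *\<^sub>R exp (h x)" for x
    using pos(1)[of x] by simp
  have intL: "integrable L (\<lambda>x. g x *\<^sub>R exp (h x))"
    using intQ f0 by (subst (asm) integrable_density) auto
  have intP: "integrable ?P (\<lambda>x. (g x / f x) * exp (h x))"
    by (subst integrable_density, measurable, rule f0, unfold swap, rule intL)
  have eqPQ: "(LINT x|?P. (g x / f x) * exp (h x)) = (LINT x|?Q. exp (h x))"
  proof -
    have "(LINT x|?P. (g x / f x) * exp (h x)) = (LINT x|L. f x *\<^sub>R ((g x / f x) * exp (h x)))"
      by (rule integral_density) (use f0 in measurable)
    also have "\<dots> = (LINT x|?Q. exp (h x))"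
      unfolding swap by (rule integral_density[symmetric]) (use f0 in measurable)
    finally show ?thesis .
  qed
  have intPh: "integrable ?P h" using h by (intro P.integrable_const_bound[of _ 1]) auto
  \<comment> \<open>The quadratic term, divided by \<open>u\<close> at the end, is the source of the
    summand \<open>u\<close> in the bound.\<close>
  have "exp u \<le> 1 + u + u\<^sup>2" using u by (intro exp_bound) auto
  have expQ: "(LINT x|?Q. exp (h x)) \<le> 1 + (u + u\<^sup>2) * measure ?Q B"
  proof -
    have "(LINT x|?Q. exp (h x)) \<le> (LINT x|?Q. 1 + (u + u\<^sup>2) * indicator B x)"
    proof (rule integral_mono[OF intQ])
      show "integrable ?Q (\<lambda>x. 1 + (u + u\<^sup>2) * indicator B x)"
        by (intro Bochner_Integration.integrable_add integrable_mult_right)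
          (auto intro!: Q.integrable_const_bound[of _ 1])
      show "exp (h x) \<le> 1 + (u + u\<^sup>2) * indicator B x" for x
        using \<open>exp u \<le> 1 + u + u\<^sup>2\<close> by (auto simp: h_def indicator_def)
    qed
    also have "\<dots> = 1 + (u + u\<^sup>2) * measure ?Q B"
    proof -
      have "integrable ?Q (\<lambda>x. indicator B x :: real)" by (auto intro!: Q.integrable_const_bound[of _ 1])
      then show ?thesis using Q.prob_space by simp
    qed
    finally show ?thesis .
  qed
  have "(LINT x|?P. h x + 1 - (g x / f x) * exp (h x)) \<le> (LINT x|?P. ln (f x / g x))"
  proof (rule integral_mono[OF _ int])
    show "integrable ?P (\<lambda>x. h x + 1 - (g x / f x) * exp (h x))" using intPh intP by auto
    \<comment> \<open>This is ln z \<le> z - 1 at z = (g / f) exp h.\<close>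
    show "h x + 1 - (g x / f x) * exp (h x) \<le> ln (f x / g x)" for x
    proof -
      have p: "(g x / f x) * exp (h x) > 0" using pos by simp
      have "ln ((g x / f x) * exp (h x)) \<le> (g x / f x) * exp (h x) - 1" by (rule ln_le_minus_one[OF p])
      moreover have "ln ((g x / f x) * exp (h x)) = - ln (f x / g x) + h x"
        using pos[of x] by (simp add: ln_mult_pos ln_div)
      ultimately show ?thesis by linarith
    qed
  qed
  moreover have "(LINT x|?P. h x + 1 - (g x / f x) * exp (h x)) =
      u * measure ?P B + 1 - (LINT x|?Q. exp (h x))"
  proof -
    have "(LINT x|?P. h x) = u * measure ?P B" by (simp add: h_def[abs_def])
    then show ?thesis using intPh intP P.prob_space eqPQ by simp
  qed
  ultimately have "u * measure ?P B - (u + u\<^sup>2) * measure ?Q B \<le> D" using D expQ by linarith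
  moreover have "u\<^sup>2 * measure ?Q B \<le> u\<^sup>2 * 1" by (intro mult_left_mono) auto
  ultimately have "u * (measure ?P B - measure ?Q B) \<le> D + u\<^sup>2" by (simp add: algebra_simps)
  then show ?thesis using u by (simp add: field_simps power2_eq_square)
qed

section \<open>The product law of past and future\<close>

text \<open>The law of \<open>decouple m X\<close> is the product of the laws of the past up to time \<open>m\<close> and of the
  future after it; its covariance matrix is \<open>block m \<sigma>\<close>.\<close>

definition decouple :: "int \<Rightarrow> (int \<Rightarrow> 'a \<Rightarrow> real) \<Rightarrow> int \<Rightarrow> 'a \<times> 'a \<Rightarrow> real" where
  "decouple m X k \<omega> = (if k \<le> m then X k (fst \<omega>) else X k (snd \<omega>))"

definition block :: "int \<Rightarrow> (int \<Rightarrow> int \<Rightarrow> real) \<Rightarrow> int \<Rightarrow> int \<Rightarrow> real" where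
  "block m \<sigma> i j = (if (i \<le> m) = (j \<le> m) then \<sigma> i j else 0)"

lemma bil_block:
  assumes "finite T"
  shows "bil (block m \<sigma>) T a b = bil \<sigma> {i\<in>T. i \<le> m} a b + bil \<sigma> {i\<in>T. \<not> i \<le> m} a b"
proof -
  let ?I = "{i\<in>T. i \<le> m}" and ?J = "{i\<in>T. \<not> i \<le> m}"
  have T: "T = ?I \<union> ?J" and disj: "?I \<inter> ?J = {}" by auto
  have split: "(\<Sum>i\<in>T. h i) = (\<Sum>i\<in>?I. h i) + (\<Sum>i\<in>?J. h i)" for h :: "int \<Rightarrow> real"
    using assms disj by (subst T, subst sum.union_disjoint) auto
  have "(\<Sum>j\<in>T. a i * b j * block m \<sigma> i j) = (\<Sum>j\<in>?I. a i * b j * \<sigma> i j)" if "i \<in> ?I" for i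
    unfolding split using that by (simp add: block_def)
  moreover have "(\<Sum>j\<in>T. a i * b j * block m \<sigma> i j) = (\<Sum>j\<in>?J. a i * b j * \<sigma> i j)" if "i \<in> ?J" for i
    unfolding split using that by (simp add: block_def)
  ultimately show ?thesis
    unfolding bil_def split[of "\<lambda>i. \<Sum>j\<in>T. _ i j"] by simp
qed

lemma bil_block_eq:
  assumes "finite T" "A = {i\<in>T. (i \<le> m) = (k \<le> m)}" "\<And>i. i \<in> T - A \<Longrightarrow> v i = 0"
  shows "bil (block m \<sigma>) T v v = bil \<sigma> T v v"
proof -
  have "bil (block m \<sigma>) T v v = bil (block m \<sigma>) A v v" using assms by (intro bil_mono_neutral) auto
  also have "\<dots> = bil \<sigma> A v v" unfolding bil_def by (intro sum.cong refl) (auto simp: assms block_def)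
  also have "\<dots> = bil \<sigma> T v v" using assms by (intro bil_mono_neutral[symmetric]) auto
  finally show ?thesis .
qed

text \<open>All covariances across time \<open>m\<close> vanish in \<open>block m \<sigma>\<close>,
  so an innovation computed on its own side of \<open>m\<close> is automatically orthogonal to the
  other side.\<close>

lemma innovation_block:
  assumes T: "finite T" "k \<in> T" and A: "A = {i\<in>T. (i \<le> m) = (k \<le> m)}" and v: "innovation \<sigma> A k v"
  shows "innovation (block m \<sigma>) T k v"
proof -
  have kA: "k \<in> A" using T A by simp
  have pair: "pairing (block m \<sigma>) (insert k T) v l = 0" if l: "l \<in> T" "l < k" for l
  proof -
    have "pairing (block m \<sigma>) (insert k T) v l = (\<Sum>i\<in>A. v i * block m \<sigma> i l)"
      unfolding pairing_def using T A v by (intro sum.mono_neutral_right) (auto simp: innovation_def)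
    also have "\<dots> = 0"
    proof (cases "l \<in> A")
      case True
      then have "(\<Sum>i\<in>A. v i * block m \<sigma> i l) = pairing \<sigma> (insert k A) v l"
        unfolding pairing_def insert_absorb[OF kA] by (intro sum.cong) (auto simp: A block_def)
      then show ?thesis using v True l by (simp add: innovation_def)
    next
      case False
      then show ?thesis using l by (intro sum.neutral) (auto simp: A block_def)
    qed
    finally show ?thesis .
  qed
  then show ?thesis using v A by (auto simp: innovation_def)
qed

context prob_space
begin

lemma prob_space_pair: "prob_space (M \<Otimes>\<^sub>M M)"
proof -
  interpret MM: pair_prob_space M M ..
  show ?thesis by (rule MM.P.prob_space_axioms)
qed

lemma decouple_measurable[measurable (raw)]:
  assumes [measurable]: "Z k \<in> borel_measurable M"
  shows "decouple m Z k \<in> borel_measurable (M \<Otimes>\<^sub>M M)"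
  unfolding decouple_def[abs_def] by measurable

lemma decouple_char:
  assumes T: "finite T" and Z: "\<And>k. k \<in> T \<Longrightarrow> Z k \<in> borel_measurable M"
  shows "(CLINT \<omega>|M \<Otimes>\<^sub>M M. iexp (\<Sum>k\<in>T. a k * decouple m Z k \<omega>)) =
    (CLINT x|M. iexp (\<Sum>k\<in>{i\<in>T. i \<le> m}. a k * Z k x)) *
    (CLINT x|M. iexp (\<Sum>k\<in>{i\<in>T. \<not> i \<le> m}. a k * Z k x))"
proof -
  interpret MM: pair_prob_space M M ..
  let ?I = "{i\<in>T. i \<le> m}" and ?J = "{i\<in>T. \<not> i \<le> m}"
  have split: "(\<Sum>k\<in>T. a k * decouple m Z k (x, y)) = (\<Sum>k\<in>?I. a k * Z k x) + (\<Sum>k\<in>?J. a k * Z k y)" for x y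
  proof -
    have "T = ?I \<union> ?J" by auto
    then have "(\<Sum>k\<in>T. a k * decouple m Z k (x, y)) = (\<Sum>k\<in>?I \<union> ?J. a k * decouple m Z k (x, y))" by simp
    also have "\<dots> = (\<Sum>k\<in>?I. a k * decouple m Z k (x, y)) + (\<Sum>k\<in>?J. a k * decouple m Z k (x, y))"
      using T by (intro sum.union_disjoint) auto
    finally show ?thesis by (simp add: decouple_def)
  qed
  have "integrable (M \<Otimes>\<^sub>M M) (\<lambda>\<omega>. complex_of_real 1 * iexp (\<Sum>k\<in>T. a k * decouple m Z k \<omega>))"
    by (rule integrable_bounded_iexp[where C = 1]) (auto intro!: MM.P.finite_measure_axioms borel_measurable_sum borel_measurable_times decouple_measurable Z)
  then have "(CLINT \<omega>|M \<Otimes>\<^sub>M M. iexp (\<Sum>k\<in>T. a k * decouple m Z k \<omega>)) =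
    (CLINT x|M. CLINT y|M. iexp (\<Sum>k\<in>T. a k * decouple m Z k (x, y)))"
    by (intro MM.integral_fst'[symmetric]) simp
  also have "\<dots> = (CLINT x|M. CLINT y|M. iexp (\<Sum>k\<in>?I. a k * Z k x) * iexp (\<Sum>k\<in>?J. a k * Z k y))"
    unfolding split of_real_add distrib_left exp_add ..
  also have "\<dots> = (CLINT x|M. iexp (\<Sum>k\<in>?I. a k * Z k x)) * (CLINT y|M. iexp (\<Sum>k\<in>?J. a k * Z k y))"
    by (simp only: integral_mult_right_zero integral_mult_left_zero)
  finally show ?thesis .
qed

end

lemma (in centred_gaussian) decouple_char_functional:
  assumes T: "finite T"
  shows "(CLINT \<omega>|M \<Otimes>\<^sub>M M. iexp (\<Sum>k\<in>T. a k * decouple m X k \<omega>)) =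
    complex_of_real (exp (- bil (block m \<sigma>) T a a / 2))"
proof -
  have "(CLINT \<omega>|M \<Otimes>\<^sub>M M. iexp (\<Sum>k\<in>T. a k * decouple m X k \<omega>)) =
    (CLINT x|M. iexp (lin {i\<in>T. i \<le> m} a x)) * (CLINT x|M. iexp (lin {i\<in>T. \<not> i \<le> m} a x))"
    unfolding lin_def by (rule decouple_char[OF T]) simp
  also have "\<dots> = complex_of_real (exp (- bil \<sigma> {i\<in>T. i \<le> m} a a / 2)) *
      complex_of_real (exp (- bil \<sigma> {i\<in>T. \<not> i \<le> m} a a / 2))"
    using T by (subst (1 2) char_functional) auto
  also have "\<dots> = complex_of_real (exp (- bil (block m \<sigma>) T a a / 2))"
    unfolding of_real_mult[symmetric] exp_add[symmetric] bil_block[OF T] by (simp add: field_simps)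
  finally show ?thesis .
qed

locale coercive_gaussian = centred_gaussian M X \<sigma> + covariance_form \<sigma> \<mu> \<Lambda>
  for M :: "'a measure" and X \<sigma> \<mu> \<Lambda>
begin

text \<open>Cutting to the two diagonal blocks preserves both bounds, so everything known about
  innovations holds for the product law with the same constants.\<close>

lemma covariance_form_block: "covariance_form (block m \<sigma>) \<mu> \<Lambda>"
proof
  show "block m \<sigma> i j = block m \<sigma> j i" for i j using sym by (auto simp: block_def)
  fix F :: "int set" and a :: "int \<Rightarrow> real" assume F: "finite F"
  have s: "(\<Sum>i\<in>F. (a i)\<^sup>2) = (\<Sum>i\<in>{i\<in>F. i \<le> m}. (a i)\<^sup>2) + (\<Sum>i\<in>{i\<in>F. \<not> i \<le> m}. (a i)\<^sup>2)"
    using F by (subst sum.union_disjoint[symmetric]) (auto intro!: sum.cong)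
  show "\<mu> * (\<Sum>i\<in>F. (a i)\<^sup>2) \<le> bil (block m \<sigma>) F a a"
    unfolding bil_block[OF F] s distrib_left using F by (intro add_mono lower) auto
  show "bil (block m \<sigma>) F a a \<le> \<Lambda> * (\<Sum>i\<in>F. (a i)\<^sup>2)"
    unfolding bil_block[OF F] s distrib_left using F by (intro add_mono upper) auto
qed (rule \<mu>_pos \<Lambda>_pos)+

lemma joint_density:
  assumes T: "finite T" and e: "\<And>k. k \<in> T \<Longrightarrow> innovation \<sigma> T k (e k)"
  shows "distr M (\<Pi>\<^sub>M k\<in>T. borel) (\<lambda>\<omega>. \<lambda>k\<in>T. X k \<omega>) =
    density (\<Pi>\<^sub>M k\<in>T. lborel) (\<lambda>y. ennreal (innovation_density e (\<lambda>k. sqrt (bil \<sigma> T (e k) (e k))) T y))"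
proof (rule gaussian_law_innovation_density[OF prob_space_axioms T _ _ e])
  fix k assume "k \<in> T"
  then have "bil \<sigma> T (e k) (e k) > 0"
    using innovation_variance_lower[OF T _ _ e] \<mu>_pos by (force intro: less_le_trans)
  then show "0 < sqrt (bil \<sigma> T (e k) (e k))" "(sqrt (bil \<sigma> T (e k) (e k)))\<^sup>2 = bil \<sigma> T (e k) (e k)" by auto
qed (use char_functional[OF T] sym in \<open>auto simp: lin_def\<close>)

lemma decouple_density:
  assumes T: "finite T" and e: "\<And>k. k \<in> T \<Longrightarrow> innovation (block m \<sigma>) T k (e k)"
  shows "distr (M \<Otimes>\<^sub>M M) (\<Pi>\<^sub>M k\<in>T. borel) (\<lambda>\<omega>. \<lambda>k\<in>T. decouple m X k \<omega>) =
    density (\<Pi>\<^sub>M k\<in>T. lborel)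
      (\<lambda>y. ennreal (innovation_density e (\<lambda>k. sqrt (bil (block m \<sigma>) T (e k) (e k))) T y))"
proof (rule gaussian_law_innovation_density[OF prob_space_pair T _ _ e])
  interpret b: covariance_form "block m \<sigma>" \<mu> \<Lambda> by (rule covariance_form_block)
  show "block m \<sigma> i j = block m \<sigma> j i" for i j by (rule b.sym)
  fix k assume "k \<in> T"
  then have "bil (block m \<sigma>) T (e k) (e k) > 0"
    using b.innovation_variance_lower[OF T _ _ e] \<mu>_pos by (force intro: less_le_trans)
  then show "0 < sqrt (bil (block m \<sigma>) T (e k) (e k))"
    "(sqrt (bil (block m \<sigma>) T (e k) (e k)))\<^sup>2 = bil (block m \<sigma>) T (e k) (e k)" by auto
qed (use decouple_char_functional[OF T] in auto)

lemma ln_innovation_density: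
  assumes "finite T" "\<And>k. k \<in> T \<Longrightarrow> s k > 0"
  shows "ln (innovation_density e s T y) =
    (\<Sum>k\<in>T. - ln (sqrt (2 * pi)) - ln (s k) - (\<Sum>l\<in>T. e k l * y l)\<^sup>2 / (2 * (s k)\<^sup>2))"
proof -
  have "ln (normal_density 0 (s k) z) = - ln (sqrt (2 * pi)) - ln (s k) - z\<^sup>2 / (2 * (s k)\<^sup>2)"
    if "k \<in> T" for k z
    using assms(2)[OF that] unfolding normal_density_def
    by (simp add: ln_mult_pos ln_div real_sqrt_mult)
  moreover have "normal_density 0 (s k) z \<noteq> 0" if "k \<in> T" for k z
    using normal_density_pos[OF assms(2)[OF that], of 0 z] by linarith
  ultimately show ?thesis
    unfolding innovation_density_def using assms by (subst ln_prod) auto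
qed

text \<open>The log-likelihood ratio is a sum of logarithms ln (t / s) plus differences of
  normalised squared innovations. Under the joint law the squares cancel in the mean, and the
  logarithms at past indices vanish, so the entropy is half the sum bounded in
  \<open>sum_ln_innovation_variance_le\<close>.\<close>

lemma joint_vs_decoupled:
  assumes T: "finite T" and B: "B \<in> sets (\<Pi>\<^sub>M k\<in>T. borel)" and u: "0 < u" "u \<le> 1"
  shows "measure M ((\<lambda>\<omega>. \<lambda>k\<in>T. X k \<omega>) -` B \<inter> space M) -
    measure (M \<Otimes>\<^sub>M M) ((\<lambda>\<omega>. \<lambda>k\<in>T. decouple m X k \<omega>) -` B \<inter> space (M \<Otimes>\<^sub>M M))
    \<le> \<Lambda> / \<mu> ^ 3 * (\<Sum>i\<in>{i\<in>T. i \<le> m}. \<Sum>j\<in>{i\<in>T. \<not> i \<le> m}. (\<sigma> i j)\<^sup>2) / u + u"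
proof -
  interpret MM: prob_space "M \<Otimes>\<^sub>M M" by (rule prob_space_pair)
  let ?I = "{i\<in>T. i \<le> m}" and ?J = "{i\<in>T. \<not> i \<le> m}"
  let ?L = "\<Pi>\<^sub>M k\<in>T. (lborel :: real measure)"
  have TIJ: "?I \<union> ?J = T" by auto
  have "\<forall>k. \<exists>v. innovation \<sigma> T k v" using exists_innovation[OF T] by blast
  then obtain e where e: "\<And>k. innovation \<sigma> T k (e k)" by metis
  have "\<forall>k. \<exists>v. innovation \<sigma> ?J k v" using exists_innovation[of ?J] T by simp
  then obtain e1 where e1: "\<And>k. innovation \<sigma> ?J k (e1 k)" by metis
  \<comment> \<open>Up to time \<open>m\<close> an innovation involves earlier indices only, hence
    is the same for both laws; after \<open>m\<close> the product law forgets the past.\<close>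
  define e' where "e' k = (if k \<le> m then e k else e1 k)" for k
  have e'J: "innovation \<sigma> {i\<in>T. (i \<le> m) = (k \<le> m)} k (e' k)" if "k \<in> T" for k
  proof (cases "k \<le> m")
    case True
    have "innovation \<sigma> {i\<in>T. (i \<le> m) = (k \<le> m)} k (e k)"
      by (rule innovation_subset[OF e]) (use True T in auto)
    then show ?thesis using True by (simp add: e'_def)
  next
    case False
    then show ?thesis using e1[of k] by (simp add: e'_def)
  qed
  have e'b: "innovation (block m \<sigma>) T k (e' k)" if "k \<in> T" for k
    by (rule innovation_block[OF T that refl e'J[OF that]])
  define s where "s k = sqrt (bil \<sigma> T (e k) (e k))" for k
  define t where "t k = sqrt (bil (block m \<sigma>) T (e' k) (e' k))" for k
  interpret b: covariance_form "block m \<sigma>" \<mu> \<Lambda> by (rule covariance_form_block)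
  have s2: "(s k)\<^sup>2 = bil \<sigma> T (e k) (e k)" "s k > 0" if "k \<in> T" for k
    using innovation_variance_lower[OF T _ that e] \<mu>_pos by (auto simp: s_def)
  have t2: "(t k)\<^sup>2 = bil (block m \<sigma>) T (e' k) (e' k)" "t k > 0" if "k \<in> T" for k
    using b.innovation_variance_lower[OF T _ that e'b[OF that]] \<mu>_pos by (auto simp: t_def)
  \<comment> \<open>Each \<open>e' k\<close> is supported on one side of \<open>m\<close>, so its
    variance is the same under the joint and the product law. The cancellation below rests on
    this.\<close>
  have t2': "(t k)\<^sup>2 = bil \<sigma> T (e' k) (e' k)" if "k \<in> T" for k
    unfolding t2(1)[OF that]
    by (rule bil_block_eq[OF T refl, where k = k]) (use e'J[OF that] that in \<open>auto simp: innovation_def\<close>)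
  let ?f = "innovation_density e s T" and ?g = "innovation_density e' t T"
  let ?X = "\<lambda>\<omega>. \<lambda>k\<in>T. X k \<omega>" and ?X' = "\<lambda>\<omega>. \<lambda>k\<in>T. decouple m X k \<omega>"
  have P: "distr M (\<Pi>\<^sub>M k\<in>T. borel) ?X = density ?L ?f"
    unfolding s_def by (rule joint_density[OF T e])
  have Q: "distr (M \<Otimes>\<^sub>M M) (\<Pi>\<^sub>M k\<in>T. borel) ?X' = density ?L ?g"
    unfolding t_def by (rule decouple_density[OF T e'b])
  have Xm[measurable]: "?X \<in> measurable M (\<Pi>\<^sub>M k\<in>T. borel)"
    and X'm[measurable]: "?X' \<in> measurable (M \<Otimes>\<^sub>M M) (\<Pi>\<^sub>M k\<in>T. borel)" by (auto intro!: measurable_restrict)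
  have pP: "prob_space (density ?L ?f)" unfolding P[symmetric] by (rule prob_space_distr) simp
  have pQ: "prob_space (density ?L ?g)" unfolding Q[symmetric] by (rule MM.prob_space_distr) simp
  define K where "K y = (\<Sum>k\<in>T. ln (t k / s k) + ((\<Sum>l\<in>T. e' k l * y l)\<^sup>2 / (2 * (t k)\<^sup>2) -
      (\<Sum>l\<in>T. e k l * y l)\<^sup>2 / (2 * (s k)\<^sup>2)))" for y
  have K_eq: "ln (?f y / ?g y) = K y" for y
  proof -
    have lnf: "ln (?f y) = (\<Sum>k\<in>T. - ln (sqrt (2 * pi)) - ln (s k) - (\<Sum>l\<in>T. e k l * y l)\<^sup>2 / (2 * (s k)\<^sup>2))"
      by (rule ln_innovation_density[OF T]) (rule s2)
    have lng: "ln (?g y) = (\<Sum>k\<in>T. - ln (sqrt (2 * pi)) - ln (t k) - (\<Sum>l\<in>T. e' k l * y l)\<^sup>2 / (2 * (t k)\<^sup>2))"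
      by (rule ln_innovation_density[OF T]) (rule t2)
    have "ln (?f y / ?g y) = ln (?f y) - ln (?g y)"
      using s2 t2 by (intro ln_divide_pos innovation_density_pos) auto
    also have "\<dots> = K y"
      unfolding K_def lnf lng sum_subtractf[symmetric]
    proof (rule sum.cong[OF refl])
      fix k assume "k \<in> T"
      then have "ln (t k / s k) = ln (t k) - ln (s k)" using s2 t2 by (intro ln_divide_pos) auto
      then show "- ln (sqrt (2 * pi)) - ln (s k) - (\<Sum>l\<in>T. e k l * y l)\<^sup>2 / (2 * (s k)\<^sup>2) -
          (- ln (sqrt (2 * pi)) - ln (t k) - (\<Sum>l\<in>T. e' k l * y l)\<^sup>2 / (2 * (t k)\<^sup>2)) =
        ln (t k / s k) + ((\<Sum>l\<in>T. e' k l * y l)\<^sup>2 / (2 * (t k)\<^sup>2) - (\<Sum>l\<in>T. e k l * y l)\<^sup>2 / (2 * (s k)\<^sup>2))"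
        by linarith
    qed
    finally show ?thesis .
  qed
  have [measurable]: "K \<in> borel_measurable (\<Pi>\<^sub>M k\<in>T. borel)" unfolding K_def[abs_def] by measurable
  have KX: "K (?X \<omega>) = (\<Sum>k\<in>T. ln (t k / s k) + ((lin T (e' k) \<omega>)\<^sup>2 / (2 * (t k)\<^sup>2) -
      (lin T (e k) \<omega>)\<^sup>2 / (2 * (s k)\<^sup>2)))" for \<omega>
    unfolding K_def lin_def by simp
  have intKX: "integrable M (\<lambda>\<omega>. K (?X \<omega>))"
    unfolding KX using integrable_lin_power[OF T, where k = 2]
    by (intro Bochner_Integration.integrable_sum Bochner_Integration.integrable_add
        Bochner_Integration.integrable_diff integrable_divide_zero) auto
  have "integrable (distr M (\<Pi>\<^sub>M k\<in>T. borel) ?X) K"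
    using intKX by (subst integrable_distr_eq) auto
  then have int: "integrable (density ?L ?f) (\<lambda>y. ln (?f y / ?g y))"
    unfolding P K_eq .
  have "(LINT y|density ?L ?f. ln (?f y / ?g y)) = (LINT y|distr M (\<Pi>\<^sub>M k\<in>T. borel) ?X. K y)"
    unfolding K_eq P ..
  also have "\<dots> = expectation (\<lambda>\<omega>. K (?X \<omega>))" by (rule integral_distr) auto
  also have "\<dots> = (\<Sum>k\<in>T. ln (t k / s k) + (bil \<sigma> T (e' k) (e' k) / (2 * (t k)\<^sup>2) - bil \<sigma> T (e k) (e k) / (2 * (s k)\<^sup>2)))"
    unfolding KX using integrable_lin_power[OF T, where k = 2]
    by (simp add: expectation_lin_square Bochner_Integration.integral_add prob_space)
  \<comment> \<open>Both normalised squares have mean 1/2.\<close>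
  also have "\<dots> = (\<Sum>k\<in>T. ln (t k / s k))"
  proof (rule sum.cong[OF refl])
    fix k assume k: "k \<in> T"
    show "ln (t k / s k) + (bil \<sigma> T (e' k) (e' k) / (2 * (t k)\<^sup>2) - bil \<sigma> T (e k) (e k) / (2 * (s k)\<^sup>2)) = ln (t k / s k)"
      unfolding t2'[OF k, symmetric] s2(1)[OF k, symmetric] using s2(2)[OF k] t2(2)[OF k] by simp
  qed
  also have "\<dots> = (\<Sum>k\<in>?J. ln (t k / s k))"
  proof (rule sum.mono_neutral_right[OF T])
    show "\<forall>k\<in>T - ?J. ln (t k / s k) = 0"
    proof
      fix k assume k: "k \<in> T - ?J"
      then have "(t k)\<^sup>2 = (s k)\<^sup>2" using t2'[of k] s2[of k] by (simp add: e'_def)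
      then have "t k = s k" using t2[of k] s2[of k] k by (simp add: power2_eq_iff)
      then show "ln (t k / s k) = 0" using s2[of k] k by simp
    qed
  qed auto
  \<comment> \<open>From standard deviations to variances; the factor 1/2 is given away
    afterwards.\<close>
  also have "\<dots> = (\<Sum>k\<in>?J. ln (bil \<sigma> T (e' k) (e' k) / bil \<sigma> T (e k) (e k))) / 2"
    unfolding sum_divide_distrib
  proof (rule sum.cong[OF refl])
    fix k assume "k \<in> ?J"
    then have k: "k \<in> T" by simp
    have "bil \<sigma> T (e' k) (e' k) / bil \<sigma> T (e k) (e k) = (t k / s k)\<^sup>2"
      unfolding t2'[OF k, symmetric] s2(1)[OF k, symmetric] by (simp add: power_divide)
    then show "ln (t k / s k) = ln (bil \<sigma> T (e' k) (e' k) / bil \<sigma> T (e k) (e k)) / 2"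
      using s2(2)[OF k] t2(2)[OF k] by (simp add: ln_realpow)
  qed
  finally have KL: "(LINT y|density ?L ?f. ln (?f y / ?g y)) =
    (\<Sum>k\<in>?J. ln (bil \<sigma> T (e' k) (e' k) / bil \<sigma> T (e k) (e k))) / 2" .
  have ln_sum: "(\<Sum>k\<in>?J. ln (bil \<sigma> (?I \<union> ?J) (e' k) (e' k) / bil \<sigma> (?I \<union> ?J) (e k) (e k)))
    \<le> \<Lambda> / \<mu> ^ 3 * (\<Sum>i\<in>?I. \<Sum>j\<in>?J. (\<sigma> i j)\<^sup>2)"
  proof (rule sum_ln_innovation_variance_le)
    fix k assume "k \<in> ?J"
    then show "innovation \<sigma> ?J k (e' k)" using e'J[of k] by simp
    show "innovation \<sigma> (?I \<union> ?J) k (e k)" unfolding TIJ by (rule e)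
  qed (use T in auto)
  have nn: "0 \<le> \<Lambda> / \<mu> ^ 3 * (\<Sum>i\<in>?I. \<Sum>j\<in>?J. (\<sigma> i j)\<^sup>2)"
    using \<Lambda>_pos \<mu>_pos by (intro mult_nonneg_nonneg sum_nonneg) auto
  have sets_eq: "sets ?L = sets (\<Pi>\<^sub>M k\<in>T. borel)" by (intro sets_PiM_cong) auto
  have "measure (density ?L ?f) B - measure (density ?L ?g) B
    \<le> \<Lambda> / \<mu> ^ 3 * (\<Sum>i\<in>?I. \<Sum>j\<in>?J. (\<sigma> i j)\<^sup>2) / u + u"
  proof (rule event_difference_le_relative_entropy[OF _ _ _ _ _ pP pQ int _ u])
    show "(LINT y|density ?L ?f. ln (?f y / ?g y)) \<le> \<Lambda> / \<mu> ^ 3 * (\<Sum>i\<in>?I. \<Sum>j\<in>?J. (\<sigma> i j)\<^sup>2)"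
      unfolding KL using ln_sum nn unfolding TIJ by linarith
  qed (use s2 t2 B sets_eq in \<open>auto intro!: innovation_density_pos\<close>)
  then show ?thesis
    unfolding P[symmetric] Q[symmetric] using B by (simp add: measure_distr)
qed

end

section \<open>Conditional laws of the future\<close>

text \<open>The L1 norms of the increments are summable, so the sum of their absolute values is
  integrable and therefore almost surely finite; then telescope.\<close>

lemma (in prob_space) AE_convergent_of_summable_increments:
  fixes q :: "nat \<Rightarrow> 'a \<Rightarrow> real"
  assumes [measurable]: "\<And>k. q k \<in> borel_measurable M"
    and incr: "\<And>k. (\<integral>\<^sup>+\<omega>. ennreal \<bar>q (Suc k) \<omega> - q k \<omega>\<bar> \<partial>M) \<le> ennreal ((1/2) ^ k)"
  shows "AE \<omega> in M. convergent (\<lambda>k. q k \<omega>)"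
proof -
  have "(\<integral>\<^sup>+\<omega>. (\<Sum>k. ennreal \<bar>q (Suc k) \<omega> - q k \<omega>\<bar>) \<partial>M) = (\<Sum>k. \<integral>\<^sup>+\<omega>. ennreal \<bar>q (Suc k) \<omega> - q k \<omega>\<bar> \<partial>M)"
    by (rule nn_integral_suminf) measurable
  also have "\<dots> \<le> (\<Sum>k. ennreal ((1/2) ^ k))" using incr by (intro suminf_le) auto
  also have "\<dots> = ennreal (\<Sum>k. (1/2) ^ k)" by (intro suminf_ennreal2) (auto intro: summable_geometric)
  also have "\<dots> < \<infinity>" by simp
  finally have "AE \<omega> in M. (\<Sum>k. ennreal \<bar>q (Suc k) \<omega> - q k \<omega>\<bar>) \<noteq> \<infinity>"
    by (intro nn_integral_PInf_AE) auto
  then show ?thesis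
  proof eventually_elim
    case (elim \<omega>)
    then have "summable (\<lambda>k. \<bar>q (Suc k) \<omega> - q k \<omega>\<bar>)"
      by (intro summable_suminf_not_top) auto
    then have "summable (\<lambda>k. q (Suc k) \<omega> - q k \<omega>)" by (rule summable_rabs_cancel)
    then have "convergent (\<lambda>n. \<Sum>k<n. q (Suc k) \<omega> - q k \<omega>)" by (simp add: summable_iff_convergent)
    then have "convergent (\<lambda>n. q n \<omega> - q 0 \<omega>)" by (simp only: sum_lessThan_telescope[of "\<lambda>k. q k \<omega>"])
    then have "convergent (\<lambda>n. (q n \<omega> - q 0 \<omega>) + q 0 \<omega>)" by (intro convergent_add convergent_const)
    then show ?case by simp
  qed
qed

lemma space_generated_field[simp]: "space (generated_field M X J) = space M"
  unfolding generated_field_def by (rule space_measure_of) auto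

lemma sets_generated_field:
  "sets (generated_field M X J) = sigma_sets (space M) (\<Union>j\<in>J. {X j -` A \<inter> space M | A. A \<in> sets borel})"
  unfolding generated_field_def by (rule sets_measure_of) auto

lemma measurable_generated_field:
  assumes "j \<in> J" shows "X j \<in> borel_measurable (generated_field M X J)"
proof (rule measurableI)
  fix A :: "real set" assume "A \<in> sets borel"
  then show "X j -` A \<inter> space (generated_field M X J) \<in> sets (generated_field M X J)"
    unfolding sets_generated_field space_generated_field using assms by (intro sigma_sets.Basic) auto
qed simp

lemma subalgebra_generated_field:
  assumes "\<And>j. j \<in> J \<Longrightarrow> X j \<in> borel_measurable M"
  shows "subalgebra M (generated_field M X J)"
  unfolding subalgebra_def sets_generated_field space_generated_field
  using assms by (auto intro!: sets.sigma_sets_subset simp: measurable_sets)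

text \<open>The generators are preimages under the map to sequences, and preimages form a
  sigma-field. Statements about past events can therefore be read off from laws on sequence
  space.\<close>

lemma generated_field_obtain:
  assumes "A \<in> sets (generated_field M X J)"
  obtains B where "B \<in> sets (\<Pi>\<^sub>M j\<in>J. borel)" "A = (\<lambda>\<omega>. \<lambda>j\<in>J. X j \<omega>) -` B \<inter> space M"
proof -
  let ?f = "\<lambda>\<omega>. \<lambda>j\<in>J. X j \<omega>" and ?N = "\<Pi>\<^sub>M j\<in>J. (borel :: real measure)"
  let ?V = "vimage_algebra (space M) ?f ?N"
  have f: "?f \<in> space M \<rightarrow> space ?N" by (auto simp: space_PiM)
  have fV: "?f \<in> measurable ?V ?N" by (rule measurable_vimage_algebra1[OF f])
  have "sets (generated_field M X J) \<subseteq> sets ?V"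
    unfolding sets_generated_field
  proof (rule sets.sigma_sets_subset[of _ ?V, simplified])
    show "(\<Union>j\<in>J. {X j -` A \<inter> space M |A. A \<in> sets borel}) \<subseteq> sets ?V"
    proof safe
      fix j and A :: "real set" assume j: "j \<in> J" and A: "A \<in> sets borel"
      have "(\<lambda>\<omega>. ?f \<omega> j) \<in> borel_measurable ?V"
        using j by (intro measurable_compose[OF fV] measurable_component_singleton)
      then have "(\<lambda>\<omega>. ?f \<omega> j) -` A \<inter> space ?V \<in> sets ?V" using A by (rule measurable_sets)
      then show "X j -` A \<inter> space M \<in> sets ?V" using j by simp
    qed
  qed
  then have "A \<in> {?f -` B \<inter> space M | B. B \<in> sets ?N}"
    using assms sets_vimage_algebra2[OF f] by auto
  then show ?thesis using that by blast
qed

lemma pairing_sum: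
  assumes "finite J"
  shows "pairing \<sigma> V (\<lambda>i. \<Sum>j\<in>J. b j * w j i) l = (\<Sum>j\<in>J. b j * pairing \<sigma> V (w j) l)"
  unfolding pairing_def sum_distrib_left sum_distrib_right
  by (subst sum.swap) (simp add: mult.assoc)

lemma pairing_mono_neutral:
  assumes "finite V" "T \<subseteq> V" "\<And>i. i \<notin> T \<Longrightarrow> w i = 0"
  shows "pairing \<sigma> V w l = pairing \<sigma> T w l"
  unfolding pairing_def using assms by (intro sum.mono_neutral_right) auto

context centred_gaussian
begin

lemma lin_mono_neutral:
  assumes "finite V" "T \<subseteq> V" "\<And>i. i \<notin> T \<Longrightarrow> w i = 0"
  shows "lin V w \<omega> = lin T w \<omega>"
  unfolding lin_def using assms by (intro sum.mono_neutral_right) auto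

lemma lin_add: "lin V a \<omega> + lin V b \<omega> = lin V (\<lambda>i. a i + b i) \<omega>"
  by (simp add: lin_def sum.distrib[symmetric] algebra_simps)

lemma lin_diff: "lin V a \<omega> - lin V b \<omega> = lin V (\<lambda>i. a i - b i) \<omega>"
  by (simp add: lin_def sum_subtractf[symmetric] algebra_simps)

lemma char_functional_add_orthogonal:
  assumes "finite V" "bil \<sigma> V a b = 0"
  shows "(CLINT \<omega>|M. iexp (lin V a \<omega> + lin V b \<omega>)) =
    (CLINT \<omega>|M. iexp (lin V a \<omega>)) * (CLINT \<omega>|M. iexp (lin V b \<omega>))"
proof -
  have "bil \<sigma> V (\<lambda>i. a i + b i) (\<lambda>i. a i + b i) = bil \<sigma> V a a + bil \<sigma> V b b"
    using assms(2) bil_commute[of \<sigma> V a b] cov_sym by (simp add: bil_add_left bil_add_right)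
  then show ?thesis
    unfolding lin_add char_functional[OF assms(1)] of_real_mult[symmetric] exp_add[symmetric]
    by (simp add: field_simps)
qed

lemma nn_integral_abs_lin_le:
  assumes J: "finite J" and c: "c > 0" and v: "bil \<sigma> J v v \<le> c\<^sup>2"
  shows "(\<integral>\<^sup>+\<omega>. ennreal \<bar>lin J v \<omega>\<bar> \<partial>M) \<le> ennreal c"
proof -
  have int: "integrable M (\<lambda>\<omega>. c / 2 + (lin J v \<omega>)\<^sup>2 / (2 * c))"
    using integrable_lin_power[OF J, of v 2] by simp
  \<comment> \<open>The arithmetic-geometric mean inequality turns a variance bound c^2 into an L1
    bound c.\<close>
  have "\<bar>y\<bar> \<le> c / 2 + y\<^sup>2 / (2 * c)" for y
    using c sum_squares_bound[of c "\<bar>y\<bar>"] by (simp add: field_simps power2_eq_square)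
  then have "(\<integral>\<^sup>+\<omega>. ennreal \<bar>lin J v \<omega>\<bar> \<partial>M) \<le> (\<integral>\<^sup>+\<omega>. ennreal (c / 2 + (lin J v \<omega>)\<^sup>2 / (2 * c)) \<partial>M)"
    by (intro nn_integral_mono ennreal_leI)
  also have "\<dots> = ennreal (expectation (\<lambda>\<omega>. c / 2 + (lin J v \<omega>)\<^sup>2 / (2 * c)))"
    using int c by (intro nn_integral_eq_integral) auto
  also have "expectation (\<lambda>\<omega>. c / 2 + (lin J v \<omega>)\<^sup>2 / (2 * c)) = c / 2 + bil \<sigma> J v v / (2 * c)"
    using integrable_lin_power[OF J, of v 2] by (simp add: expectation_lin_square prob_space)
  also have "\<dots> \<le> c"
    using c v by (simp add: field_simps power2_eq_square)
  finally show ?thesis by (simp add: ennreal_leI)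
qed

text \<open>The projection onto the infinite past need not be a finite linear combination, so orthogonality
  to the past is recorded for approximations only.\<close>

definition past_residual :: "int \<Rightarrow> ('a \<Rightarrow> real) \<Rightarrow> (nat \<Rightarrow> int set) \<Rightarrow> (nat \<Rightarrow> int \<Rightarrow> real) \<Rightarrow> bool" where
  "past_residual m R T w \<longleftrightarrow>
     (\<forall>k. finite (T k)) \<and> (\<forall>k i. i \<notin> T k \<longrightarrow> w k i = 0) \<and>
     (\<forall>l\<le>m. \<forall>\<^sub>F k in sequentially. pairing \<sigma> (T k) (w k) l = 0) \<and>
     (AE \<omega> in M. (\<lambda>k. lin (T k) (w k) \<omega>) \<longlonglongrightarrow> R \<omega>)"

text \<open>For late approximations the residuals are exactly orthogonal to the finitely many past
  variables in \<open>I\<close>, so the Gaussian transforms factor; dominated convergence carries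
  the factorisation to the limits.\<close>

lemma past_residual_char:
  assumes I: "finite I" "I \<subseteq> {..m}" and J: "finite J"
    and R[measurable]: "\<And>j. R j \<in> borel_measurable M"
    and res: "\<And>j. j \<in> J \<Longrightarrow> past_residual m (R j) (T j) (w j)"
  shows "(CLINT \<omega>|M. iexp (lin I a \<omega> + (\<Sum>j\<in>J. b j * R j \<omega>))) =
    (CLINT \<omega>|M. iexp (lin I a \<omega>)) * (CLINT \<omega>|M. iexp (\<Sum>j\<in>J. b j * R j \<omega>))"
proof -
  define V where "V k = I \<union> (\<Union>j\<in>J. T j k)" for k
  define c where "c k i = (\<Sum>j\<in>J. b j * w j k i)" for k i
  define a' where "a' i = (if i \<in> I then a i else 0)" for i
  have V: "finite (V k)" for k using I J res by (auto simp: V_def past_residual_def)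
  have lin_a: "lin I a \<omega> = lin (V k) a' \<omega>" for k \<omega>
  proof -
    have "lin (V k) a' \<omega> = lin I a' \<omega>" using V by (intro lin_mono_neutral) (auto simp: V_def a'_def)
    then show ?thesis by (simp add: lin_def a'_def)
  qed
  have w0: "w j k i = 0" if "j \<in> J" "i \<notin> T j k" for i j k
    using res[OF that(1)] that(2) unfolding past_residual_def by blast
  have lin_c: "(\<Sum>j\<in>J. b j * lin (T j k) (w j k) \<omega>) = lin (V k) (c k) \<omega>" for k \<omega>
  proof -
    have "(\<Sum>j\<in>J. b j * lin (T j k) (w j k) \<omega>) = (\<Sum>j\<in>J. b j * lin (V k) (w j k) \<omega>)"
      using V w0 by (intro sum.cong refl arg_cong2[where f = "(*)"] lin_mono_neutral[symmetric]) (auto simp: V_def)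
    also have "\<dots> = lin (V k) (c k) \<omega>"
      unfolding lin_def c_def sum_distrib_left sum_distrib_right by (subst sum.swap) (simp add: mult.assoc)
    finally show ?thesis .
  qed
  have lim: "AE \<omega> in M. (\<lambda>k. \<Sum>j\<in>J. b j * lin (T j k) (w j k) \<omega>) \<longlonglongrightarrow> (\<Sum>j\<in>J. b j * R j \<omega>)"
  proof -
    have "AE \<omega> in M. \<forall>j\<in>J. (\<lambda>k. lin (T j k) (w j k) \<omega>) \<longlonglongrightarrow> R j \<omega>"
      using J res by (intro AE_finite_allI) (auto simp: past_residual_def)
    then show ?thesis by eventually_elim (auto intro!: tendsto_sum tendsto_mult)
  qed
  have 1: "(\<lambda>k. CLINT \<omega>|M. iexp (lin I a \<omega> + lin (V k) (c k) \<omega>)) \<longlonglongrightarrow>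
      (CLINT \<omega>|M. iexp (lin I a \<omega> + (\<Sum>j\<in>J. b j * R j \<omega>)))"
  proof (rule integral_dominated_convergence[where w = "\<lambda>_. 1"])
    show "AE \<omega> in M. (\<lambda>k. iexp (lin I a \<omega> + lin (V k) (c k) \<omega>)) \<longlonglongrightarrow> iexp (lin I a \<omega> + (\<Sum>j\<in>J. b j * R j \<omega>))"
      using lim unfolding lin_c by eventually_elim (intro tendsto_intros)
  qed auto
  have 2: "(\<lambda>k. CLINT \<omega>|M. iexp (lin (V k) (c k) \<omega>)) \<longlonglongrightarrow> (CLINT \<omega>|M. iexp (\<Sum>j\<in>J. b j * R j \<omega>))"
  proof (rule integral_dominated_convergence[where w = "\<lambda>_. 1"])
    show "AE \<omega> in M. (\<lambda>k. iexp (lin (V k) (c k) \<omega>)) \<longlonglongrightarrow> iexp (\<Sum>j\<in>J. b j * R j \<omega>)"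
      using lim unfolding lin_c by eventually_elim (intro tendsto_intros)
  qed auto
  \<comment> \<open>Finiteness of \<open>I\<close> and \<open>J\<close> makes the orthogonality
    relations hold simultaneously from some point on.\<close>
  have "\<forall>\<^sub>F k in sequentially. \<forall>j\<in>J. \<forall>l\<in>I. pairing \<sigma> (T j k) (w j k) l = 0"
    using res I J by (intro eventually_ball_finite ballI) (auto simp: past_residual_def)
  then have "\<forall>\<^sub>F k in sequentially. (CLINT \<omega>|M. iexp (lin I a \<omega> + lin (V k) (c k) \<omega>)) =
      (CLINT \<omega>|M. iexp (lin I a \<omega>)) * (CLINT \<omega>|M. iexp (lin (V k) (c k) \<omega>))"
  proof eventually_elim
    case (elim k)
    have "bil \<sigma> (V k) (c k) a' = 0"
      unfolding bil_eq_pairing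
    proof (rule sum.neutral, rule ballI)
      fix l assume "l \<in> V k"
      show "a' l * pairing \<sigma> (V k) (c k) l = 0"
      proof (cases "l \<in> I")
        case True
        have "pairing \<sigma> (V k) (c k) l = (\<Sum>j\<in>J. b j * pairing \<sigma> (V k) (w j k) l)"
          unfolding c_def using J by (rule pairing_sum)
        also have "\<dots> = (\<Sum>j\<in>J. b j * pairing \<sigma> (T j k) (w j k) l)"
          using V w0 by (intro sum.cong refl arg_cong2[where f = "(*)"] pairing_mono_neutral) (auto simp: V_def)
        also have "\<dots> = 0" using elim True by (intro sum.neutral) auto
        finally show ?thesis by simp
      qed (simp add: a'_def)
    qed
    then have "bil \<sigma> (V k) a' (c k) = 0" using bil_commute[of \<sigma>] cov_sym by metis
    then show ?case unfolding lin_a[of _ k] by (rule char_functional_add_orthogonal[OF V])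
  qed
  then have "(\<lambda>k. (CLINT \<omega>|M. iexp (lin I a \<omega>)) * (CLINT \<omega>|M. iexp (lin (V k) (c k) \<omega>))) \<longlonglongrightarrow>
      (CLINT \<omega>|M. iexp (lin I a \<omega> + (\<Sum>j\<in>J. b j * R j \<omega>)))"
    using 1 by (rule Lim_transform_eventually[rotated])
  moreover have "(\<lambda>k. (CLINT \<omega>|M. iexp (lin I a \<omega>)) * (CLINT \<omega>|M. iexp (lin (V k) (c k) \<omega>))) \<longlonglongrightarrow>
      (CLINT \<omega>|M. iexp (lin I a \<omega>)) * (CLINT \<omega>|M. iexp (\<Sum>j\<in>J. b j * R j \<omega>))"
    by (intro tendsto_intros 2)
  ultimately show ?thesis by (rule LIMSEQ_unique)
qed

end

section \<open>Projection of the future on the infinite past\<close>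

context coercive_gaussian
begin

text \<open>The variables are projected on the windows {m - N..m}. The residual variances
  \<open>d N\<close> decrease, hence converge, and by Pythagoras their differences are the variances
  of the differences of projections. A fast subsequence then converges almost surely.\<close>

lemma exists_past_residual:
  assumes j: "m < j"
  shows "\<exists>g T w. g \<in> borel_measurable (generated_field M X {..m}) \<and>
    past_residual m (\<lambda>\<omega>. X j \<omega> - g \<omega>) T w"
proof -
  define I where "I N = {m - int N..m}" for N
  define T where "T N = insert j (I N)" for N
  have fin: "finite (T N)" "finite (I N)" and IT: "I N \<subseteq> T N" and jI: "j \<notin> I N" "j \<in> T N" for N
    using j by (auto simp: T_def I_def)
  have I_mono: "I N \<subseteq> I N'" "T N \<subseteq> T N'" if "N \<le> N'" for N N' using that by (auto simp: I_def T_def)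
  have "\<forall>N. \<exists>w. (\<forall>i. i \<notin> I N \<longrightarrow> w i = (if i = j then 1 else 0)) \<and> (\<forall>l\<in>I N. pairing \<sigma> (T N) w l = 0)"
    by (intro allI exists_residual fin(1) IT)
  then obtain W where W: "\<And>N i. i \<notin> I N \<Longrightarrow> W N i = (if i = j then 1 else 0)"
    "\<And>N l. l \<in> I N \<Longrightarrow> pairing \<sigma> (T N) (W N) l = 0" by metis
  have W0: "W N i = 0" if "i \<notin> T N" for N i using that W(1)[of i N] by (auto simp: T_def)
  define d where "d N = bil \<sigma> (T N) (W N) (W N)" for N
  \<comment> \<open>The two vectors differ only inside the larger window, to which the residual
    \<open>W N'\<close> is orthogonal.\<close>
  have pyth: "bil \<sigma> (T N') (\<lambda>i. W N i - W N' i) (\<lambda>i. W N i - W N' i) = d N - d N'" if N: "N \<le> N'" for N N'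
  proof -
    define v where "v i = W N i - W N' i" for i
    have orth: "bil \<sigma> (T N') (W N') v = 0"
      unfolding bil_eq_pairing
    proof (rule sum.neutral, rule ballI)
      fix l assume "l \<in> T N'"
      show "v l * pairing \<sigma> (T N') (W N') l = 0"
      proof (cases "l \<in> I N'")
        case False
        then have "l \<notin> I N" using I_mono(1)[OF N] by blast
        then have "v l = 0" using W(1)[of l N] W(1)[of l N'] False by (simp add: v_def)
        then show ?thesis by simp
      qed (simp add: W(2))
    qed
    have "d N = bil \<sigma> (T N') (W N) (W N)"
      unfolding d_def using fin I_mono[OF N] W0 by (intro bil_mono_neutral[symmetric]) auto
    also have "\<dots> = bil \<sigma> (T N') (\<lambda>i. W N' i + v i) (\<lambda>i. W N' i + v i)" by (simp add: v_def)
    also have "\<dots> = d N' + bil \<sigma> (T N') v v"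
      using orth bil_commute[of \<sigma> "T N'" "W N'" v] sym by (simp add: bil_add_left bil_add_right d_def)
    finally show ?thesis by (simp add: v_def[abs_def])
  qed
  have dec: "d N' \<le> d N" if "N \<le> N'" for N N'
    using pyth[OF that] psd[OF fin(1)[of N']] by (metis diff_ge_0_iff_ge)
  have conv: "convergent d"
  proof -
    have "decseq d" using dec by (simp add: decseq_def)
    moreover have "\<forall>k. 0 \<le> d k" unfolding d_def using bil_nonneg by simp
    ultimately obtain L where "d \<longlonglongrightarrow> L" using decseq_convergent[of d 0] by blast
    then show ?thesis by (rule convergentI)
  qed
  have ex: "\<exists>n\<ge>n0. n \<ge> k \<and> (\<forall>N\<ge>n. d n - d N \<le> (1/4) ^ k)" for n0 k :: nat
  proof -
    have "Cauchy d" using conv by (rule convergent_Cauchy)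
    then obtain n1 where n1: "\<And>a b. a \<ge> n1 \<Longrightarrow> b \<ge> n1 \<Longrightarrow> dist (d a) (d b) < (1/4) ^ k"
      unfolding Cauchy_def by (metis zero_less_power zero_less_divide_1_iff zero_less_numeral)
    let ?n = "max n0 (max n1 k)"
    have "d ?n - d N \<le> (1/4) ^ k" if "N \<ge> ?n" for N
    proof -
      have "dist (d ?n) (d N) < (1/4) ^ k" using that by (intro n1) auto
      then show ?thesis unfolding dist_real_def by linarith
    qed
    then show ?thesis by (intro exI[of _ ?n]) auto
  qed
  \<comment> \<open>Increments along the subsequence have variance at most 4^-k, hence L1 norm at
    most 2^-k; \<open>n k \<ge> k\<close> makes every past index enter the window
    eventually.\<close>
  have "\<exists>n. \<forall>k. (n k \<ge> k \<and> (\<forall>N\<ge>n k. d (n k) - d N \<le> (1/4) ^ k)) \<and> n k \<le> n (Suc k)"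
    using ex by (intro dependent_nat_choice) (blast, metis)
  then obtain n where n: "\<And>k. n k \<ge> k" "\<And>k N. N \<ge> n k \<Longrightarrow> d (n k) - d N \<le> (1/4) ^ k" "\<And>k. n k \<le> n (Suc k)"
    by blast
  define q where "q k \<omega> = - lin (I (n k)) (W (n k)) \<omega>" for k \<omega>
  have q_eq: "lin (T (n k)) (W (n k)) \<omega> = X j \<omega> - q k \<omega>" for k \<omega>
    using fin(2) jI(1) W(1)[of j] by (simp add: q_def lin_def T_def)
  have qF: "q k \<in> borel_measurable (generated_field M X {..m})" for k
    unfolding q_def[abs_def] lin_def[abs_def]
    by (intro borel_measurable_uminus borel_measurable_sum borel_measurable_times borel_measurable_const
        measurable_generated_field) (auto simp: I_def)
  have sub: "subalgebra M (generated_field M X {..m})" by (rule subalgebra_generated_field) simp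
  have [measurable]: "q k \<in> borel_measurable M" for k by (rule measurable_from_subalg[OF sub qF])
  \<comment> \<open>\<open>lim\<close> is taken at every point, so \<open>g\<close> is measurable
    for the past field itself, without completion, although convergence is only almost sure.\<close>
  define g where "g \<omega> = lim (\<lambda>k. q k \<omega>)" for \<omega>
  have gF: "g \<in> borel_measurable (generated_field M X {..m})"
    unfolding g_def[abs_def] using qF by (rule borel_measurable_lim_metric)
  have "AE \<omega> in M. convergent (\<lambda>k. q k \<omega>)"
  proof (rule AE_convergent_of_summable_increments)
    fix k
    let ?v = "\<lambda>i. W (n k) i - W (n (Suc k)) i" and ?T = "T (n (Suc k))"
    have "q (Suc k) \<omega> - q k \<omega> = lin ?T ?v \<omega>" for \<omega>
    proof -
      have "lin (T (n k)) (W (n k)) \<omega> = lin ?T (W (n k)) \<omega>"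
        using fin I_mono n W0 by (intro lin_mono_neutral[symmetric]) auto
      then show ?thesis using q_eq[of k \<omega>] q_eq[of "Suc k" \<omega>] by (simp add: lin_diff[symmetric])
    qed
    moreover have "bil \<sigma> ?T ?v ?v \<le> ((1/2) ^ k)\<^sup>2"
      using n(2)[OF n(3)[of k]] pyth[OF n(3)[of k]] by (simp add: power_mult[symmetric] power2_eq_square power_mult_distrib[symmetric])
    ultimately show "(\<integral>\<^sup>+\<omega>. ennreal \<bar>q (Suc k) \<omega> - q k \<omega>\<bar> \<partial>M) \<le> ennreal ((1/2) ^ k)"
      using fin(1) by (simp add: nn_integral_abs_lin_le)
  qed simp
  then have lim: "AE \<omega> in M. (\<lambda>k. lin (T (n k)) (W (n k)) \<omega>) \<longlonglongrightarrow> X j \<omega> - g \<omega>"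
    unfolding q_eq g_def by eventually_elim (intro tendsto_intros, simp add: convergent_LIMSEQ_iff)
  have "past_residual m (\<lambda>\<omega>. X j \<omega> - g \<omega>) (\<lambda>k. T (n k)) (\<lambda>k. W (n k))"
    unfolding past_residual_def
  proof (intro conjI allI impI)
    fix l assume l: "l \<le> m"
    have "pairing \<sigma> (T (n k)) (W (n k)) l = 0" if "k \<ge> nat (m - l)" for k
      using that n(1)[of k] l by (intro W(2)) (auto simp: I_def)
    then show "\<forall>\<^sub>F k in sequentially. pairing \<sigma> (T (n k)) (W (n k)) l = 0"
      unfolding eventually_sequentially by blast
  qed (use fin W0 lim in auto)
  then show ?thesis using gF by blast
qed

text \<open>Uncorrelated becomes independent: \<open>Z\<close> is the process before
  \<open>m\<close> and its residual after \<open>m\<close>. Its characteristic functionals factor at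
  \<open>m\<close>, so \<open>Z\<close> has the law of its decoupled copy, whose two halves are
  independent by construction.\<close>

lemma exists_future_residual:
  assumes F: "F \<subseteq> {m<..}"
  shows "\<exists>g. (\<forall>j>m. g j \<in> borel_measurable (generated_field M X {..m})) \<and>
    (\<forall>A\<in>sets (generated_field M X {..m}). \<forall>C\<in>sets (\<Pi>\<^sub>M j\<in>F. borel).
      measure M (A \<inter> ((\<lambda>\<omega>. \<lambda>j\<in>F. X j \<omega> - g j \<omega>) -` C \<inter> space M)) =
      measure M A * measure M ((\<lambda>\<omega>. \<lambda>j\<in>F. X j \<omega> - g j \<omega>) -` C \<inter> space M))"
proof -
  let ?F = "generated_field M X {..m}"
  have sub: "subalgebra M ?F" by (rule subalgebra_generated_field) simp
  have "\<forall>j\<in>{m<..}. \<exists>g T w. g \<in> borel_measurable ?F \<and> past_residual m (\<lambda>\<omega>. X j \<omega> - g \<omega>) T w"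
    using exists_past_residual by blast
  then obtain g T w where g: "\<And>j. m < j \<Longrightarrow> g j \<in> borel_measurable ?F"
    and res: "\<And>j. m < j \<Longrightarrow> past_residual m (\<lambda>\<omega>. X j \<omega> - g j \<omega>) (T j) (w j)"
    by (metis greaterThan_iff)
  define Z where "Z k \<omega> = (if k \<le> m then X k \<omega> else X k \<omega> - g k \<omega>)" for k \<omega>
  have Z[measurable]: "Z k \<in> borel_measurable M" for k
  proof (cases "k \<le> m")
    case False
    then have [measurable]: "g k \<in> borel_measurable M" using measurable_from_subalg[OF sub g] by simp
    show ?thesis using False by (simp add: Z_def[abs_def])
  qed (simp add: Z_def[abs_def])
  have char: "(CLINT \<omega>|M. iexp (\<Sum>k\<in>S. a k * Z k \<omega>)) = (CLINT \<omega>|M \<Otimes>\<^sub>M M. iexp (\<Sum>k\<in>S. a k * decouple m Z k \<omega>))"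
    if S: "finite S" for S a
  proof -
    let ?I = "{i\<in>S. i \<le> m}" and ?J = "{i\<in>S. \<not> i \<le> m}"
    have I: "(\<Sum>k\<in>?I. a k * Z k \<omega>) = lin ?I a \<omega>" for \<omega> by (simp add: lin_def Z_def)
    have split: "(\<Sum>k\<in>S. a k * Z k \<omega>) = lin ?I a \<omega> + (\<Sum>k\<in>?J. a k * Z k \<omega>)" for \<omega>
    proof -
      have "S = ?I \<union> ?J" by auto
      then have "(\<Sum>k\<in>S. a k * Z k \<omega>) = (\<Sum>k\<in>?I \<union> ?J. a k * Z k \<omega>)" by simp
      also have "\<dots> = (\<Sum>k\<in>?I. a k * Z k \<omega>) + (\<Sum>k\<in>?J. a k * Z k \<omega>)"
        using S by (intro sum.union_disjoint) auto
      finally show ?thesis by (simp add: I)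
    qed
    have dc: "(CLINT \<omega>|M \<Otimes>\<^sub>M M. iexp (\<Sum>k\<in>S. a k * decouple m Z k \<omega>)) =
        (CLINT \<omega>|M. iexp (\<Sum>k\<in>?I. a k * Z k \<omega>)) * (CLINT \<omega>|M. iexp (\<Sum>k\<in>?J. a k * Z k \<omega>))"
      by (rule decouple_char[OF S]) (rule Z)
    have "(CLINT \<omega>|M. iexp (lin ?I a \<omega> + (\<Sum>k\<in>?J. a k * Z k \<omega>))) =
        (CLINT \<omega>|M. iexp (lin ?I a \<omega>)) * (CLINT \<omega>|M. iexp (\<Sum>k\<in>?J. a k * Z k \<omega>))"
    proof (rule past_residual_char)
      fix k assume "k \<in> ?J"
      then show "past_residual m (Z k) (T k) (w k)" using res[of k] by (simp add: Z_def[abs_def])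
    qed (use S in auto)
    then show ?thesis unfolding split dc I .
  qed
  \<comment> \<open>The past is infinite and \<open>F\<close> may be; cylinder sets reduce an
    arbitrary index set to finite ones.\<close>
  have law: "distr M (\<Pi>\<^sub>M k\<in>S. borel) (\<lambda>\<omega>. \<lambda>k\<in>S. Z k \<omega>) =
      distr (M \<Otimes>\<^sub>M M) (\<Pi>\<^sub>M k\<in>S. borel) (\<lambda>\<omega>. \<lambda>k\<in>S. decouple m Z k \<omega>)" for S
  proof (rule measure_eqI_PiM_infinite)
    interpret Z: prob_space "distr M (\<Pi>\<^sub>M k\<in>S. borel) (\<lambda>\<omega>. \<lambda>k\<in>S. Z k \<omega>)"
      by (rule prob_space_distr) (auto intro!: measurable_restrict)
    show "finite_measure (distr M (\<Pi>\<^sub>M k\<in>S. borel) (\<lambda>\<omega>. \<lambda>k\<in>S. Z k \<omega>))" by unfold_locales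
    fix A :: "int \<Rightarrow> real set" and J assume J: "finite J" "J \<subseteq> S" and A: "\<And>i. i \<in> J \<Longrightarrow> A i \<in> sets borel"
    have "distr M (\<Pi>\<^sub>M k\<in>J. borel) (\<lambda>\<omega>. \<lambda>k\<in>J. Z k \<omega>) =
      distr (M \<Otimes>\<^sub>M M) (\<Pi>\<^sub>M k\<in>J. borel) (\<lambda>\<omega>. \<lambda>k\<in>J. decouple m Z k \<omega>)"
      by (rule char_functional_uniqueness[OF prob_space_axioms prob_space_pair J(1)])
        (use char[OF J(1)] in auto)
    then have "emeasure (distr M (\<Pi>\<^sub>M k\<in>J. borel) (\<lambda>\<omega>. \<lambda>k\<in>J. Z k \<omega>)) (Pi\<^sub>E J A) =
      emeasure (distr (M \<Otimes>\<^sub>M M) (\<Pi>\<^sub>M k\<in>J. borel) (\<lambda>\<omega>. \<lambda>k\<in>J. decouple m Z k \<omega>)) (Pi\<^sub>E J A)" by simp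
    moreover have emb: "emeasure (distr L (\<Pi>\<^sub>M k\<in>S. borel) (\<lambda>\<omega>. \<lambda>k\<in>S. Y k \<omega>)) (prod_emb S (\<lambda>_. borel) J (Pi\<^sub>E J A)) =
      emeasure (distr L (\<Pi>\<^sub>M k\<in>J. borel) (\<lambda>\<omega>. \<lambda>k\<in>J. Y k \<omega>)) (Pi\<^sub>E J A)"
      if "\<And>k. Y k \<in> borel_measurable L" for L and Y :: "int \<Rightarrow> 'x \<Rightarrow> real"
    proof -
      have "(\<lambda>\<omega>. \<lambda>k\<in>S. Y k \<omega>) -` prod_emb S (\<lambda>_. borel) J (Pi\<^sub>E J A) = (\<lambda>\<omega>. \<lambda>k\<in>J. Y k \<omega>) -` Pi\<^sub>E J A"
        using J by (auto simp: prod_emb_def PiE_iff Int_absorb1 restrict_def extensional_def subset_eq split: if_splits)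
      moreover have "(\<lambda>\<omega>. \<lambda>k\<in>S'. Y k \<omega>) \<in> measurable L (\<Pi>\<^sub>M k\<in>S'. borel)" for S'
        using that by (intro measurable_restrict)
      moreover have "prod_emb S (\<lambda>_. borel) J (Pi\<^sub>E J A) \<in> sets (\<Pi>\<^sub>M k\<in>S. borel)"
        using J A by (intro sets_PiM_I) auto
      moreover have "Pi\<^sub>E J A \<in> sets (\<Pi>\<^sub>M k\<in>J. borel)"
        using J A by (intro sets_PiM_I_finite) auto
      ultimately show ?thesis by (simp add: emeasure_distr)
    qed
    ultimately show "emeasure (distr M (\<Pi>\<^sub>M k\<in>S. borel) (\<lambda>\<omega>. \<lambda>k\<in>S. Z k \<omega>)) (prod_emb S (\<lambda>_. borel) J (Pi\<^sub>E J A)) =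
      emeasure (distr (M \<Otimes>\<^sub>M M) (\<Pi>\<^sub>M k\<in>S. borel) (\<lambda>\<omega>. \<lambda>k\<in>S. decouple m Z k \<omega>)) (prod_emb S (\<lambda>_. borel) J (Pi\<^sub>E J A))"
      using emb[of Z M] emb[of "decouple m Z" "M \<Otimes>\<^sub>M M"] by (simp add: Z decouple_measurable)
  qed auto
  have "measure M (A \<inter> ((\<lambda>\<omega>. \<lambda>j\<in>F. X j \<omega> - g j \<omega>) -` C \<inter> space M)) =
      measure M A * measure M ((\<lambda>\<omega>. \<lambda>j\<in>F. X j \<omega> - g j \<omega>) -` C \<inter> space M)"
    if A: "A \<in> sets ?F" and C: "C \<in> sets (\<Pi>\<^sub>M j\<in>F. borel)" for A C
  proof -
    interpret MM: pair_prob_space M M ..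
    obtain B where B: "B \<in> sets (\<Pi>\<^sub>M j\<in>{..m}. borel)" and A_eq: "A = (\<lambda>\<omega>. \<lambda>j\<in>{..m}. X j \<omega>) -` B \<inter> space M"
      using generated_field_obtain[OF A] .
    have AM: "A \<in> sets M" using A sub by (auto simp: subalgebra_def)
    let ?S = "{..m} \<union> F"
    let ?D = "{z \<in> space (\<Pi>\<^sub>M k\<in>?S. borel). restrict z {..m} \<in> B \<and> restrict z F \<in> C}"
    let ?R = "(\<lambda>\<omega>. \<lambda>j\<in>F. X j \<omega> - g j \<omega>) -` C \<inter> space M"
    have D: "?D \<in> sets (\<Pi>\<^sub>M k\<in>?S. borel)"
    proof -
      have [measurable]: "(\<lambda>z. restrict z {..m}) \<in> measurable (\<Pi>\<^sub>M k\<in>?S. borel) (\<Pi>\<^sub>M j\<in>{..m}. (borel :: real measure))"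
        "(\<lambda>z. restrict z F) \<in> measurable (\<Pi>\<^sub>M k\<in>?S. borel) (\<Pi>\<^sub>M j\<in>F. (borel :: real measure))"
        by (auto intro!: measurable_restrict_subset)
      show ?thesis using B C by measurable
    qed
    have FZ: "Z j \<omega> = X j \<omega> - g j \<omega>" if "j \<in> F" for j \<omega> using F that by (auto simp: Z_def)
    have ZF: "(\<lambda>j\<in>F. X j \<omega> - g j \<omega>) = (\<lambda>j\<in>F. Z j \<omega>)" for \<omega> using FZ by (auto simp: restrict_def)
    have RM: "?R \<in> sets M" unfolding ZF by (rule measurable_sets[OF _ C]) (auto intro!: measurable_restrict)
    have pre1: "(\<lambda>\<omega>. \<lambda>k\<in>?S. Z k \<omega>) -` ?D \<inter> space M = A \<inter> ?R"
    proof -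
      have "restrict (\<lambda>k\<in>?S. Z k \<omega>) {..m} = (\<lambda>j\<in>{..m}. X j \<omega>)" for \<omega>
        by (auto simp: restrict_def Z_def)
      moreover have "restrict (\<lambda>k\<in>?S. Z k \<omega>) F = (\<lambda>j\<in>F. X j \<omega> - g j \<omega>)" for \<omega>
        unfolding ZF by (auto simp: restrict_def)
      ultimately show ?thesis by (auto simp: A_eq space_PiM)
    qed
    have pre2: "(\<lambda>\<omega>. \<lambda>k\<in>?S. decouple m Z k \<omega>) -` ?D \<inter> space (M \<Otimes>\<^sub>M M) = A \<times> ?R"
    proof -
      have "restrict (\<lambda>k\<in>?S. decouple m Z k \<omega>) {..m} = (\<lambda>j\<in>{..m}. X j (fst \<omega>))" for \<omega>
        by (auto simp: restrict_def Z_def decouple_def)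
      moreover have "restrict (\<lambda>k\<in>?S. decouple m Z k \<omega>) F = (\<lambda>j\<in>F. X j (snd \<omega>) - g j (snd \<omega>))" for \<omega>
        unfolding ZF
      proof
        fix k
        show "restrict (\<lambda>k\<in>?S. decouple m Z k \<omega>) F k = (\<lambda>j\<in>F. Z j (snd \<omega>)) k"
          using F by (cases "k \<in> F") (auto simp: decouple_def)
      qed
      ultimately show ?thesis by (auto simp: A_eq space_PiM space_pair_measure)
    qed
    \<comment> \<open>One event of sequences has preimage \<open>A \<inter> ?R\<close> under
      \<open>Z\<close> and \<open>A \<times> ?R\<close> under the decoupled copy.\<close>
    have "measure M (A \<inter> ?R) = measure (M \<Otimes>\<^sub>M M) (A \<times> ?R)"
    proof -
      have "(\<lambda>\<omega>. \<lambda>k\<in>?S. Z k \<omega>) \<in> measurable M (\<Pi>\<^sub>M k\<in>?S. borel)"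
        "(\<lambda>\<omega>. \<lambda>k\<in>?S. decouple m Z k \<omega>) \<in> measurable (M \<Otimes>\<^sub>M M) (\<Pi>\<^sub>M k\<in>?S. borel)"
        by (auto intro!: measurable_restrict decouple_measurable)
      from this[THEN measure_distr, OF D] show ?thesis using law[of ?S] by (simp only: pre1 pre2)
    qed
    also have "\<dots> = measure M A * measure M ?R"
      unfolding measure_def by (simp add: emeasure_pair_measure_Times AM RM enn2real_mult)
    finally show ?thesis .
  qed
  then show ?thesis using g by (intro exI[of _ g]) auto
qed

end

lemma prob_algebra_memberD:
  assumes "K \<in> F \<rightarrow>\<^sub>M prob_algebra N" "\<omega> \<in> space F"
  shows "prob_space (K \<omega>)" "sets (K \<omega>) = sets N" "space (K \<omega>) = space N"
  using measurable_space[OF assms] by (auto simp: space_prob_algebra dest: sets_eq_imp_space_eq)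

context coercive_gaussian
begin

text \<open>The future equals \<open>h \<omega> (R \<omega>)\<close>, where
  \<open>h \<omega>\<close> translates by past-measurable functions and \<open>R\<close> is
  independent of the past; so the law of \<open>R\<close>, translated by \<open>h \<omega>\<close>,
  is a conditional law. Existence matters because \<open>future_cond_law\<close> is defined by
  choice and would otherwise carry no information.\<close>

theorem exists_regular_cond_law:
  assumes J: "J \<subseteq> {m<..}"
  shows "\<exists>K. is_regular_cond_law M (generated_field M X {..m}) (\<Pi>\<^sub>M j\<in>J. borel) (\<lambda>\<omega>. \<lambda>j\<in>J. X j \<omega>) K"
proof -
  let ?F = "generated_field M X {..m}" and ?N = "\<Pi>\<^sub>M j\<in>J. (borel :: real measure)"
  let ?Y = "\<lambda>\<omega>. \<lambda>j\<in>J. X j \<omega>"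
  have sub: "subalgebra M ?F" by (rule subalgebra_generated_field) simp
  obtain g where g': "\<forall>j>m. g j \<in> borel_measurable ?F" and
    indep: "\<forall>A\<in>sets ?F. \<forall>C\<in>sets ?N. measure M (A \<inter> ((\<lambda>\<omega>. \<lambda>j\<in>J. X j \<omega> - g j \<omega>) -` C \<inter> space M)) =
      measure M A * measure M ((\<lambda>\<omega>. \<lambda>j\<in>J. X j \<omega> - g j \<omega>) -` C \<inter> space M)"
    using exists_future_residual[OF J] by (elim exE conjE)
  have g: "g j \<in> borel_measurable ?F" if "m < j" for j using g' that by blast
  define R where "R \<omega> = (\<lambda>j\<in>J. X j \<omega> - g j \<omega>)" for \<omega>
  define h where "h \<omega> r = (\<lambda>j\<in>J. g j \<omega> + r j)" for \<omega> and r :: "int \<Rightarrow> real"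
  have gJ: "g j \<in> borel_measurable ?F" "g j \<in> borel_measurable M" if "j \<in> J" for j
    using g[of j] measurable_from_subalg[OF sub g[of j]] J that by auto
  have R[measurable]: "R \<in> measurable M ?N"
    unfolding R_def[abs_def] by (intro measurable_restrict borel_measurable_diff gJ) auto
  have Y[measurable]: "?Y \<in> measurable M ?N" by (intro measurable_restrict) auto
  have h: "(\<lambda>(\<omega>, r). h \<omega> r) \<in> measurable (?F \<Otimes>\<^sub>M ?N) ?N"
    unfolding h_def[abs_def] case_prod_beta
  proof (rule measurable_restrict)
    fix j assume j: "j \<in> J"
    have "(\<lambda>p. g j (fst p)) \<in> borel_measurable (?F \<Otimes>\<^sub>M ?N)" using gJ(1)[OF j] by measurable
    moreover have "(\<lambda>p. snd p j) \<in> borel_measurable (?F \<Otimes>\<^sub>M ?N)" using j by measurable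
    ultimately show "(\<lambda>p. g j (fst p) + snd p j) \<in> borel_measurable (?F \<Otimes>\<^sub>M ?N)" by simp
  qed
  have hY: "h \<omega> (R \<omega>) = ?Y \<omega>" for \<omega> by (auto simp: h_def R_def)
  define \<rho> where "\<rho> = distr M ?N R"
  interpret \<rho>: prob_space \<rho> unfolding \<rho>_def by (rule prob_space_distr[OF R])
  have sets_\<rho>[measurable_cong]: "sets \<rho> = sets ?N" by (simp add: \<rho>_def)
  have space_\<rho>: "space \<rho> = space ?N" by (simp add: \<rho>_def)
  define K where "K \<omega> = distr \<rho> ?N (h \<omega>)" for \<omega>
  have K: "K \<in> ?F \<rightarrow>\<^sub>M prob_algebra ?N"
    unfolding K_def[abs_def]
  proof (rule measurable_distr_prob_space2[OF _ h])
    show "(\<lambda>x. \<rho>) \<in> ?F \<rightarrow>\<^sub>M prob_algebra ?N"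
      by (intro measurable_const) (auto simp: space_prob_algebra sets_\<rho> \<rho>.prob_space_axioms)
  qed
  let ?MF = "restr_to_subalg M ?F"
  interpret MF: prob_space ?MF by (rule prob_space_restr_to_subalg[OF sub prob_space_axioms])
  have id[measurable]: "(\<lambda>\<omega>. \<omega>) \<in> measurable M ?F"
    using sub by (intro measurableI) (auto simp: subalgebra_def)
  have pair[measurable]: "(\<lambda>\<omega>. (\<omega>, R \<omega>)) \<in> measurable M (?F \<Otimes>\<^sub>M ?N)" by measurable
  \<comment> \<open>Independence restated as a product law on sample space times sequence space, so
    that sections can be integrated.\<close>
  have joint: "?MF \<Otimes>\<^sub>M \<rho> = distr M (?F \<Otimes>\<^sub>M ?N) (\<lambda>\<omega>. (\<omega>, R \<omega>))"
  proof (rule pair_measure_eqI)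
    show "sigma_finite_measure ?MF" "sigma_finite_measure \<rho>" by unfold_locales
    show "sets (?MF \<Otimes>\<^sub>M \<rho>) = sets (distr M (?F \<Otimes>\<^sub>M ?N) (\<lambda>\<omega>. (\<omega>, R \<omega>)))"
      by (simp add: sets_restr_to_subalg[OF sub] sets_\<rho> cong: sets_pair_measure_cong)
    fix A C assume "A \<in> sets ?MF" "C \<in> sets \<rho>"
    then have A: "A \<in> sets ?F" and C: "C \<in> sets ?N" by (auto simp: sets_restr_to_subalg[OF sub] sets_\<rho>)
    have "A \<subseteq> space M" using sets.sets_into_space[OF A] by simp
    then have pre: "(\<lambda>\<omega>. (\<omega>, R \<omega>)) -` (A \<times> C) \<inter> space M = A \<inter> (R -` C \<inter> space M)" by auto
    have "emeasure (distr M (?F \<Otimes>\<^sub>M ?N) (\<lambda>\<omega>. (\<omega>, R \<omega>))) (A \<times> C) = emeasure M (A \<inter> (R -` C \<inter> space M))"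
      using A C by (subst emeasure_distr) (auto simp: pre)
    also have "\<dots> = ennreal (measure M A * measure M (R -` C \<inter> space M))"
      using indep[rule_format, OF A C] unfolding emeasure_eq_measure R_def[abs_def] by simp
    also have "\<dots> = emeasure M A * emeasure M (R -` C \<inter> space M)"
      unfolding emeasure_eq_measure by (simp add: ennreal_mult)
    also have "\<dots> = emeasure ?MF A * emeasure \<rho> C"
      using A C by (simp add: emeasure_restr_to_subalg[OF sub] \<rho>_def emeasure_distr)
    finally show "emeasure ?MF A * emeasure \<rho> C = emeasure (distr M (?F \<Otimes>\<^sub>M ?N) (\<lambda>\<omega>. (\<omega>, R \<omega>))) (A \<times> C)" by simp
  qed
  interpret fs: finite_measure_subalgebra M ?F by unfold_locales (rule sub)
  have ce: "AE \<omega> in M. real_cond_exp M ?F (indicator (?Y -` C \<inter> space M)) \<omega> = measure (K \<omega>) C"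
    if C: "C \<in> sets ?N" for C
  proof (rule fs.real_cond_exp_charact)
    have YC: "?Y -` C \<inter> space M \<in> sets M" using measurable_sets[OF Y C] .
    have Km: "(\<lambda>\<omega>. measure (K \<omega>) C) \<in> borel_measurable ?F"
      using K C by measurable
    have KmM: "(\<lambda>\<omega>. measure (K \<omega>) C) \<in> borel_measurable M" by (rule measurable_from_subalg[OF sub Km])
    have KP: "prob_space (K \<omega>)" if "\<omega> \<in> space M" for \<omega>
      using prob_algebra_memberD[OF K] that by simp
    show "(\<lambda>\<omega>. measure (K \<omega>) C) \<in> borel_measurable ?F" by (rule Km)
    show intK: "integrable M (\<lambda>\<omega>. measure (K \<omega>) C)"
      using KmM KP by (intro integrable_const_bound[of _ 1]) (auto simp: prob_space.prob_le_1)
    show "integrable M (indicator (?Y -` C \<inter> space M) :: 'a \<Rightarrow> real)"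
      using YC by (intro integrable_const_bound[of _ 1]) auto
    fix A assume A: "A \<in> sets ?F"
    then have AM: "A \<in> sets M" using sub by (auto simp: subalgebra_def)
    \<comment> \<open>Its section at a point of \<open>A\<close> is the preimage of \<open>C\<close>
      under the translation; pulled back along \<open>(\<omega>, R \<omega>)\<close> it is the event
      \<open>A\<close> together with the future in \<open>C\<close>.\<close>
    let ?E = "(A \<times> space ?N) \<inter> ((\<lambda>(\<omega>, r). h \<omega> r) -` C \<inter> space (?F \<Otimes>\<^sub>M ?N))"
    have E: "?E \<in> sets (?F \<Otimes>\<^sub>M ?N)" using A measurable_sets[OF h C] by auto
    have preE: "(\<lambda>\<omega>. (\<omega>, R \<omega>)) -` ?E \<inter> space M = A \<inter> (?Y -` C \<inter> space M)"
      using measurable_space[OF R] by (auto simp: hY space_pair_measure)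
    have sec: "emeasure \<rho> (Pair \<omega> -` ?E) = indicator A \<omega> * ennreal (measure (K \<omega>) C)" if \<omega>: "\<omega> \<in> space M" for \<omega>
    proof -
      interpret KP: prob_space "K \<omega>" by (rule KP[OF \<omega>])
      have "h \<omega> \<in> measurable ?N ?N"
        using measurable_Pair2[OF h, of \<omega>] \<omega> by simp
      then have hm: "h \<omega> \<in> measurable \<rho> ?N" by (subst measurable_cong_sets[OF sets_\<rho> refl])
      have "ennreal (measure (K \<omega>) C) = emeasure (K \<omega>) C" by (simp add: KP.emeasure_eq_measure)
      also have "\<dots> = emeasure \<rho> (h \<omega> -` C \<inter> space ?N)"
        unfolding K_def using hm C by (simp add: emeasure_distr space_\<rho>)
      finally have *: "emeasure \<rho> (h \<omega> -` C \<inter> space ?N) = ennreal (measure (K \<omega>) C)" by simp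
      show ?thesis
      proof (cases "\<omega> \<in> A")
        case True
        have "r \<in> Pair \<omega> -` ?E \<longleftrightarrow> r \<in> h \<omega> -` C \<inter> space ?N" for r
          unfolding vimage_eq Int_iff space_pair_measure mem_Times_iff case_prod_conv fst_conv snd_conv
          using True \<omega> space_generated_field[of M X "{..m}"] by blast
        then have "Pair \<omega> -` ?E = h \<omega> -` C \<inter> space ?N" by (rule set_eqI)
        then have "emeasure \<rho> (Pair \<omega> -` ?E) = ennreal (measure (K \<omega>) C)" by (simp only: *)
        moreover have "indicator A \<omega> = (1 :: ennreal)" using True by simp
        ultimately show ?thesis by (simp only: mult_1_left)
      next
        case False
        then have "Pair \<omega> -` ?E = {}" by blast
        moreover have "indicator A \<omega> = (0 :: ennreal)" using False by simp
        ultimately show ?thesis by (simp only: mult_zero_left emeasure_empty)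
      qed
    qed
    have "ennreal (measure M (A \<inter> (?Y -` C \<inter> space M))) = emeasure (distr M (?F \<Otimes>\<^sub>M ?N) (\<lambda>\<omega>. (\<omega>, R \<omega>))) ?E"
      by (simp only: emeasure_distr[OF pair E] preE emeasure_eq_measure)
    also have "\<dots> = (\<integral>\<^sup>+\<omega>. emeasure \<rho> (Pair \<omega> -` ?E) \<partial>?MF)"
      unfolding joint[symmetric]
    proof (rule \<rho>.emeasure_pair_measure_alt)
      show "?E \<in> sets (?MF \<Otimes>\<^sub>M \<rho>)"
        using E by (simp add: sets_restr_to_subalg[OF sub] sets_\<rho> cong: sets_pair_measure_cong)
    qed
    also have "\<dots> = (\<integral>\<^sup>+\<omega>. indicator A \<omega> * ennreal (measure (K \<omega>) C) \<partial>?MF)"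
      using sec by (intro nn_integral_cong) (simp add: space_restr_to_subalg)
    also have "\<dots> = (\<integral>\<^sup>+\<omega>. indicator A \<omega> * ennreal (measure (K \<omega>) C) \<partial>M)"
      by (rule nn_integral_subalgebra2[OF sub]) (use A Km in measurable)
    also have "\<dots> = (\<integral>\<^sup>+\<omega>. ennreal (indicator A \<omega> * measure (K \<omega>) C) \<partial>M)"
      by (intro nn_integral_cong) (auto simp: indicator_def)
    also have "\<dots> = ennreal (LINT \<omega>|M. indicator A \<omega> * measure (K \<omega>) C)"
      using integrable_mult_indicator[OF AM intK] by (intro nn_integral_eq_integral) auto
    finally have "measure M (A \<inter> (?Y -` C \<inter> space M)) = (LINT \<omega>|M. indicator A \<omega> * measure (K \<omega>) C)"
      by (subst (asm) ennreal_inj) (auto intro!: integral_nonneg_AE)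
    moreover have "(LINT \<omega>:A|M. indicator (?Y -` C \<inter> space M) \<omega>) = measure M (A \<inter> (?Y -` C \<inter> space M))"
    proof -
      have "(LINT \<omega>:A|M. indicator (?Y -` C \<inter> space M) \<omega>) = (LINT \<omega>|M. indicator (A \<inter> (?Y -` C \<inter> space M)) \<omega>)"
        unfolding set_lebesgue_integral_def by (intro Bochner_Integration.integral_cong) (auto simp: indicator_def)
      also have "\<dots> = measure M (A \<inter> (?Y -` C \<inter> space M))" using AM YC by simp
      finally show ?thesis .
    qed
    ultimately show "(LINT \<omega>:A|M. indicator (?Y -` C \<inter> space M) \<omega>) = (LINT \<omega>:A|M. measure (K \<omega>) C)"
      by (simp add: set_lebesgue_integral_def)
  qed
  show ?thesis
    unfolding is_regular_cond_law_def
  proof (intro exI[of _ K] conjI ballI K)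
    fix C assume "C \<in> sets ?N"
    from ce[OF this] show "AE \<omega> in M. measure (K \<omega>) C = real_cond_exp M ?F (indicator (?Y -` C \<inter> space M)) \<omega>"
      by eventually_elim simp
  qed
qed

end

section \<open>Total variation\<close>

text \<open>Threshold formulas \<open>x\<^sub>j \<le> q\<close> and their Boolean combinations: a countable algebra of events that
  depend on finitely many coordinates. Atoms with index outside \<open>J\<close> are read as false.\<close>

datatype event_formula = Atom int rat | Neg event_formula | Disj event_formula event_formula

instance event_formula :: countable
  by countable_datatype

fun holds :: "int set \<Rightarrow> (int \<Rightarrow> real) \<Rightarrow> event_formula \<Rightarrow> bool" where
  "holds J x (Atom j q) \<longleftrightarrow> j \<in> J \<and> x j \<le> of_rat q"
| "holds J x (Neg \<phi>) \<longleftrightarrow> \<not> holds J x \<phi>"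
| "holds J x (Disj \<phi> \<psi>) \<longleftrightarrow> holds J x \<phi> \<or> holds J x \<psi>"

fun indices :: "event_formula \<Rightarrow> int set" where
  "indices (Atom j q) = {j}"
| "indices (Neg \<phi>) = indices \<phi>"
| "indices (Disj \<phi> \<psi>) = indices \<phi> \<union> indices \<psi>"

lemma finite_indices: "finite (indices \<phi>)"
  by (induction \<phi>) auto

text \<open>Allows an infinite index set to be replaced by the finitely many of its indices that
  occur in the formula.\<close>

lemma holds_cong: "(\<And>j. j \<in> J \<inter> indices \<phi> \<Longrightarrow> x j = y j) \<Longrightarrow> J \<inter> indices \<phi> \<subseteq> J' \<Longrightarrow> J' \<subseteq> J \<Longrightarrow>
    holds J x \<phi> = holds J' y \<phi>"
proof (induction \<phi>)
  case (Disj \<phi> \<psi>)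
  have "holds J x \<phi> = holds J' y \<phi>" by (rule Disj.IH(1)) (use Disj.prems in auto)
  moreover have "holds J x \<psi> = holds J' y \<psi>" by (rule Disj.IH(2)) (use Disj.prems in auto)
  ultimately show ?case by simp
qed auto

lemma holds_measurable:
  assumes "\<And>j. j \<in> J \<Longrightarrow> (\<lambda>x. Z x j) \<in> borel_measurable N"
  shows "{x \<in> space N. holds J (Z x) \<phi>} \<in> sets N"
proof (induction \<phi>)
  case (Atom j q)
  show ?case
  proof (cases "j \<in> J")
    case True
    then have [measurable]: "(\<lambda>x. Z x j) \<in> borel_measurable N" by (rule assms)
    show ?thesis using True by simp
  qed simp
next
  case (Neg \<phi>)
  have "{x \<in> space N. holds J (Z x) (Neg \<phi>)} = space N - {x \<in> space N. holds J (Z x) \<phi>}" by auto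
  then show ?case using Neg by simp
next
  case (Disj \<phi> \<psi>)
  have "{x \<in> space N. holds J (Z x) (Disj \<phi> \<psi>)} =
    {x \<in> space N. holds J (Z x) \<phi>} \<union> {x \<in> space N. holds J (Z x) \<psi>}" by auto
  then show ?case using Disj by simp
qed

lemma (in finite_measure) measure_diff_le_symdiff:
  assumes "A \<in> sets M" "B \<in> sets M"
  shows "\<bar>measure M A - measure M B\<bar> \<le> measure M ((A - B) \<union> (B - A))"
proof -
  have "measure M A \<le> measure M (B \<union> ((A - B) \<union> (B - A)))" using assms by (intro finite_measure_mono) auto
  also have "\<dots> \<le> measure M B + measure M ((A - B) \<union> (B - A))" using assms by (intro measure_Un_le) auto
  finally have 1: "measure M A \<le> measure M B + measure M ((A - B) \<union> (B - A))" .
  have "measure M B \<le> measure M (A \<union> ((A - B) \<union> (B - A)))" using assms by (intro finite_measure_mono) auto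
  also have "\<dots> \<le> measure M A + measure M ((A - B) \<union> (B - A))" using assms by (intro measure_Un_le) auto
  finally show ?thesis using 1 by linarith
qed

text \<open>The approximable events form a sigma-field. The error is measured by \<open>r\<close>,
  the sum of both measures, so that one formula serves \<open>P\<close> and \<open>Q\<close>
  together, as a comparison of the two laws requires.\<close>

lemma event_formula_approximation:
  fixes Z :: "'a \<Rightarrow> int \<Rightarrow> real"
  assumes P: "finite_measure P" and Q: "finite_measure Q" and sets: "sets Q = sets P"
    and Z: "\<And>j. j \<in> J \<Longrightarrow> (\<lambda>x. Z x j) \<in> borel_measurable P"
    and B: "B \<in> sigma_sets (space P) {{x \<in> space P. Z x j \<le> of_rat q} | j q. j \<in> J}"
    and "\<epsilon> > 0"
  shows "\<exists>\<phi>. \<bar>measure P B - measure P {x \<in> space P. holds J (Z x) \<phi>}\<bar> < \<epsilon> \<and>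
    \<bar>measure Q B - measure Q {x \<in> space P. holds J (Z x) \<phi>}\<bar> < \<epsilon>"
proof -
  interpret P: finite_measure P by fact
  interpret Q: finite_measure Q by fact
  define E where "E \<phi> = {x \<in> space P. holds J (Z x) \<phi>}" for \<phi>
  define S where "S A C = (A - C) \<union> (C - A)" for A C :: "'a set"
  define r where "r A = measure P A + measure Q A" for A
  have E: "E \<phi> \<in> sets P" for \<phi> unfolding E_def by (rule holds_measurable[OF Z])
  have SM: "S A (E \<phi>) \<in> sets P" if "A \<in> sets P" for A \<phi> using that E by (auto simp: S_def)
  have r_mono: "r A \<le> r C" if "A \<subseteq> C" "C \<in> sets P" for A C
    unfolding r_def using that sets by (intro add_mono P.finite_measure_mono Q.finite_measure_mono) auto
  have r_Un: "r (A \<union> C) \<le> r A + r C" if "A \<in> sets P" "C \<in> sets P" for A C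
    unfolding r_def using measure_Un_le[of A P C] measure_Un_le[of A Q C] that sets by auto
  define good where "good A \<longleftrightarrow> A \<in> sets P \<and> (\<forall>\<epsilon>>0. \<exists>\<phi>. r (S A (E \<phi>)) < \<epsilon>)" for A
  have empty: "good {}"
  proof -
    \<comment> \<open>A contradiction, false whether or not 0 belongs to \<open>J\<close>.\<close>
    have "E (Neg (Disj (Atom 0 0) (Neg (Atom 0 0)))) = {}" by (auto simp: E_def)
    then have "r (S {} (E (Neg (Disj (Atom 0 0) (Neg (Atom 0 0)))))) = 0" by (simp add: S_def r_def)
    then show ?thesis unfolding good_def by (metis sets.empty_sets)
  qed
  have union: "good (A \<union> C)" if A: "good A" and C: "good C" for A C
    unfolding good_def
  proof (intro conjI allI impI)
    have AC: "A \<in> sets P" "C \<in> sets P" using A C by (auto simp: good_def)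
    show "A \<union> C \<in> sets P" using AC by auto
    fix \<epsilon> :: real assume "\<epsilon> > 0"
    then have "\<epsilon> / 2 > 0" by simp
    obtain \<phi> where \<phi>: "r (S A (E \<phi>)) < \<epsilon> / 2" using A \<open>\<epsilon> / 2 > 0\<close> unfolding good_def by blast
    obtain \<psi> where \<psi>: "r (S C (E \<psi>)) < \<epsilon> / 2" using C \<open>\<epsilon> / 2 > 0\<close> unfolding good_def by blast
    have "r (S (A \<union> C) (E (Disj \<phi> \<psi>))) \<le> r (S A (E \<phi>) \<union> S C (E \<psi>))"
      using AC SM by (intro r_mono) (auto simp: S_def E_def)
    also have "\<dots> \<le> r (S A (E \<phi>)) + r (S C (E \<psi>))" using AC SM by (intro r_Un) auto
    finally show "\<exists>\<phi>. r (S (A \<union> C) (E \<phi>)) < \<epsilon>" using \<phi> \<psi> by (intro exI[of _ "Disj \<phi> \<psi>"]) linarith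
  qed
  have "good B"
    using B
  proof (induction rule: sigma_sets.induct)
    case (Basic A)
    then obtain j q where A: "A = {x \<in> space P. Z x j \<le> of_rat q}" "j \<in> J" by blast
    then have "A = E (Atom j q)" by (simp add: E_def)
    then have "r (S A (E (Atom j q))) = 0" "A \<in> sets P" using E by (simp_all add: S_def r_def)
    then show ?case unfolding good_def by metis
  next
    case Empty
    show ?case by (rule empty)
  next
    case (Compl A)
    show ?case
      unfolding good_def
    proof (intro conjI allI impI)
      show "space P - A \<in> sets P" using Compl by (auto simp: good_def)
      fix \<epsilon> :: real assume "\<epsilon> > 0"
      then obtain \<phi> where \<phi>: "r (S A (E \<phi>)) < \<epsilon>" using Compl unfolding good_def by blast
      have "S (space P - A) (E (Neg \<phi>)) \<subseteq> S A (E \<phi>)" by (auto simp: S_def E_def)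
      then have "r (S (space P - A) (E (Neg \<phi>))) \<le> r (S A (E \<phi>))"
        using Compl SM by (intro r_mono) (auto simp: good_def)
      then show "\<exists>\<phi>. r (S (space P - A) (E \<phi>)) < \<epsilon>" using \<phi> by (intro exI[of _ "Neg \<phi>"]) linarith
    qed
  next
    \<comment> \<open>Half of the error is spent on cutting the union after finitely many sets, half
      on approximating the finite union.\<close>
    case (Union A)
    have A: "A i \<in> sets P" for i using Union(2) by (auto simp: good_def)
    have part: "good (\<Union>i<n. A i)" for n :: nat
    proof (induction n)
      case 0 then show ?case using empty by simp
    next
      case (Suc n)
      then show ?case using union[OF Suc Union(2)[of n]] by (simp add: lessThan_Suc Un_commute)
    qed
    have inc: "incseq (\<lambda>n. \<Union>i<n. A i)" by (intro monoI UN_mono) auto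
    have UN: "(\<Union>n. \<Union>i<n. A i) = (\<Union>i. A i)" by blast
    have lim: "(\<lambda>n. r (\<Union>i<n. A i)) \<longlonglongrightarrow> r (\<Union>i. A i)"
      unfolding r_def using A inc sets UN[symmetric]
      by (auto intro!: tendsto_add P.finite_Lim_measure_incseq Q.finite_Lim_measure_incseq)
    show ?case
      unfolding good_def
    proof (intro conjI allI impI)
      show U: "(\<Union>i. A i) \<in> sets P" using A by auto
      fix \<epsilon> :: real assume "\<epsilon> > 0"
      then have "\<epsilon> / 2 > 0" by simp
      then have "\<forall>\<^sub>F n in sequentially. r (\<Union>i. A i) - \<epsilon> / 2 < r (\<Union>i<n. A i)"
        using order_tendstoD(1)[OF lim, of "r (\<Union>i. A i) - \<epsilon> / 2"] by simp
      then obtain n where n: "r (\<Union>i. A i) - \<epsilon> / 2 < r (\<Union>i<n. A i)"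
        unfolding eventually_sequentially by blast
      obtain \<phi> where \<phi>: "r (S (\<Union>i<n. A i) (E \<phi>)) < \<epsilon> / 2" using part[of n] \<open>\<epsilon> / 2 > 0\<close> unfolding good_def by blast
      have Un: "(\<Union>i<n. A i) \<in> sets P" using A by auto
      have rest: "r ((\<Union>i. A i) - (\<Union>i<n. A i)) = r (\<Union>i. A i) - r (\<Union>i<n. A i)"
        unfolding r_def using U Un sets
        by (subst P.finite_measure_Diff, auto)[1] (subst Q.finite_measure_Diff, auto)
      have "S (\<Union>i. A i) (E \<phi>) \<subseteq> ((\<Union>i. A i) - (\<Union>i<n. A i)) \<union> S (\<Union>i<n. A i) (E \<phi>)"
        by (auto simp: S_def)
      then have "r (S (\<Union>i. A i) (E \<phi>)) \<le> r (((\<Union>i. A i) - (\<Union>i<n. A i)) \<union> S (\<Union>i<n. A i) (E \<phi>))"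
        using U Un SM by (intro r_mono) auto
      also have "\<dots> \<le> r ((\<Union>i. A i) - (\<Union>i<n. A i)) + r (S (\<Union>i<n. A i) (E \<phi>))"
        using U Un SM by (intro r_Un) auto
      finally have "r (S (\<Union>i. A i) (E \<phi>)) < \<epsilon>" using rest n \<phi> by linarith
      then show "\<exists>\<phi>. r (S (\<Union>i. A i) (E \<phi>)) < \<epsilon>" by blast
    qed
  qed
  then obtain \<phi> where \<phi>: "r (S B (E \<phi>)) < \<epsilon>" and BM: "B \<in> sets P" using \<open>\<epsilon> > 0\<close> unfolding good_def by blast
  have "\<bar>measure P B - measure P (E \<phi>)\<bar> \<le> measure P (S B (E \<phi>))"
    unfolding S_def by (rule P.measure_diff_le_symdiff[OF BM E])
  moreover have "\<bar>measure Q B - measure Q (E \<phi>)\<bar> \<le> measure Q (S B (E \<phi>))"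
    unfolding S_def using BM E sets by (intro Q.measure_diff_le_symdiff) auto
  moreover have "0 \<le> measure P (S B (E \<phi>))" "0 \<le> measure Q (S B (E \<phi>))" by simp_all
  ultimately show ?thesis using \<phi> unfolding r_def E_def by (intro exI[of _ \<phi>]) linarith
qed

lemma borel_measurable_rat_thresholds:
  fixes f :: "'a \<Rightarrow> real"
  assumes "\<And>q :: rat. {x \<in> space N. f x \<le> of_rat q} \<in> sets N"
  shows "f \<in> borel_measurable N"
  unfolding borel_measurable_iff_le
proof
  fix a :: real
  have "{x \<in> space N. f x \<le> a} = (\<Inter>q\<in>{q. a < of_rat q}. {x \<in> space N. f x \<le> of_rat q})" (is "?L = ?R")
  proof
    show "?L \<subseteq> ?R" by auto
    show "?R \<subseteq> ?L"
    proof
      fix x assume x: "x \<in> ?R"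
      obtain q0 :: rat where "a < of_rat q0" using of_rat_dense[of a "a + 1"] by auto
      then have "x \<in> space N" using x by auto
      moreover have "f x \<le> a"
      proof (rule ccontr)
        assume "\<not> f x \<le> a"
        then obtain q :: rat where "a < of_rat q" "of_rat q < f x" using of_rat_dense[of a "f x"] by auto
        then show False using x by auto
      qed
      ultimately show "x \<in> ?L" by simp
    qed
  qed
  moreover have "{q :: rat. a < of_rat q} \<noteq> {}" using of_rat_dense[of a "a + 1"] by auto
  ultimately show "{x \<in> space N. f x \<le> a} \<in> sets N"
    using assms by (auto intro!: sets.countable_INT'')
qed

section \<open>Total variation, single events and disintegration\<close>

text \<open>The difference has total mass 0, so what the negative cells lose is gained on the
  complement of their union. Each of the two groups of cells is thus measured by a single event,
  hence the factor 2.\<close>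

lemma total_variation_upper:
  assumes P: "prob_space P" and Q: "prob_space Q" and sets: "sets P = sets N" "sets Q = sets N"
    and S: "\<And>C. C \<in> sets N \<Longrightarrow> ennreal (measure P C - measure Q C) \<le> S"
  shows "total_variation N (\<lambda>A. measure P A - measure Q A) \<le> 2 * S"
  unfolding total_variation_def
proof (rule SUP_least, clarify)
  interpret P: prob_space P by fact
  interpret Q: prob_space Q by fact
  have space: "space P = space N" "space Q = space N" using sets by (auto dest: sets_eq_imp_space_eq)
  fix \<A> assume \<A>: "finite \<A>" "\<A> \<subseteq> sets N" "disjoint \<A>" "\<Union>\<A> = space N"
  let ?\<mu> = "\<lambda>A. measure P A - measure Q A"
  let ?pos = "{A\<in>\<A>. 0 \<le> ?\<mu> A}" and ?neg = "{A\<in>\<A>. \<not> 0 \<le> ?\<mu> A}"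
  have sum: "(\<Sum>A\<in>\<B>. ?\<mu> A) = ?\<mu> (\<Union>\<B>)" if \<B>: "\<B> \<subseteq> \<A>" for \<B>
  proof -
    have fin: "finite \<B>" using \<A> \<B> finite_subset by blast
    have disj: "disjoint \<B>" using \<A>(3) \<B> by (rule pairwise_subset)
    then have d: "disjoint_family_on id \<B>" by (auto simp: disjoint_family_on_def disjoint_def pairwise_def disjnt_def)
    have "measure P (\<Union>\<B>) = (\<Sum>A\<in>\<B>. measure P A)"
      using P.finite_measure_finite_Union[OF fin, of id] \<A>(2) \<B> d sets by auto
    moreover have "measure Q (\<Union>\<B>) = (\<Sum>A\<in>\<B>. measure Q A)"
      using Q.finite_measure_finite_Union[OF fin, of id] \<A>(2) \<B> d sets by auto
    ultimately show ?thesis by (simp add: sum_subtractf)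
  qed
  have un: "\<Union>\<B> \<in> sets N" if "\<B> \<subseteq> \<A>" for \<B>
    using that \<A> by (intro sets.finite_Union) (auto intro: finite_subset)
  have "(\<Sum>A\<in>\<A>. ennreal \<bar>?\<mu> A\<bar>) = (\<Sum>A\<in>?pos \<union> ?neg. ennreal \<bar>?\<mu> A\<bar>)" by (rule sum.cong) auto
  also have "\<dots> = (\<Sum>A\<in>?pos. ennreal \<bar>?\<mu> A\<bar>) + (\<Sum>A\<in>?neg. ennreal \<bar>?\<mu> A\<bar>)"
    using \<A>(1) by (intro sum.union_disjoint) auto
  also have "(\<Sum>A\<in>?pos. ennreal \<bar>?\<mu> A\<bar>) = ennreal (\<Sum>A\<in>?pos. ?\<mu> A)"
    by (subst sum_ennreal[symmetric]) (auto intro!: sum.cong)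
  also have "\<dots> \<le> S" using sum[of ?pos] S[OF un[of ?pos]] by simp
  also have "(\<Sum>A\<in>?neg. ennreal \<bar>?\<mu> A\<bar>) = ennreal (- (\<Sum>A\<in>?neg. ?\<mu> A))"
    unfolding sum_negf[symmetric] by (subst sum_ennreal[symmetric]) (auto intro!: sum.cong)
  also have "- (\<Sum>A\<in>?neg. ?\<mu> A) = ?\<mu> (space N - \<Union>?neg)"
    using sum[of ?neg] un[of ?neg] P.prob_compl[of "\<Union>?neg"] Q.prob_compl[of "\<Union>?neg"] sets space by auto
  also have "ennreal \<dots> \<le> S" using un[of ?neg] by (intro S) auto
  finally show "(\<Sum>A\<in>\<A>. ennreal \<bar>?\<mu> A\<bar>) \<le> 2 * S" by (simp add: mult_2 add_mono)
qed

lemma total_variation_lower: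
  assumes "C \<in> sets N"
  shows "ennreal (\<mu> C) \<le> total_variation N \<mu>"
proof -
  let ?\<A> = "{C, space N - C}"
  have "ennreal (\<mu> C) \<le> ennreal \<bar>\<mu> C\<bar>" by (intro ennreal_leI) simp
  also have "\<dots> \<le> (\<Sum>A\<in>?\<A>. ennreal \<bar>\<mu> A\<bar>)" by (rule member_le_sum) auto
  also have "\<dots> \<le> total_variation N \<mu>"
    unfolding total_variation_def
  proof (rule SUP_upper)
    show "?\<A> \<in> {\<A>. finite \<A> \<and> \<A> \<subseteq> sets N \<and> disjoint \<A> \<and> \<Union>\<A> = space N}"
      using assms sets.sets_into_space[OF assms] by (auto simp: disjoint_def)
  qed
  finally show ?thesis .
qed

text \<open>The kernel \<open>L\<close> sends \<omega> to the law of (\<omega>, y) with y drawn from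
  \<open>K \<omega>\<close>. By the defining property of conditional expectation its mixture agrees
  with the law of \<open>(\<omega>, Y \<omega>)\<close> on rectangles, hence everywhere. General
  \<open>E\<close> are wanted because later the event for the future depends on \<omega>.\<close>

lemma regular_cond_law_disintegration:
  assumes M: "prob_space M" and sub: "subalgebra M F" and Y[measurable]: "Y \<in> measurable M N"
    and K: "is_regular_cond_law M F N Y K" and E: "E \<in> sets (F \<Otimes>\<^sub>M N)"
  shows "(\<lambda>\<omega>. emeasure (K \<omega>) (Pair \<omega> -` E)) \<in> borel_measurable F"
    and "emeasure M {\<omega> \<in> space M. (\<omega>, Y \<omega>) \<in> E} = (\<integral>\<^sup>+\<omega>. emeasure (K \<omega>) (Pair \<omega> -` E) \<partial>M)"
proof -
  interpret prob_space M by fact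
  interpret fs: finite_measure_subalgebra M F by unfold_locales (rule sub)
  have spF: "space F = space M" using sub by (simp add: subalgebra_def)
  have Km: "K \<in> F \<rightarrow>\<^sub>M prob_algebra N"
    and Kc: "\<And>A. A \<in> sets N \<Longrightarrow> AE \<omega> in M. measure (K \<omega>) A = real_cond_exp M F (indicator (Y -` A \<inter> space M)) \<omega>"
    using K by (auto simp: is_regular_cond_law_def)
  have KP: "prob_space (K \<omega>)" "sets (K \<omega>) = sets N" if "\<omega> \<in> space M" for \<omega>
    using measurable_space[OF Km, of \<omega>] that by (auto simp: space_prob_algebra spF)
  let ?FN = "F \<Otimes>\<^sub>M N"
  define L where "L \<omega> = distr (K \<omega>) ?FN (Pair \<omega>)" for \<omega>
  have L: "L \<in> F \<rightarrow>\<^sub>M prob_algebra ?FN"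
    unfolding L_def[abs_def] by (rule measurable_distr_prob_space2[OF Km]) simp
  have Pm: "Pair \<omega> \<in> measurable (K \<omega>) ?FN" if "\<omega> \<in> space M" for \<omega>
    using that KP(2)[OF that] spF by (subst measurable_cong_sets[OF KP(2)[OF that] refl]) simp
  have Lem: "emeasure (L \<omega>) A = emeasure (K \<omega>) (Pair \<omega> -` A)" if A: "A \<in> sets ?FN" and \<omega>: "\<omega> \<in> space M" for A \<omega>
  proof -
    have "A \<subseteq> space F \<times> space N" using sets.sets_into_space[OF A] by (simp add: space_pair_measure)
    then have "Pair \<omega> -` A \<inter> space (K \<omega>) = Pair \<omega> -` A" using sets_eq_imp_space_eq[OF KP(2)[OF \<omega>]] by auto
    then show ?thesis unfolding L_def using Pm[OF \<omega>] A by (simp add: emeasure_distr)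
  qed
  have Lmeas: "(\<lambda>\<omega>. emeasure (L \<omega>) A) \<in> borel_measurable F" if "A \<in> sets ?FN" for A
    using measurable_prob_algebraD[OF L] that by (rule measurable_emeasure_kernel)
  show "(\<lambda>\<omega>. emeasure (K \<omega>) (Pair \<omega> -` E)) \<in> borel_measurable F"
    using Lmeas[OF E] by (subst measurable_cong[where g = "\<lambda>\<omega>. emeasure (L \<omega>) E"]) (simp_all add: Lem[OF E] spF)
  let ?MF = "restr_to_subalg M F"
  have spMF: "space ?MF = space M" by (rule space_restr_to_subalg)
  have L': "L \<in> measurable ?MF (subprob_algebra ?FN)"
    by (rule measurable_in_subalg[OF sub measurable_prob_algebraD[OF L]])
  have bind: "emeasure (?MF \<bind> L) A = (\<integral>\<^sup>+\<omega>. emeasure (K \<omega>) (Pair \<omega> -` A) \<partial>M)" if A: "A \<in> sets ?FN" for A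
  proof -
    have "emeasure (?MF \<bind> L) A = (\<integral>\<^sup>+\<omega>. emeasure (L \<omega>) A \<partial>?MF)"
      using L' A not_empty by (intro emeasure_bind) (auto simp: spMF)
    also have "\<dots> = (\<integral>\<^sup>+\<omega>. emeasure (L \<omega>) A \<partial>M)" by (rule nn_integral_subalgebra2[OF sub Lmeas[OF A]])
    also have "\<dots> = (\<integral>\<^sup>+\<omega>. emeasure (K \<omega>) (Pair \<omega> -` A) \<partial>M)" by (intro nn_integral_cong Lem A)
    finally show ?thesis .
  qed
  have id[measurable]: "(\<lambda>\<omega>. \<omega>) \<in> measurable M F"
    using sub by (intro measurableI) (auto simp: subalgebra_def)
  have pair[measurable]: "(\<lambda>\<omega>. (\<omega>, Y \<omega>)) \<in> measurable M ?FN" by measurable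
  have rect: "emeasure (distr M ?FN (\<lambda>\<omega>. (\<omega>, Y \<omega>))) (A \<times> C) = emeasure (?MF \<bind> L) (A \<times> C)"
    if A: "A \<in> sets F" and C: "C \<in> sets N" for A C
  proof -
    have AM: "A \<in> sets M" using A sub by (auto simp: subalgebra_def)
    have YC: "Y -` C \<inter> space M \<in> sets M" using measurable_sets[OF Y C] .
    have int: "integrable M (indicator (Y -` C \<inter> space M) :: 'a \<Rightarrow> real)"
      using YC by (intro integrable_const_bound[of _ 1]) auto
    have intK: "integrable M (\<lambda>\<omega>. measure (K \<omega>) C)"
    proof (rule integrable_const_bound[of _ 1])
      have "(\<lambda>\<omega>. measure (K \<omega>) C) \<in> borel_measurable F" using Km C by measurable
      then show "(\<lambda>\<omega>. measure (K \<omega>) C) \<in> borel_measurable M" by (rule measurable_from_subalg[OF sub])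
    qed (use KP in \<open>auto simp: prob_space.prob_le_1\<close>)
    have AS: "A \<subseteq> space M" using sets.sets_into_space[OF A] spF by simp
    then have pre: "(\<lambda>\<omega>. (\<omega>, Y \<omega>)) -` (A \<times> C) \<inter> space M = A \<inter> (Y -` C \<inter> space M)" by auto
    have "emeasure (distr M ?FN (\<lambda>\<omega>. (\<omega>, Y \<omega>))) (A \<times> C) = ennreal (measure M (A \<inter> (Y -` C \<inter> space M)))"
      using A C by (subst emeasure_distr) (auto simp: pre emeasure_eq_measure)
    also have "measure M (A \<inter> (Y -` C \<inter> space M)) = (LINT \<omega>|M. indicator (A \<inter> (Y -` C \<inter> space M)) \<omega>)"
      using AM YC by simp
    also have "\<dots> = (LINT \<omega>:A|M. indicator (Y -` C \<inter> space M) \<omega>)"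
      unfolding set_lebesgue_integral_def by (intro Bochner_Integration.integral_cong) (auto simp: indicator_def)
    also have "\<dots> = (LINT \<omega>:A|M. real_cond_exp M F (indicator (Y -` C \<inter> space M)) \<omega>)"
      by (rule fs.real_cond_exp_intA[OF int A])
    also have "\<dots> = (LINT \<omega>:A|M. measure (K \<omega>) C)"
      unfolding set_lebesgue_integral_def
    proof (rule integral_cong_AE)
      have "real_cond_exp M F (indicator (Y -` C \<inter> space M)) \<in> borel_measurable M"
        using int by (simp add: fs.real_cond_exp_int borel_measurable_integrable)
      then show "(\<lambda>\<omega>. indicat_real A \<omega> *\<^sub>R real_cond_exp M F (indicator (Y -` C \<inter> space M)) \<omega>) \<in> borel_measurable M"
        using AM by measurable
      show "(\<lambda>\<omega>. indicat_real A \<omega> *\<^sub>R measure (K \<omega>) C) \<in> borel_measurable M"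
        using AM borel_measurable_integrable[OF intK] by measurable
      show "AE \<omega> in M. indicat_real A \<omega> *\<^sub>R real_cond_exp M F (indicator (Y -` C \<inter> space M)) \<omega> =
          indicat_real A \<omega> *\<^sub>R measure (K \<omega>) C"
        using Kc[OF C] by eventually_elim simp
    qed
    also have "ennreal (LINT \<omega>:A|M. measure (K \<omega>) C) = (\<integral>\<^sup>+\<omega>. ennreal (indicator A \<omega> * measure (K \<omega>) C) \<partial>M)"
      unfolding set_lebesgue_integral_def
      using integrable_mult_indicator[OF AM intK] by (subst nn_integral_eq_integral) auto
    also have "\<dots> = (\<integral>\<^sup>+\<omega>. emeasure (K \<omega>) (Pair \<omega> -` (A \<times> C)) \<partial>M)"
    proof (rule nn_integral_cong)
      fix \<omega> assume \<omega>: "\<omega> \<in> space M"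
      interpret KP: prob_space "K \<omega>" by (rule KP[OF \<omega>])
      show "ennreal (indicator A \<omega> * measure (K \<omega>) C) = emeasure (K \<omega>) (Pair \<omega> -` (A \<times> C))"
        by (cases "\<omega> \<in> A") (auto simp: KP.emeasure_eq_measure)
    qed
    also have "\<dots> = emeasure (?MF \<bind> L) (A \<times> C)" using A C by (subst bind) auto
    finally show ?thesis .
  qed
  have "distr M ?FN (\<lambda>\<omega>. (\<omega>, Y \<omega>)) = ?MF \<bind> L"
  proof (rule measure_eqI_generator_eq[OF Int_stable_pair_measure_generator[of F N]])
    show "{a \<times> b |a b. a \<in> sets F \<and> b \<in> sets N} \<subseteq> Pow (space F \<times> space N)"
      by (rule pair_measure_closed)
    show "emeasure (distr M ?FN (\<lambda>\<omega>. (\<omega>, Y \<omega>))) X = emeasure (?MF \<bind> L) X"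
      if "X \<in> {a \<times> b |a b. a \<in> sets F \<and> b \<in> sets N}" for X using that rect by auto
    show "sets (distr M ?FN (\<lambda>\<omega>. (\<omega>, Y \<omega>))) = sigma_sets (space F \<times> space N) {a \<times> b |a b. a \<in> sets F \<and> b \<in> sets N}"
      by (simp add: sets_pair_measure)
    have "sets (?MF \<bind> L) = sets ?FN"
      using measurable_space[OF L'] not_empty by (intro sets_bind) (auto simp: spMF space_subprob_algebra)
    then show "sets (?MF \<bind> L) = sigma_sets (space F \<times> space N) {a \<times> b |a b. a \<in> sets F \<and> b \<in> sets N}"
      by (simp add: sets_pair_measure)
    show "range (\<lambda>i::nat. space F \<times> space N) \<subseteq> {a \<times> b |a b. a \<in> sets F \<and> b \<in> sets N}" by auto
    show "(\<Union>i::nat. space F \<times> space N) = space F \<times> space N" by simp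
    interpret D: prob_space "distr M ?FN (\<lambda>\<omega>. (\<omega>, Y \<omega>))" by (rule prob_space_distr[OF pair])
    show "emeasure (distr M ?FN (\<lambda>\<omega>. (\<omega>, Y \<omega>))) (space F \<times> space N) \<noteq> \<infinity>" by simp
  qed
  then have "emeasure (distr M ?FN (\<lambda>\<omega>. (\<omega>, Y \<omega>))) E = emeasure (?MF \<bind> L) E" by simp
  moreover have "emeasure (distr M ?FN (\<lambda>\<omega>. (\<omega>, Y \<omega>))) E = emeasure M {\<omega> \<in> space M. (\<omega>, Y \<omega>) \<in> E}"
    using E by (subst emeasure_distr) (auto intro!: arg_cong[where f = "emeasure M"])
  ultimately show "emeasure M {\<omega> \<in> space M. (\<omega>, Y \<omega>) \<in> E} = (\<integral>\<^sup>+\<omega>. emeasure (K \<omega>) (Pair \<omega> -` E) \<partial>M)"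
    by (simp add: bind[OF E])
qed

section \<open>Joint events of past and future\<close>

text \<open>Conditional laws go from sample points to sequences, so joint events live on the product
  of the two spaces. This reads a point of the product as one sequence.\<close>

definition past_future :: "int \<Rightarrow> (int \<Rightarrow> 'a \<Rightarrow> real) \<Rightarrow> 'a \<times> (int \<Rightarrow> real) \<Rightarrow> int \<Rightarrow> real" where
  "past_future m X p j = (if j \<le> m then X j (fst p) else snd p j)"

lemma past_future_measurable:
  assumes "j \<in> {..m} \<union> J" "J \<subseteq> {m<..}"
  shows "(\<lambda>p. past_future m X p j) \<in> borel_measurable (generated_field M X {..m} \<Otimes>\<^sub>M (\<Pi>\<^sub>M j\<in>J. borel))"
proof (cases "j \<le> m")
  case True
  then have "X j \<in> borel_measurable (generated_field M X {..m})" by (intro measurable_generated_field) simp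
  then show ?thesis using True by (simp add: past_future_def[abs_def])
next
  case False
  then have "j \<in> J" using assms by auto
  then show ?thesis using False by (simp add: past_future_def[abs_def])
qed

text \<open>Every coordinate is measurable for the sigma-field generated by rational thresholds,
  hence so is the identity into the product. This makes \<open>event_formula_approximation\<close>
  applicable.\<close>

lemma sets_PiM_thresholds:
  fixes J :: "int set"
  assumes "B \<in> sets (\<Pi>\<^sub>M j\<in>J. borel)"
  shows "B \<in> sigma_sets (space (\<Pi>\<^sub>M j\<in>J. borel))
    {{y \<in> space (\<Pi>\<^sub>M j\<in>J. borel). y j \<le> real_of_rat q} | j q. j \<in> J}"
proof -
  let ?N = "\<Pi>\<^sub>M j\<in>J. (borel :: real measure)"
  let ?G = "{{y \<in> space ?N. y j \<le> real_of_rat q} | j q. j \<in> J}"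
  let ?S = "sigma (space ?N) ?G"
  have G: "?G \<subseteq> Pow (space ?N)" by auto
  have sp: "space ?S = space ?N" by (rule space_measure_of[OF G])
  have se: "sets ?S = sigma_sets (space ?N) ?G" by (rule sets_measure_of[OF G])
  have comp: "(\<lambda>y. y j) \<in> borel_measurable ?S" if "j \<in> J" for j
  proof (rule borel_measurable_rat_thresholds)
    fix q show "{x \<in> space ?S. x j \<le> real_of_rat q} \<in> sets ?S"
      unfolding sp se using that by (intro sigma_sets.Basic) blast
  qed
  have "(\<lambda>y j. y j) \<in> measurable ?S ?N"
    by (rule measurable_PiM_single') (use comp sp in \<open>auto simp: space_PiM\<close>)
  then have "(\<lambda>y. y) -` B \<inter> space ?S \<in> sets ?S" using assms by (rule measurable_sets)
  moreover have "(\<lambda>y. y) -` B \<inter> space ?S = B" unfolding sp using sets.sets_into_space[OF assms] by blast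
  ultimately show ?thesis by (simp only: se)
qed

text \<open>The same identity argument on sample points times sequences; the first component is
  measurable because the past field is itself generated by the X_j with
  \<open>j \<le> m\<close>.\<close>

lemma sets_past_future_thresholds:
  assumes J: "J \<subseteq> {m<..}" and B: "B \<in> sets (generated_field M X {..m} \<Otimes>\<^sub>M (\<Pi>\<^sub>M j\<in>J. borel))"
  shows "B \<in> sigma_sets (space (generated_field M X {..m} \<Otimes>\<^sub>M (\<Pi>\<^sub>M j\<in>J. borel)))
    {{p \<in> space (generated_field M X {..m} \<Otimes>\<^sub>M (\<Pi>\<^sub>M j\<in>J. borel)). past_future m X p j \<le> real_of_rat q} | j q.
      j \<in> {..m} \<union> J}"
proof -
  let ?F = "generated_field M X {..m}" and ?N = "\<Pi>\<^sub>M j\<in>J. (borel :: real measure)"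
  let ?\<Omega> = "space (?F \<Otimes>\<^sub>M ?N)"
  let ?G = "{{p \<in> ?\<Omega>. past_future m X p j \<le> real_of_rat q} | j q. j \<in> {..m} \<union> J}"
  let ?S = "sigma ?\<Omega> ?G"
  have G: "?G \<subseteq> Pow ?\<Omega>" by auto
  have sp: "space ?S = ?\<Omega>" by (rule space_measure_of[OF G])
  have se: "sets ?S = sigma_sets ?\<Omega> ?G" by (rule sets_measure_of[OF G])
  have comp: "(\<lambda>p. past_future m X p j) \<in> borel_measurable ?S" if "j \<in> {..m} \<union> J" for j
  proof (rule borel_measurable_rat_thresholds)
    fix q show "{x \<in> space ?S. past_future m X x j \<le> real_of_rat q} \<in> sets ?S"
      unfolding sp se using that by (intro sigma_sets.Basic) blast
  qed
  have "fst \<in> measurable ?S (sigma (space M) (\<Union>j\<in>{..m}. {X j -` A \<inter> space M |A. A \<in> sets borel}))"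
  proof (rule measurable_measure_of)
    show "fst \<in> space ?S \<rightarrow> space M" unfolding sp by (auto simp: space_pair_measure)
    show "(\<Union>j\<in>{..m}. {X j -` A \<inter> space M |A. A \<in> sets borel}) \<subseteq> Pow (space M)" by auto
    fix y assume "y \<in> (\<Union>j\<in>{..m}. {X j -` A \<inter> space M |A. A \<in> sets borel})"
    then obtain j A where j: "j \<le> m" and A: "A \<in> sets borel" and y: "y = X j -` A \<inter> space M" by auto
    have "fst -` y \<inter> space ?S = (\<lambda>p. past_future m X p j) -` A \<inter> space ?S"
      using j unfolding sp by (auto simp: y past_future_def space_pair_measure)
    then show "fst -` y \<inter> space ?S \<in> sets ?S"
      using measurable_sets[OF comp[of j] A] j by simp
  qed
  then have fst: "fst \<in> measurable ?S ?F" unfolding generated_field_def .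
  have "(\<lambda>p j. snd p j) \<in> measurable ?S ?N"
  proof (rule measurable_PiM_single')
    fix j assume j: "j \<in> J"
    then have "\<not> j \<le> m" using J by auto
    then have "(\<lambda>p. snd p j) = (\<lambda>p. past_future m X p j)" by (auto simp: past_future_def)
    then show "(\<lambda>p. snd p j) \<in> borel_measurable ?S" using comp[of j] j by simp
  next
    show "(\<lambda>p j. snd p j) \<in> space ?S \<rightarrow> (\<Pi>\<^sub>E i\<in>J. space borel)"
      unfolding sp by (auto simp: space_pair_measure space_PiM)
  qed
  then have "(\<lambda>p. (fst p, snd p)) \<in> measurable ?S (?F \<Otimes>\<^sub>M ?N)" using fst by (intro measurable_Pair) auto
  then have "(\<lambda>p. p) -` B \<inter> space ?S \<in> sets ?S" using B by (simp add: measurable_sets)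
  moreover have "(\<lambda>p. p) -` B \<inter> space ?S = B" unfolding sp using sets.sets_into_space[OF B] by blast
  ultimately show ?thesis by (simp only: se)
qed

context coercive_gaussian
begin

text \<open>The counterpart of \<open>regular_cond_law_disintegration\<close> for the product law,
  with a constant kernel.\<close>

lemma decoupled_event:
  assumes E: "E \<in> sets (generated_field M X {..m} \<Otimes>\<^sub>M (\<Pi>\<^sub>M j\<in>J. borel))"
  shows "(\<lambda>\<omega>. (fst \<omega>, \<lambda>j\<in>J. X j (snd \<omega>))) \<in> measurable (M \<Otimes>\<^sub>M M) (generated_field M X {..m} \<Otimes>\<^sub>M (\<Pi>\<^sub>M j\<in>J. borel))"
    and "emeasure (M \<Otimes>\<^sub>M M) {\<omega> \<in> space (M \<Otimes>\<^sub>M M). (fst \<omega>, \<lambda>j\<in>J. X j (snd \<omega>)) \<in> E} =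
      (\<integral>\<^sup>+\<omega>. emeasure (joint_law M X J) (Pair \<omega> -` E) \<partial>M)"
    and "(\<lambda>\<omega>. emeasure (joint_law M X J) (Pair \<omega> -` E)) \<in> borel_measurable M"
proof -
  let ?F = "generated_field M X {..m}" and ?N = "\<Pi>\<^sub>M j\<in>J. (borel :: real measure)"
  let ?Y = "\<lambda>\<omega>. \<lambda>j\<in>J. X j \<omega>"
  have sub: "subalgebra M ?F" by (rule subalgebra_generated_field) simp
  have Y[measurable]: "?Y \<in> measurable M ?N" by (intro measurable_restrict) auto
  have id[measurable]: "(\<lambda>\<omega>. \<omega>) \<in> measurable M ?F"
    using sub by (intro measurableI) (auto simp: subalgebra_def)
  have fstF: "fst \<in> measurable (M \<Otimes>\<^sub>M M) ?F" using measurable_compose[OF measurable_fst id] by simp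
  show m: "(\<lambda>\<omega>. (fst \<omega>, ?Y (snd \<omega>))) \<in> measurable (M \<Otimes>\<^sub>M M) (?F \<Otimes>\<^sub>M ?N)"
    using fstF measurable_compose[OF measurable_snd Y] by (intro measurable_Pair) simp_all
  let ?A = "{\<omega> \<in> space (M \<Otimes>\<^sub>M M). (fst \<omega>, ?Y (snd \<omega>)) \<in> E}"
  have A: "?A \<in> sets (M \<Otimes>\<^sub>M M)" using measurable_sets[OF m E] by (simp add: vimage_def Int_def conj_commute)
  have sec: "emeasure M (Pair \<omega> -` ?A) = emeasure (joint_law M X J) (Pair \<omega> -` E)" if \<omega>: "\<omega> \<in> space M" for \<omega>
  proof -
    have "Pair \<omega> -` E \<in> sets ?N" by (rule sets_Pair1[OF E])
    then have "emeasure (joint_law M X J) (Pair \<omega> -` E) = emeasure M (?Y -` (Pair \<omega> -` E) \<inter> space M)"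
      unfolding joint_law_def by (rule emeasure_distr[OF Y])
    also have "?Y -` (Pair \<omega> -` E) \<inter> space M = Pair \<omega> -` ?A" using \<omega> by (auto simp: space_pair_measure)
    finally show ?thesis by simp
  qed
  have "emeasure (M \<Otimes>\<^sub>M M) ?A = (\<integral>\<^sup>+\<omega>. emeasure M (Pair \<omega> -` ?A) \<partial>M)"
    by (rule emeasure_pair_measure_alt[OF A])
  also have "\<dots> = (\<integral>\<^sup>+\<omega>. emeasure (joint_law M X J) (Pair \<omega> -` E) \<partial>M)" by (intro nn_integral_cong sec)
  finally show "emeasure (M \<Otimes>\<^sub>M M) ?A = (\<integral>\<^sup>+\<omega>. emeasure (joint_law M X J) (Pair \<omega> -` E) \<partial>M)" .
  have "(\<lambda>\<omega>. emeasure M (Pair \<omega> -` ?A)) \<in> borel_measurable M" by (rule measurable_emeasure_Pair[OF A])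
  then show "(\<lambda>\<omega>. emeasure (joint_law M X J) (Pair \<omega> -` E)) \<in> borel_measurable M"
    using measurable_cong[of M "\<lambda>\<omega>. emeasure M (Pair \<omega> -` ?A)", OF sec] by blast
qed

text \<open>The entropy estimate is uniform over finite blocks, and one formula approximates
  \<open>E\<close> under both laws; so the finite-dimensional bound survives with an error
  \<epsilon>.\<close>

lemma past_future_decoupling_bound:
  assumes J: "J \<subseteq> {m<..}" and E: "E \<in> sets (generated_field M X {..m} \<Otimes>\<^sub>M (\<Pi>\<^sub>M j\<in>J. borel))"
    and u: "0 < u" "u \<le> 1"
    and D: "\<And>I K. finite I \<Longrightarrow> finite K \<Longrightarrow> I \<subseteq> {..m} \<Longrightarrow> K \<subseteq> J \<Longrightarrow>
      \<Lambda> / \<mu> ^ 3 * (\<Sum>i\<in>I. \<Sum>j\<in>K. (\<sigma> i j)\<^sup>2) \<le> D"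
  shows "measure M {\<omega> \<in> space M. (\<omega>, \<lambda>j\<in>J. X j \<omega>) \<in> E} -
    measure (M \<Otimes>\<^sub>M M) {\<omega> \<in> space (M \<Otimes>\<^sub>M M). (fst \<omega>, \<lambda>j\<in>J. X j (snd \<omega>)) \<in> E} \<le> D / u + u"
proof (rule field_le_epsilon)
  fix \<epsilon> :: real assume "\<epsilon> > 0"
  then have \<epsilon>2: "\<epsilon> / 2 > 0" by simp
  let ?F = "generated_field M X {..m}" and ?N = "\<Pi>\<^sub>M j\<in>J. (borel :: real measure)"
  let ?Y = "\<lambda>\<omega>. \<lambda>j\<in>J. X j \<omega>"
  interpret MM: prob_space "M \<Otimes>\<^sub>M M" by (rule prob_space_pair)
  have sub: "subalgebra M ?F" by (rule subalgebra_generated_field) simp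
  have Y[measurable]: "?Y \<in> measurable M ?N" by (intro measurable_restrict) auto
  have id[measurable]: "(\<lambda>\<omega>. \<omega>) \<in> measurable M ?F"
    using sub by (intro measurableI) (auto simp: subalgebra_def)
  have p1: "(\<lambda>\<omega>. (\<omega>, ?Y \<omega>)) \<in> measurable M (?F \<Otimes>\<^sub>M ?N)" by measurable
  note p2 = decoupled_event(1)[OF E]
  let ?P = "distr M (?F \<Otimes>\<^sub>M ?N) (\<lambda>\<omega>. (\<omega>, ?Y \<omega>))"
  let ?Q = "distr (M \<Otimes>\<^sub>M M) (?F \<Otimes>\<^sub>M ?N) (\<lambda>\<omega>. (fst \<omega>, ?Y (snd \<omega>)))"
  interpret P: prob_space ?P by (rule prob_space_distr[OF p1])
  interpret Q: prob_space ?Q by (rule MM.prob_space_distr[OF p2])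
  let ?S = "{..m} \<union> J"
  have "\<exists>\<phi>. \<bar>measure ?P E - measure ?P {x \<in> space ?P. holds ?S (past_future m X x) \<phi>}\<bar> < \<epsilon> / 2 \<and>
    \<bar>measure ?Q E - measure ?Q {x \<in> space ?P. holds ?S (past_future m X x) \<phi>}\<bar> < \<epsilon> / 2"
  proof (rule event_formula_approximation[OF P.finite_measure_axioms Q.finite_measure_axioms _ _ _ \<epsilon>2])
    show "E \<in> sigma_sets (space ?P) {{x \<in> space ?P. past_future m X x j \<le> real_of_rat q} |j q. j \<in> ?S}"
      using sets_past_future_thresholds[OF J E] by simp
    fix j assume "j \<in> ?S"
    then show "(\<lambda>x. past_future m X x j) \<in> borel_measurable ?P"
      using past_future_measurable[of j m J X M] J by simp
  qed simp
  then obtain \<phi> where \<phi>: "\<bar>measure ?P E - measure ?P {x \<in> space ?P. holds ?S (past_future m X x) \<phi>}\<bar> < \<epsilon> / 2"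
    "\<bar>measure ?Q E - measure ?Q {x \<in> space ?P. holds ?S (past_future m X x) \<phi>}\<bar> < \<epsilon> / 2" by blast
  let ?E = "{x \<in> space (?F \<Otimes>\<^sub>M ?N). holds ?S (past_future m X x) \<phi>}"
  have E': "?E \<in> sets (?F \<Otimes>\<^sub>M ?N)"
    by (rule holds_measurable, rule past_future_measurable[OF _ J])
  \<comment> \<open>Only indices mentioned by the formula matter, so the approximating event is
    finite-dimensional.\<close>
  let ?T = "?S \<inter> indices \<phi>"
  have T: "finite ?T" using finite_indices by simp
  let ?D = "{x \<in> space (\<Pi>\<^sub>M k\<in>?T. (borel :: real measure)). holds ?T x \<phi>}"
  have D': "?D \<in> sets (\<Pi>\<^sub>M k\<in>?T. borel)" by (intro holds_measurable) auto
  have pre1: "(\<lambda>\<omega>. (\<omega>, ?Y \<omega>)) -` ?E \<inter> space M = (\<lambda>\<omega>. \<lambda>k\<in>?T. X k \<omega>) -` ?D \<inter> space M"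
  proof -
    have "holds ?S (past_future m X (\<omega>, ?Y \<omega>)) \<phi> = holds ?T (\<lambda>k\<in>?T. X k \<omega>) \<phi>" for \<omega>
      using J by (intro holds_cong) (auto simp: past_future_def)
    then show ?thesis using measurable_space[OF p1] by (auto simp: space_PiM)
  qed
  have pre2: "(\<lambda>\<omega>. (fst \<omega>, ?Y (snd \<omega>))) -` ?E \<inter> space (M \<Otimes>\<^sub>M M) =
      (\<lambda>\<omega>. \<lambda>k\<in>?T. decouple m X k \<omega>) -` ?D \<inter> space (M \<Otimes>\<^sub>M M)"
  proof -
    have "holds ?S (past_future m X (fst \<omega>, ?Y (snd \<omega>))) \<phi> = holds ?T (\<lambda>k\<in>?T. decouple m X k \<omega>) \<phi>" for \<omega>
      using J by (intro holds_cong) (auto simp: past_future_def decouple_def)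
    then show ?thesis using measurable_space[OF p2] by (auto simp: space_PiM)
  qed
  have "measure ?P ?E - measure ?Q ?E \<le>
      \<Lambda> / \<mu> ^ 3 * (\<Sum>i\<in>{i\<in>?T. i \<le> m}. \<Sum>j\<in>{i\<in>?T. \<not> i \<le> m}. (\<sigma> i j)\<^sup>2) / u + u"
    unfolding measure_distr[OF p1 E'] measure_distr[OF p2 E'] pre1 pre2
    by (rule joint_vs_decoupled[OF T D' u])
  also have "\<dots> \<le> D / u + u"
  proof -
    have fT: "finite {i\<in>?T. Q i}" for Q by (rule finite_subset[OF _ T]) blast
    show ?thesis using u by (intro add_right_mono divide_right_mono D fT) auto
  qed
  finally have "measure ?P ?E - measure ?Q ?E \<le> D / u + u" .
  moreover have "measure ?P E = measure M {\<omega> \<in> space M. (\<omega>, ?Y \<omega>) \<in> E}"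
    unfolding measure_distr[OF p1 E] by (rule arg_cong[where f = "measure M"]) auto
  moreover have "measure ?Q E = measure (M \<Otimes>\<^sub>M M) {\<omega> \<in> space (M \<Otimes>\<^sub>M M). (fst \<omega>, ?Y (snd \<omega>)) \<in> E}"
    unfolding measure_distr[OF p2 E] by (rule arg_cong[where f = "measure (M \<Otimes>\<^sub>M M)"]) auto
  moreover have "\<bar>measure ?P E - measure ?P ?E\<bar> < \<epsilon> / 2" "\<bar>measure ?Q E - measure ?Q ?E\<bar> < \<epsilon> / 2"
    using \<phi> by simp_all
  ultimately show "measure M {\<omega> \<in> space M. (\<omega>, ?Y \<omega>) \<in> E} -
    measure (M \<Otimes>\<^sub>M M) {\<omega> \<in> space (M \<Otimes>\<^sub>M M). (fst \<omega>, ?Y (snd \<omega>)) \<in> E} \<le> D / u + u + \<epsilon>" by linarith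
qed

text \<open>Over the countable algebra of formulas a maximising event can be chosen measurably in \<open>\<omega>\<close>, so
  that the integral of the maxima is again a difference of two probabilities.\<close>

lemma total_variation_integral_upper:
  assumes J: "J \<subseteq> {m<..}"
    and K: "is_regular_cond_law M (generated_field M X {..m}) (\<Pi>\<^sub>M j\<in>J. borel) (\<lambda>\<omega>. \<lambda>j\<in>J. X j \<omega>) K"
    and d: "\<And>E. E \<in> sets (generated_field M X {..m} \<Otimes>\<^sub>M (\<Pi>\<^sub>M j\<in>J. borel)) \<Longrightarrow>
      measure M {\<omega> \<in> space M. (\<omega>, \<lambda>j\<in>J. X j \<omega>) \<in> E} -
      measure (M \<Otimes>\<^sub>M M) {\<omega> \<in> space (M \<Otimes>\<^sub>M M). (fst \<omega>, \<lambda>j\<in>J. X j (snd \<omega>)) \<in> E} \<le> d"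
  shows "(\<integral>\<^sup>+\<omega>. total_variation (\<Pi>\<^sub>M j\<in>J. borel)
      (\<lambda>A. measure (K \<omega>) A - measure (joint_law M X J) A) \<partial>M) \<le> 2 * ennreal d"
proof -
  let ?F = "generated_field M X {..m}" and ?N = "\<Pi>\<^sub>M j\<in>J. (borel :: real measure)"
  let ?Y = "\<lambda>\<omega>. \<lambda>j\<in>J. X j \<omega>" and ?\<rho> = "joint_law M X J"
  interpret MM: prob_space "M \<Otimes>\<^sub>M M" by (rule prob_space_pair)
  have sub: "subalgebra M ?F" by (rule subalgebra_generated_field) simp
  have Y[measurable]: "?Y \<in> measurable M ?N" by (intro measurable_restrict) auto
  have Km: "K \<in> ?F \<rightarrow>\<^sub>M prob_algebra ?N" using K by (simp add: is_regular_cond_law_def)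
  have KP: "prob_space (K \<omega>)" "sets (K \<omega>) = sets ?N" "space (K \<omega>) = space ?N" if "\<omega> \<in> space M" for \<omega>
    using prob_algebra_memberD[OF Km] that by simp_all
  interpret \<rho>: prob_space ?\<rho> unfolding joint_law_def by (rule prob_space_distr[OF Y])
  have sets_\<rho>: "sets ?\<rho> = sets ?N" by (simp add: joint_law_def)
  \<comment> \<open>Index 0 is the empty event, which makes the running maxima nonnegative; the
    remaining indices enumerate all formulas.\<close>
  define C where "C i = (case i of 0 \<Rightarrow> {} | Suc k \<Rightarrow> {y \<in> space ?N. holds J y (from_nat k)})" for i :: nat
  have C: "C i \<in> sets ?N" for i
    by (cases i) (auto simp: C_def intro!: holds_measurable)
  define D where "D i \<omega> = measure (K \<omega>) (C i) - measure ?\<rho> (C i)" for i \<omega>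
  have Dm[measurable]: "D i \<in> borel_measurable ?F" for i
    unfolding D_def[abs_def] using Km C by measurable
  have DM[measurable]: "D i \<in> borel_measurable M" for i by (rule measurable_from_subalg[OF sub Dm])
  have D0: "D 0 \<omega> = 0" for \<omega> by (simp add: D_def C_def)
  \<comment> \<open>Approximation under both measures at once shows that formula events suffice for
    the supremum over all events.\<close>
  have TV: "total_variation ?N (\<lambda>A. measure (K \<omega>) A - measure ?\<rho> A) \<le> 2 * (SUP i. ennreal (D i \<omega>))"
    if \<omega>: "\<omega> \<in> space M" for \<omega>
  proof (rule total_variation_upper[OF KP(1)[OF \<omega>] \<rho>.prob_space_axioms KP(2)[OF \<omega>] sets_\<rho>])
    interpret KP: prob_space "K \<omega>" by (rule KP(1)[OF \<omega>])
    fix A assume A: "A \<in> sets ?N"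
    show "ennreal (measure (K \<omega>) A - measure ?\<rho> A) \<le> (SUP i. ennreal (D i \<omega>))"
    proof (rule ennreal_le_epsilon)
      fix \<epsilon> :: real assume "\<epsilon> > 0"
      then have \<epsilon>2: "\<epsilon> / 2 > 0" by simp
      have "\<exists>\<phi>. \<bar>measure (K \<omega>) A - measure (K \<omega>) {y \<in> space (K \<omega>). holds J y \<phi>}\<bar> < \<epsilon> / 2 \<and>
          \<bar>measure ?\<rho> A - measure ?\<rho> {y \<in> space (K \<omega>). holds J y \<phi>}\<bar> < \<epsilon> / 2"
      proof (rule event_formula_approximation[where Z = "\<lambda>y. y", OF KP.finite_measure_axioms \<rho>.finite_measure_axioms _ _ _ \<epsilon>2])
        show "sets ?\<rho> = sets (K \<omega>)" by (simp add: sets_\<rho> KP(2)[OF \<omega>])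
        show "A \<in> sigma_sets (space (K \<omega>)) {{y \<in> space (K \<omega>). y j \<le> real_of_rat q} |j q. j \<in> J}"
          unfolding KP(3)[OF \<omega>] by (rule sets_PiM_thresholds[OF A])
        show "(\<lambda>y. y j) \<in> borel_measurable (K \<omega>)" if "j \<in> J" for j
          using that by (subst measurable_cong_sets[OF KP(2)[OF \<omega>] refl]) simp
      qed
      then obtain \<phi> where \<phi>: "\<bar>measure (K \<omega>) A - measure (K \<omega>) {y \<in> space ?N. holds J y \<phi>}\<bar> < \<epsilon> / 2"
          "\<bar>measure ?\<rho> A - measure ?\<rho> {y \<in> space ?N. holds J y \<phi>}\<bar> < \<epsilon> / 2"
        unfolding KP(3)[OF \<omega>] by blast
      have "{y \<in> space ?N. holds J y \<phi>} = C (Suc (to_nat \<phi>))" by (simp add: C_def)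
      note \<phi> = \<phi>[unfolded this]
      have "measure (K \<omega>) A - measure ?\<rho> A \<le> D (Suc (to_nat \<phi>)) \<omega> + \<epsilon>"
        using \<phi> unfolding D_def by linarith
      then have "ennreal (measure (K \<omega>) A - measure ?\<rho> A) \<le> ennreal (D (Suc (to_nat \<phi>)) \<omega> + \<epsilon>)"
        by (rule ennreal_leI)
      also have "\<dots> \<le> ennreal (D (Suc (to_nat \<phi>)) \<omega>) + ennreal \<epsilon>"
        using \<open>\<epsilon> > 0\<close> by (cases "D (Suc (to_nat \<phi>)) \<omega> \<ge> 0") (auto simp: ennreal_plus ennreal_neg intro!: ennreal_leI)
      also have "\<dots> \<le> (SUP i. ennreal (D i \<omega>)) + ennreal \<epsilon>"
        by (intro add_right_mono SUP_upper) auto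
      finally show "ennreal (measure (K \<omega>) A - measure ?\<rho> A) \<le> (SUP i. ennreal (D i \<omega>)) + ennreal \<epsilon>" .
    qed
  qed
  \<comment> \<open>The least maximiser among the events 0 to \<open>n\<close>: an integer-valued
    function of \<omega>, measurable for the past field.\<close>
  define \<iota> where "\<iota> n \<omega> = (LEAST i. i \<le> n \<and> (\<forall>k\<in>{..n}. D k \<omega> \<le> D i \<omega>))" for n \<omega>
  have \<iota>: "\<iota> n \<omega> \<le> n" "\<And>k. k \<le> n \<Longrightarrow> D k \<omega> \<le> D (\<iota> n \<omega>) \<omega>" for n \<omega>
  proof -
    have "Max ((\<lambda>k. D k \<omega>) ` {..n}) \<in> (\<lambda>k. D k \<omega>) ` {..n}" by (intro Max_in) auto
    then obtain i where i: "Max ((\<lambda>k. D k \<omega>) ` {..n}) = D i \<omega>" "i \<in> {..n}" by (rule imageE)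
    have "\<exists>i. i \<le> n \<and> (\<forall>k\<in>{..n}. D k \<omega> \<le> D i \<omega>)"
      using i(2) by (intro exI[of _ i]) (auto simp: i(1)[symmetric])
    from LeastI_ex[OF this] show "\<iota> n \<omega> \<le> n" "\<And>k. k \<le> n \<Longrightarrow> D k \<omega> \<le> D (\<iota> n \<omega>) \<omega>"
      unfolding \<iota>_def by auto
  qed
  have \<iota>m[measurable]: "\<iota> n \<in> measurable ?F (count_space UNIV)" for n
    unfolding \<iota>_def[abs_def] by measurable
  have \<iota>M[measurable]: "\<iota> n \<in> measurable M (count_space UNIV)" for n
    by (rule measurable_from_subalg[OF sub \<iota>m])
  define G where "G n \<omega> = D (\<iota> n \<omega>) \<omega>" for n \<omega>
  have Gm[measurable]: "G n \<in> borel_measurable M" for n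
    unfolding G_def[abs_def] by (rule measurable_compose_countable[OF _ \<iota>M]) (rule DM)
  have G0: "0 \<le> G n \<omega>" for n \<omega> using \<iota>(2)[of 0 n \<omega>] D0 by (simp add: G_def)
  have Gmono: "incseq (\<lambda>n \<omega>. ennreal (G n \<omega>))"
  proof (rule incseq_SucI, rule le_funI)
    fix n \<omega> show "ennreal (G n \<omega>) \<le> ennreal (G (Suc n) \<omega>)"
      unfolding G_def using \<iota>(1)[of n \<omega>] by (intro ennreal_leI \<iota>(2)) simp
  qed
  have SUPG: "(SUP i. ennreal (D i \<omega>)) \<le> (SUP n. ennreal (G n \<omega>))" for \<omega>
  proof (rule SUP_mono)
    fix i show "\<exists>n\<in>UNIV. ennreal (D i \<omega>) \<le> ennreal (G n \<omega>)"
      unfolding G_def by (intro bexI[of _ i] ennreal_leI \<iota>(2)) auto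
  qed
  have int_G: "(\<integral>\<^sup>+\<omega>. ennreal (G n \<omega>) \<partial>M) \<le> ennreal d" for n
  proof -
    \<comment> \<open>The chosen events are glued into one joint event; its probabilities under the
      two laws differ by the integral of \<open>G n\<close>.\<close>
    let ?E = "{p \<in> space (?F \<Otimes>\<^sub>M ?N). snd p \<in> C (\<iota> n (fst p))}"
    have E: "?E \<in> sets (?F \<Otimes>\<^sub>M ?N)"
    proof -
      have "?E = (\<Union>i. {p \<in> space (?F \<Otimes>\<^sub>M ?N). \<iota> n (fst p) = i \<and> snd p \<in> C i})" by auto
      moreover have "{p \<in> space (?F \<Otimes>\<^sub>M ?N). \<iota> n (fst p) = i \<and> snd p \<in> C i} \<in> sets (?F \<Otimes>\<^sub>M ?N)" for i
        using C[of i] by measurable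
      ultimately show ?thesis by auto
    qed
    have sec: "Pair \<omega> -` ?E = C (\<iota> n \<omega>)" if "\<omega> \<in> space M" for \<omega>
      using that sets.sets_into_space[OF C[of "\<iota> n \<omega>"]] by (auto simp: space_pair_measure)
    let ?p = "measure M {\<omega> \<in> space M. (\<omega>, ?Y \<omega>) \<in> ?E}"
    let ?q = "measure (M \<Otimes>\<^sub>M M) {\<omega> \<in> space (M \<Otimes>\<^sub>M M). (fst \<omega>, ?Y (snd \<omega>)) \<in> ?E}"
    have p: "ennreal ?p = (\<integral>\<^sup>+\<omega>. emeasure (K \<omega>) (C (\<iota> n \<omega>)) \<partial>M)"
      unfolding emeasure_eq_measure[symmetric]
        regular_cond_law_disintegration(2)[OF prob_space_axioms sub Y K E]
      by (intro nn_integral_cong) (simp only: sec)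
    have q: "ennreal ?q = (\<integral>\<^sup>+\<omega>. emeasure ?\<rho> (C (\<iota> n \<omega>)) \<partial>M)"
      unfolding MM.emeasure_eq_measure[symmetric] decoupled_event(2)[OF E]
      by (intro nn_integral_cong) (simp only: sec)
    have qm: "(\<lambda>\<omega>. emeasure ?\<rho> (C (\<iota> n \<omega>))) \<in> borel_measurable M"
      by (rule measurable_compose[OF \<iota>M]) simp
    have "(\<integral>\<^sup>+\<omega>. ennreal (G n \<omega>) \<partial>M) + ennreal ?q = (\<integral>\<^sup>+\<omega>. ennreal (G n \<omega>) + emeasure ?\<rho> (C (\<iota> n \<omega>)) \<partial>M)"
      unfolding q by (rule nn_integral_add[symmetric]) (use qm in auto)
    also have "\<dots> = ennreal ?p"
      unfolding p
    proof (rule nn_integral_cong)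
      fix \<omega> assume \<omega>: "\<omega> \<in> space M"
      interpret KP: prob_space "K \<omega>" by (rule KP(1)[OF \<omega>])
      have "measure (K \<omega>) (C (\<iota> n \<omega>)) = G n \<omega> + measure ?\<rho> (C (\<iota> n \<omega>))" by (simp add: G_def D_def)
      then show "ennreal (G n \<omega>) + emeasure ?\<rho> (C (\<iota> n \<omega>)) = emeasure (K \<omega>) (C (\<iota> n \<omega>))"
        using G0 by (simp add: KP.emeasure_eq_measure \<rho>.emeasure_eq_measure ennreal_plus)
    qed
    also have "\<dots> \<le> ennreal (d + ?q)" using d[OF E] by (intro ennreal_leI) linarith
    also have "\<dots> \<le> ennreal d + ennreal ?q"
      by (cases "d \<ge> 0") (auto simp: ennreal_plus ennreal_neg intro!: ennreal_leI)
    finally show ?thesis by (simp add: ennreal_add_left_cancel_le add.commute)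
  qed
  have "(\<integral>\<^sup>+\<omega>. total_variation ?N (\<lambda>A. measure (K \<omega>) A - measure ?\<rho> A) \<partial>M) \<le>
      (\<integral>\<^sup>+\<omega>. 2 * (SUP n. ennreal (G n \<omega>)) \<partial>M)"
    using TV SUPG by (intro nn_integral_mono) (meson mult_left_mono order_trans zero_le)
  also have "\<dots> = 2 * (\<integral>\<^sup>+\<omega>. (SUP n. ennreal (G n \<omega>)) \<partial>M)" by (rule nn_integral_cmult) measurable
  also have "(\<integral>\<^sup>+\<omega>. (SUP n. ennreal (G n \<omega>)) \<partial>M) = (SUP n. \<integral>\<^sup>+\<omega>. ennreal (G n \<omega>) \<partial>M)"
    by (rule nn_integral_monotone_convergence_SUP[OF Gmono]) measurable
  also have "2 * \<dots> \<le> 2 * ennreal d" using int_G by (intro mult_left_mono SUP_least) auto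
  finally show ?thesis .
qed

text \<open>For every \<omega> the section of the joint event is a test event for the total
  variation. After integration the two section probabilities become those of the joint and of the
  product law.\<close>

lemma total_variation_integral_lower:
  assumes J: "J \<subseteq> {m<..}"
    and K: "is_regular_cond_law M (generated_field M X {..m}) (\<Pi>\<^sub>M j\<in>J. borel) (\<lambda>\<omega>. \<lambda>j\<in>J. X j \<omega>) K"
    and T: "T \<subseteq> {..m} \<union> J" and B: "B \<in> sets (\<Pi>\<^sub>M k\<in>T. borel)"
  shows "ennreal (measure M ((\<lambda>\<omega>. \<lambda>k\<in>T. X k \<omega>) -` B \<inter> space M) -
      measure (M \<Otimes>\<^sub>M M) ((\<lambda>\<omega>. \<lambda>k\<in>T. decouple m X k \<omega>) -` B \<inter> space (M \<Otimes>\<^sub>M M)))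
    \<le> (\<integral>\<^sup>+\<omega>. total_variation (\<Pi>\<^sub>M j\<in>J. borel)
        (\<lambda>A. measure (K \<omega>) A - measure (joint_law M X J) A) \<partial>M)" (is "_ \<le> ?TV")
proof -
  let ?F = "generated_field M X {..m}" and ?N = "\<Pi>\<^sub>M j\<in>J. (borel :: real measure)"
  let ?Y = "\<lambda>\<omega>. \<lambda>j\<in>J. X j \<omega>" and ?\<rho> = "joint_law M X J"
  interpret MM: prob_space "M \<Otimes>\<^sub>M M" by (rule prob_space_pair)
  have sub: "subalgebra M ?F" by (rule subalgebra_generated_field) simp
  have Y[measurable]: "?Y \<in> measurable M ?N" by (intro measurable_restrict) auto
  have Km: "K \<in> ?F \<rightarrow>\<^sub>M prob_algebra ?N" using K by (simp add: is_regular_cond_law_def)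
  interpret \<rho>: prob_space ?\<rho> unfolding joint_law_def by (rule prob_space_distr[OF Y])
  have sets_\<rho>: "sets ?\<rho> = sets ?N" by (simp add: joint_law_def)
  have hm: "(\<lambda>p. \<lambda>k\<in>T. past_future m X p k) \<in> measurable (?F \<Otimes>\<^sub>M ?N) (\<Pi>\<^sub>M k\<in>T. borel)"
    using past_future_measurable[of _ m J X M] J T by (intro measurable_restrict) auto
  let ?E = "{p \<in> space (?F \<Otimes>\<^sub>M ?N). (\<lambda>k\<in>T. past_future m X p k) \<in> B}"
  have E: "?E \<in> sets (?F \<Otimes>\<^sub>M ?N)" using measurable_sets[OF hm B] by (simp add: vimage_def Int_def conj_commute)
  have Ysp: "?Y \<omega> \<in> space ?N" for \<omega> by (auto simp: space_PiM)
  have pre1: "{\<omega> \<in> space M. (\<omega>, ?Y \<omega>) \<in> ?E} = (\<lambda>\<omega>. \<lambda>k\<in>T. X k \<omega>) -` B \<inter> space M"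
  proof -
    have "(\<lambda>k\<in>T. past_future m X (\<omega>, ?Y \<omega>) k) = (\<lambda>k\<in>T. X k \<omega>)" for \<omega>
      using T by (intro restrict_ext) (auto simp: past_future_def)
    then show ?thesis using Ysp by (auto simp: space_pair_measure)
  qed
  have pre2: "{\<omega> \<in> space (M \<Otimes>\<^sub>M M). (fst \<omega>, ?Y (snd \<omega>)) \<in> ?E} =
      (\<lambda>\<omega>. \<lambda>k\<in>T. decouple m X k \<omega>) -` B \<inter> space (M \<Otimes>\<^sub>M M)"
  proof -
    have "(\<lambda>k\<in>T. past_future m X (fst \<omega>, ?Y (snd \<omega>)) k) = (\<lambda>k\<in>T. decouple m X k \<omega>)" for \<omega>
      using T by (intro restrict_ext) (auto simp: past_future_def decouple_def)
    then show ?thesis using Ysp by (auto simp: space_pair_measure)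
  qed
  let ?p = "measure M ((\<lambda>\<omega>. \<lambda>k\<in>T. X k \<omega>) -` B \<inter> space M)"
  let ?q = "measure (M \<Otimes>\<^sub>M M) ((\<lambda>\<omega>. \<lambda>k\<in>T. decouple m X k \<omega>) -` B \<inter> space (M \<Otimes>\<^sub>M M))"
  have p: "ennreal ?p = (\<integral>\<^sup>+\<omega>. emeasure (K \<omega>) (Pair \<omega> -` ?E) \<partial>M)"
    unfolding pre1[symmetric] emeasure_eq_measure[symmetric]
    by (rule regular_cond_law_disintegration(2)[OF prob_space_axioms sub Y K E])
  have q: "ennreal ?q = (\<integral>\<^sup>+\<omega>. emeasure ?\<rho> (Pair \<omega> -` ?E) \<partial>M)"
    unfolding pre2[symmetric] MM.emeasure_eq_measure[symmetric] by (rule decoupled_event(2)[OF E])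
  \<comment> \<open>\<open>ennreal\<close> cuts negative differences to 0, so adding the
    unconditional probability gives a bound for the conditional one rather than an equality.\<close>
  define v where "v \<omega> = ennreal (measure (K \<omega>) (Pair \<omega> -` ?E) - measure ?\<rho> (Pair \<omega> -` ?E))" for \<omega>
  have Em: "(\<lambda>\<omega>. emeasure (K \<omega>) (Pair \<omega> -` ?E)) \<in> borel_measurable M"
    by (rule measurable_from_subalg[OF sub regular_cond_law_disintegration(1)[OF prob_space_axioms sub Y K E]])
  note \<rho>m = decoupled_event(3)[OF E]
  have vm: "v \<in> borel_measurable M"
    unfolding v_def[abs_def] measure_def using Em \<rho>m by measurable
  have "ennreal ?p \<le> (\<integral>\<^sup>+\<omega>. v \<omega> + emeasure ?\<rho> (Pair \<omega> -` ?E) \<partial>M)"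
    unfolding p
  proof (rule nn_integral_mono)
    fix \<omega> assume \<omega>: "\<omega> \<in> space M"
    interpret KP: prob_space "K \<omega>" using prob_algebra_memberD[OF Km] \<omega> by simp
    have "emeasure (K \<omega>) (Pair \<omega> -` ?E) = ennreal ((measure (K \<omega>) (Pair \<omega> -` ?E) - measure ?\<rho> (Pair \<omega> -` ?E)) + measure ?\<rho> (Pair \<omega> -` ?E))"
      by (simp only: KP.emeasure_eq_measure diff_add_cancel)
    also have "\<dots> \<le> v \<omega> + emeasure ?\<rho> (Pair \<omega> -` ?E)"
      unfolding v_def \<rho>.emeasure_eq_measure
      by (cases "measure (K \<omega>) (Pair \<omega> -` ?E) - measure ?\<rho> (Pair \<omega> -` ?E) \<ge> 0")
        (auto simp: ennreal_plus[symmetric] ennreal_neg simp del: ennreal_plus intro!: ennreal_leI)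
    finally show "emeasure (K \<omega>) (Pair \<omega> -` ?E) \<le> v \<omega> + emeasure ?\<rho> (Pair \<omega> -` ?E)" .
  qed
  also have "\<dots> = (\<integral>\<^sup>+\<omega>. v \<omega> \<partial>M) + ennreal ?q"
    unfolding q by (rule nn_integral_add[OF vm \<rho>m])
  also have "\<dots> \<le> ?TV + ennreal ?q"
    unfolding v_def
  proof (intro add_right_mono nn_integral_mono total_variation_lower)
    fix \<omega> show "Pair \<omega> -` ?E \<in> sets ?N" by (rule sets_Pair1[OF E])
  qed
  finally have "ennreal ?p \<le> ?TV + ennreal ?q" .
  moreover have "a - b \<le> c" if "a \<le> c + b" "a \<noteq> top" for a b c :: ennreal
    using that by (simp add: ennreal_minus_le_iff add.commute)
  ultimately have "ennreal ?p - ennreal ?q \<le> ?TV" using ennreal_neq_top by blast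
  moreover have "ennreal (?p - ?q) = ennreal ?p - ennreal ?q" by (rule ennreal_minus[symmetric]) simp
  ultimately show ?thesis by (simp only:)
qed

end

section \<open>The two inequalities\<close>

lemma (in prob_space)
  fixes a b :: "'a \<Rightarrow> real"
  assumes a: "integrable M a" and b: "integrable M b"
  shows integrable_pair_mult: "integrable (M \<Otimes>\<^sub>M M) (\<lambda>\<omega>. a (fst \<omega>) * b (snd \<omega>))"
    and integral_pair_mult: "(LINT \<omega>|(M \<Otimes>\<^sub>M M). a (fst \<omega>) * b (snd \<omega>)) = expectation a * expectation b"
proof -
  interpret MM: pair_prob_space M M ..
  have [measurable]: "a \<in> borel_measurable M" "b \<in> borel_measurable M" using a b by auto
  show int: "integrable (M \<Otimes>\<^sub>M M) (\<lambda>\<omega>. a (fst \<omega>) * b (snd \<omega>))"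
  proof (rule MM.Fubini_integrable)
    show "integrable M (\<lambda>x. LINT y|M. norm (a (fst (x, y)) * b (snd (x, y))))"
      using a by (simp add: abs_mult)
    show "AE x in M. integrable M (\<lambda>y. a (fst (x, y)) * b (snd (x, y)))" using b by simp
  qed measurable
  show "(LINT \<omega>|(M \<Otimes>\<^sub>M M). a (fst \<omega>) * b (snd \<omega>)) = expectation a * expectation b"
    using MM.integral_fst'[OF int] by simp
qed

section \<open>The quadratic form linking past and future\<close>

context coercive_gaussian
begin

context
  fixes I J :: "int set" and m :: int
  assumes I: "finite I" "I \<subseteq> {..m}" and J: "finite J" "J \<subseteq> {m<..}"
begin

definition cross_form :: "(int \<Rightarrow> real) \<Rightarrow> real" where
  "cross_form x = (\<Sum>i\<in>I. x i * (\<Sum>j\<in>J. \<sigma> i j * x j))"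

definition cross_norm_sq :: real where
  "cross_norm_sq = (\<Sum>i\<in>I. \<Sum>j\<in>J. (\<sigma> i j)\<^sup>2)"

text \<open>The matrix B B^T for the block B of \<sigma> with rows in \<open>I\<close> and columns
  in \<open>J\<close>; its trace is \<open>cross_norm_sq\<close>.\<close>

definition gram :: "int \<Rightarrow> int \<Rightarrow> real" where
  "gram i k = (\<Sum>j\<in>J. \<sigma> k j * \<sigma> i j)"

text \<open>Rows of that block, extended by zero to \<open>I \<union> J\<close>, so that both
  factors of each term of \<open>cross_form\<close> are linear forms over one index set, as
  \<open>lin_Isserlis\<close> requires.\<close>

definition cov_row :: "int \<Rightarrow> int \<Rightarrow> real" where
  "cov_row k j = (if j \<in> J then \<sigma> k j else 0)"

definition unit_vec :: "int \<Rightarrow> int \<Rightarrow> real" where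
  "unit_vec i j = (if j = i then 1 else 0)"

lemma IJ: "finite (I \<union> J)" "I \<inter> J = {}"
proof -
  show "finite (I \<union> J)" using I J by simp
  show "I \<inter> J = {}" using I(2) J(2) by force
qed

lemma lin_row: "lin (I \<union> J) (cov_row k) \<omega> = lin J (\<sigma> k) \<omega>"
proof -
  have "lin (I \<union> J) (cov_row k) \<omega> = lin J (cov_row k) \<omega>"
    using IJ by (intro lin_mono_neutral) (auto simp: cov_row_def)
  then show ?thesis by (simp add: lin_def cov_row_def)
qed

lemma lin_unit: "i \<in> I \<Longrightarrow> lin (I \<union> J) (unit_vec i) \<omega> = X i \<omega>"
  using IJ unfolding lin_def unit_vec_def by (simp add: if_distrib[of "\<lambda>x. x * _"] sum.delta cong: if_cong)

lemma pairing_unit: "i \<in> I \<Longrightarrow> pairing \<sigma> (I \<union> J) (unit_vec i) l = \<sigma> i l"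
  using IJ unfolding pairing_def unit_vec_def by (simp add: if_distrib[of "\<lambda>x. x * _"] sum.delta cong: if_cong)

lemma bil_unit_unit: "i \<in> I \<Longrightarrow> k \<in> I \<Longrightarrow> bil \<sigma> (I \<union> J) (unit_vec i) (unit_vec k) = \<sigma> i k"
  using IJ unfolding bil_eq_pairing
  by (simp add: pairing_unit unit_vec_def[of k] if_distrib[of "\<lambda>x. x * _"] sum.delta cong: if_cong)

lemma bil_unit_row: "i \<in> I \<Longrightarrow> bil \<sigma> (I \<union> J) (unit_vec i) (cov_row k) = gram i k"
proof -
  assume i: "i \<in> I"
  have "bil \<sigma> (I \<union> J) (unit_vec i) (cov_row k) = (\<Sum>l\<in>I \<union> J. cov_row k l * \<sigma> i l)"
    unfolding bil_eq_pairing using i by (simp add: pairing_unit)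
  also have "\<dots> = (\<Sum>l\<in>J. cov_row k l * \<sigma> i l)"
    using IJ by (intro sum.mono_neutral_right) (auto simp: cov_row_def)
  finally show ?thesis by (simp add: cov_row_def gram_def)
qed

lemma bil_row_row: "bil \<sigma> (I \<union> J) (cov_row i) (cov_row k) = bil \<sigma> J (\<sigma> i) (\<sigma> k)"
proof -
  have "bil \<sigma> (I \<union> J) (cov_row i) (cov_row k) = bil \<sigma> J (cov_row i) (cov_row k)"
    using IJ by (intro bil_mono_neutral) (auto simp: cov_row_def)
  then show ?thesis by (simp add: bil_def cov_row_def)
qed

lemma gram_sym: "gram i k = gram k i"
  by (simp add: gram_def mult.commute)

lemma sum_gram_diag: "(\<Sum>i\<in>I. gram i i) = cross_norm_sq"
  by (simp add: gram_def cross_norm_sq_def power2_eq_square)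

text \<open>Column \<open>k\<close> of \<open>gram\<close> is \<sigma> applied to
  \<open>cov_row k\<close>, restricted to \<open>I\<close>. Pairing it with \<open>cov_row k\<close>
  gives its own squared norm t, and Cauchy-Schwarz yields t^2 \<le> (\<Lambda> t) (\<Lambda> s) with
  s the squared norm of the row; one factor t cancels.\<close>

lemma sum_gram_square_le: "(\<Sum>i\<in>I. \<Sum>k\<in>I. gram i k * gram i k) \<le> \<Lambda>\<^sup>2 * cross_norm_sq"
proof -
  have "(\<Sum>i\<in>I. gram i k * gram i k) \<le> \<Lambda>\<^sup>2 * (\<Sum>j\<in>J. (\<sigma> k j)\<^sup>2)" for k
  proof -
    let ?s = "\<Sum>j\<in>J. (\<sigma> k j)\<^sup>2"
    define t where "t = (\<Sum>i\<in>I. gram i k * gram i k)"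
    define a where "a i = (if i \<in> I then gram i k else 0)" for i
    have t0: "0 \<le> t" by (simp add: t_def sum_nonneg)
    have aa: "(\<Sum>i\<in>I \<union> J. (a i)\<^sup>2) = t"
    proof -
      have "(\<Sum>i\<in>I \<union> J. (a i)\<^sup>2) = (\<Sum>i\<in>I. (a i)\<^sup>2)"
        using IJ by (intro sum.mono_neutral_right) (auto simp: a_def)
      then show ?thesis by (simp add: a_def t_def power2_eq_square)
    qed
    have rr: "(\<Sum>i\<in>I \<union> J. (cov_row k i)\<^sup>2) = ?s"
    proof -
      have "(\<Sum>i\<in>I \<union> J. (cov_row k i)\<^sup>2) = (\<Sum>i\<in>J. (cov_row k i)\<^sup>2)"
        using IJ by (intro sum.mono_neutral_right) (auto simp: cov_row_def)
      then show ?thesis by (simp add: cov_row_def)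
    qed
    have "bil \<sigma> (I \<union> J) a (cov_row k) = (\<Sum>i\<in>I \<union> J. a i * (\<Sum>j\<in>I \<union> J. cov_row k j * \<sigma> i j))"
      unfolding bil_def by (simp add: sum_distrib_left mult.assoc)
    also have "\<dots> = (\<Sum>i\<in>I. a i * (\<Sum>j\<in>I \<union> J. cov_row k j * \<sigma> i j))"
      using IJ by (intro sum.mono_neutral_right) (auto simp: a_def)
    also have "\<dots> = (\<Sum>i\<in>I. gram i k * gram i k)"
    proof (rule sum.cong[OF refl])
      fix i assume i: "i \<in> I"
      have "(\<Sum>j\<in>I \<union> J. cov_row k j * \<sigma> i j) = (\<Sum>j\<in>J. cov_row k j * \<sigma> i j)"
        using IJ by (intro sum.mono_neutral_right) (auto simp: cov_row_def)
      then show "a i * (\<Sum>j\<in>I \<union> J. cov_row k j * \<sigma> i j) = gram i k * gram i k"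
        using i by (simp add: a_def gram_def cov_row_def)
    qed
    finally have "t\<^sup>2 = (bil \<sigma> (I \<union> J) a (cov_row k))\<^sup>2" by (simp add: t_def)
    also have "\<dots> \<le> bil \<sigma> (I \<union> J) a a * bil \<sigma> (I \<union> J) (cov_row k) (cov_row k)"
      using sym psd[OF IJ(1)] by (intro bil_Cauchy_Schwarz) auto
    also have "\<dots> \<le> (\<Lambda> * t) * (\<Lambda> * ?s)"
      using upper[OF IJ(1), of a] upper[OF IJ(1), of "cov_row k"] psd[OF IJ(1)] t0 \<Lambda>_pos
      unfolding aa rr by (intro mult_mono) auto
    finally have le: "t * t \<le> t * (\<Lambda>\<^sup>2 * ?s)" by (simp add: power2_eq_square algebra_simps)
    have "t \<le> \<Lambda>\<^sup>2 * ?s"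
    proof (cases "t = 0")
      case False
      then have "t > 0" using t0 by simp
      with le show ?thesis by (rule mult_left_le_imp_le)
    qed (simp add: sum_nonneg)
    then show ?thesis by (simp add: t_def)
  qed
  then have "(\<Sum>k\<in>I. \<Sum>i\<in>I. gram i k * gram i k) \<le> (\<Sum>k\<in>I. \<Lambda>\<^sup>2 * (\<Sum>j\<in>J. (\<sigma> k j)\<^sup>2))"
    by (intro sum_mono)
  then show ?thesis by (subst sum.swap) (simp add: cross_norm_sq_def sum_distrib_left)
qed

text \<open>The sum is the mean of the form on \<open>I\<close> at the random vector with entries
  \<open>lin J (\<sigma> i)\<close>. So \<Lambda> enters twice: pointwise on \<open>I\<close>, then
  for the variances on \<open>J\<close>.\<close>

lemma sum_cov_bil_le: "(\<Sum>i\<in>I. \<Sum>k\<in>I. \<sigma> i k * bil \<sigma> J (\<sigma> i) (\<sigma> k)) \<le> \<Lambda>\<^sup>2 * cross_norm_sq"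
proof -
  have int: "integrable M (\<lambda>\<omega>. lin J (\<sigma> i) \<omega> * lin J (\<sigma> k) \<omega>)" for i k
    by (intro integrable_mult_of_squares integrable_lin_power J) auto
  have "(\<Sum>i\<in>I. \<Sum>k\<in>I. \<sigma> i k * bil \<sigma> J (\<sigma> i) (\<sigma> k)) =
      expectation (\<lambda>\<omega>. \<Sum>i\<in>I. \<Sum>k\<in>I. \<sigma> i k * (lin J (\<sigma> i) \<omega> * lin J (\<sigma> k) \<omega>))"
    using int by (simp add: expectation_lin_mult)
  also have "\<dots> \<le> expectation (\<lambda>\<omega>. \<Sum>i\<in>I. \<Lambda> * (lin J (\<sigma> i) \<omega>)\<^sup>2)"
  proof (rule integral_mono)
    show "integrable M (\<lambda>\<omega>. \<Sum>i\<in>I. \<Sum>k\<in>I. \<sigma> i k * (lin J (\<sigma> i) \<omega> * lin J (\<sigma> k) \<omega>))" using int by simp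
    show "integrable M (\<lambda>\<omega>. \<Sum>i\<in>I. \<Lambda> * (lin J (\<sigma> i) \<omega>)\<^sup>2)"
      using J by (intro Bochner_Integration.integrable_sum integrable_mult_right integrable_lin_power)
    fix \<omega>
    have "(\<Sum>i\<in>I. \<Sum>k\<in>I. \<sigma> i k * (lin J (\<sigma> i) \<omega> * lin J (\<sigma> k) \<omega>)) =
        bil \<sigma> I (\<lambda>i. lin J (\<sigma> i) \<omega>) (\<lambda>i. lin J (\<sigma> i) \<omega>)"
      by (simp add: bil_def mult.commute)
    also have "\<dots> \<le> \<Lambda> * (\<Sum>i\<in>I. (lin J (\<sigma> i) \<omega>)\<^sup>2)" by (rule upper[OF I(1)])
    finally show "(\<Sum>i\<in>I. \<Sum>k\<in>I. \<sigma> i k * (lin J (\<sigma> i) \<omega> * lin J (\<sigma> k) \<omega>)) \<le> (\<Sum>i\<in>I. \<Lambda> * (lin J (\<sigma> i) \<omega>)\<^sup>2)"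
      by (simp add: sum_distrib_left)
  qed
  also have "\<dots> = (\<Sum>i\<in>I. \<Lambda> * bil \<sigma> J (\<sigma> i) (\<sigma> i))"
    using integrable_lin_power[OF J(1), where k = 2] by (simp add: expectation_lin_square)
  also have "\<dots> \<le> (\<Sum>i\<in>I. \<Lambda> * (\<Lambda> * (\<Sum>j\<in>J. (\<sigma> i j)\<^sup>2)))"
    using \<Lambda>_pos J by (intro sum_mono mult_left_mono upper) auto
  finally show ?thesis by (simp add: cross_norm_sq_def sum_distrib_left power2_eq_square mult.assoc)
qed

lemma cross_form_X: "cross_form (\<lambda>k\<in>I \<union> J. X k \<omega>) = (\<Sum>i\<in>I. X i \<omega> * lin J (\<sigma> i) \<omega>)"
  by (simp add: cross_form_def lin_def)

lemma cross_form_decouple: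
  "cross_form (\<lambda>k\<in>I \<union> J. decouple m X k \<omega>) = (\<Sum>i\<in>I. X i (fst \<omega>) * lin J (\<sigma> i) (snd \<omega>))"
proof -
  have "decouple m X i \<omega> = X i (fst \<omega>)" if "i \<in> I" for i using that I by (auto simp: decouple_def)
  moreover have "decouple m X j \<omega> = X j (snd \<omega>)" if "j \<in> J" for j using that J by (auto simp: decouple_def)
  ultimately show ?thesis by (simp add: cross_form_def lin_def)
qed

lemma integrable_X_lin: "integrable M (\<lambda>\<omega>. X i \<omega> * lin J (\<sigma> k) \<omega>)"
  by (intro integrable_mult_of_squares integrable_lin_power integrable_X_power J) auto

text \<open>In the second moment, the three pairings of Isserlis' formula contribute the squared
  mean, the sum of \<open>sum_cov_bil_le\<close> and that of \<open>sum_gram_square_le\<close>; the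
  last two are at most \<Lambda>^2 \<open>cross_norm_sq\<close> each.\<close>

lemma cross_form_joint_moments:
  shows "integrable M (\<lambda>\<omega>. cross_form (\<lambda>k\<in>I \<union> J. X k \<omega>))"
    and "expectation (\<lambda>\<omega>. cross_form (\<lambda>k\<in>I \<union> J. X k \<omega>)) = cross_norm_sq"
    and "integrable M (\<lambda>\<omega>. (cross_form (\<lambda>k\<in>I \<union> J. X k \<omega>))\<^sup>2)"
    and "expectation (\<lambda>\<omega>. (cross_form (\<lambda>k\<in>I \<union> J. X k \<omega>))\<^sup>2) \<le> cross_norm_sq\<^sup>2 + 2 * \<Lambda>\<^sup>2 * cross_norm_sq"
proof -
  show "integrable M (\<lambda>\<omega>. cross_form (\<lambda>k\<in>I \<union> J. X k \<omega>))"
    unfolding cross_form_X using integrable_X_lin by simp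
  have "expectation (\<lambda>\<omega>. X i \<omega> * lin J (\<sigma> i) \<omega>) = gram i i" if "i \<in> I" for i
    using expectation_lin_mult[of "I \<union> J" "unit_vec i" "cov_row i"] that by (simp add: lin_unit lin_row bil_unit_row)
  then show "expectation (\<lambda>\<omega>. cross_form (\<lambda>k\<in>I \<union> J. X k \<omega>)) = cross_norm_sq"
    unfolding cross_form_X using integrable_X_lin sum_gram_diag by simp
  have sq: "(cross_form (\<lambda>k\<in>I \<union> J. X k \<omega>))\<^sup>2 = (\<Sum>i\<in>I. \<Sum>k\<in>I.
      lin (I \<union> J) (unit_vec i) \<omega> * lin (I \<union> J) (cov_row i) \<omega> * lin (I \<union> J) (unit_vec k) \<omega> * lin (I \<union> J) (cov_row k) \<omega>)" for \<omega>
    unfolding cross_form_X power2_eq_square sum_product by (simp add: lin_unit lin_row mult.assoc)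
  note int4 = integrable_lin_mult4[OF IJ(1)]
  show "integrable M (\<lambda>\<omega>. (cross_form (\<lambda>k\<in>I \<union> J. X k \<omega>))\<^sup>2)"
    unfolding sq by (intro Bochner_Integration.integrable_sum int4)
  have "expectation (\<lambda>\<omega>. (cross_form (\<lambda>k\<in>I \<union> J. X k \<omega>))\<^sup>2) = (\<Sum>i\<in>I. \<Sum>k\<in>I.
      gram i i * gram k k + \<sigma> i k * bil \<sigma> J (\<sigma> i) (\<sigma> k) + gram i k * gram i k)"
    unfolding sq
  proof (subst Bochner_Integration.integral_sum, intro Bochner_Integration.integrable_sum int4,
      intro sum.cong refl, subst Bochner_Integration.integral_sum, intro int4, intro sum.cong refl)
    fix i k assume ik: "i \<in> I" "k \<in> I"
    have "bil \<sigma> (I \<union> J) (cov_row i) (unit_vec k) = gram i k"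
      using bil_commute[of \<sigma> "I \<union> J" "cov_row i" "unit_vec k"] sym bil_unit_row[OF ik(2), of i] gram_sym by simp
    then show "expectation (\<lambda>\<omega>. lin (I \<union> J) (unit_vec i) \<omega> * lin (I \<union> J) (cov_row i) \<omega> * lin (I \<union> J) (unit_vec k) \<omega> * lin (I \<union> J) (cov_row k) \<omega>)
        = gram i i * gram k k + \<sigma> i k * bil \<sigma> J (\<sigma> i) (\<sigma> k) + gram i k * gram i k"
      unfolding lin_Isserlis[OF IJ(1)] using ik by (simp add: bil_unit_row bil_unit_unit bil_row_row)
  qed
  also have "\<dots> = (\<Sum>i\<in>I. gram i i) * (\<Sum>k\<in>I. gram k k) + (\<Sum>i\<in>I. \<Sum>k\<in>I. \<sigma> i k * bil \<sigma> J (\<sigma> i) (\<sigma> k))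
      + (\<Sum>i\<in>I. \<Sum>k\<in>I. gram i k * gram i k)"
    by (simp add: sum.distrib sum_product)
  also have "\<dots> \<le> cross_norm_sq\<^sup>2 + 2 * \<Lambda>\<^sup>2 * cross_norm_sq"
    using sum_cov_bil_le sum_gram_square_le by (simp add: sum_gram_diag power2_eq_square)
  finally show "expectation (\<lambda>\<omega>. (cross_form (\<lambda>k\<in>I \<union> J. X k \<omega>))\<^sup>2) \<le> cross_norm_sq\<^sup>2 + 2 * \<Lambda>\<^sup>2 * cross_norm_sq" .
qed

text \<open>Under the product law each product factors into past and future moments, so the mean
  vanishes and only the pairing of \<open>sum_cov_bil_le\<close> remains.\<close>

lemma cross_form_decouple_moments:
  shows "integrable (M \<Otimes>\<^sub>M M) (\<lambda>\<omega>. cross_form (\<lambda>k\<in>I \<union> J. decouple m X k \<omega>))"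
    and "(LINT \<omega>|(M \<Otimes>\<^sub>M M). cross_form (\<lambda>k\<in>I \<union> J. decouple m X k \<omega>)) = 0"
    and "integrable (M \<Otimes>\<^sub>M M) (\<lambda>\<omega>. (cross_form (\<lambda>k\<in>I \<union> J. decouple m X k \<omega>))\<^sup>2)"
    and "(LINT \<omega>|(M \<Otimes>\<^sub>M M). (cross_form (\<lambda>k\<in>I \<union> J. decouple m X k \<omega>))\<^sup>2) \<le> \<Lambda>\<^sup>2 * cross_norm_sq"
proof -
  have intl: "integrable M (lin J (\<sigma> i))" for i using integrable_lin_power[OF J(1), of "\<sigma> i" 1] by simp
  have int1: "integrable (M \<Otimes>\<^sub>M M) (\<lambda>\<omega>. X i (fst \<omega>) * lin J (\<sigma> i) (snd \<omega>))" for i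
    by (rule integrable_pair_mult[OF integrable_X intl])
  show "integrable (M \<Otimes>\<^sub>M M) (\<lambda>\<omega>. cross_form (\<lambda>k\<in>I \<union> J. decouple m X k \<omega>))"
    unfolding cross_form_decouple using int1 by simp
  have "(LINT \<omega>|(M \<Otimes>\<^sub>M M). X i (fst \<omega>) * lin J (\<sigma> i) (snd \<omega>)) = 0" for i
    using integral_pair_mult[OF integrable_X[of i] intl[of i]] by (simp add: mean)
  then show "(LINT \<omega>|(M \<Otimes>\<^sub>M M). cross_form (\<lambda>k\<in>I \<union> J. decouple m X k \<omega>)) = 0"
    unfolding cross_form_decouple using int1 by simp
  have sq: "(cross_form (\<lambda>k\<in>I \<union> J. decouple m X k \<omega>))\<^sup>2 = (\<Sum>i\<in>I. \<Sum>k\<in>I.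
      (X i (fst \<omega>) * X k (fst \<omega>)) * (lin J (\<sigma> i) (snd \<omega>) * lin J (\<sigma> k) (snd \<omega>)))" for \<omega>
    unfolding cross_form_decouple power2_eq_square sum_product by (simp add: mult.assoc mult.left_commute)
  have intll: "integrable M (\<lambda>\<omega>. lin J (\<sigma> i) \<omega> * lin J (\<sigma> k) \<omega>)" for i k
    by (intro integrable_mult_of_squares integrable_lin_power J) auto
  note int2 = integrable_pair_mult[OF integrable_X_mult intll]
  show "integrable (M \<Otimes>\<^sub>M M) (\<lambda>\<omega>. (cross_form (\<lambda>k\<in>I \<union> J. decouple m X k \<omega>))\<^sup>2)"
    unfolding sq by (intro Bochner_Integration.integrable_sum int2)
  have "(LINT \<omega>|(M \<Otimes>\<^sub>M M). (cross_form (\<lambda>k\<in>I \<union> J. decouple m X k \<omega>))\<^sup>2) =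
      (\<Sum>i\<in>I. \<Sum>k\<in>I. \<sigma> i k * bil \<sigma> J (\<sigma> i) (\<sigma> k))"
    unfolding sq
  proof (subst Bochner_Integration.integral_sum, intro Bochner_Integration.integrable_sum int2,
      intro sum.cong refl, subst Bochner_Integration.integral_sum, intro int2, intro sum.cong refl)
    fix i k
    show "(LINT \<omega>|(M \<Otimes>\<^sub>M M). (X i (fst \<omega>) * X k (fst \<omega>)) * (lin J (\<sigma> i) (snd \<omega>) * lin J (\<sigma> k) (snd \<omega>))) =
        \<sigma> i k * bil \<sigma> J (\<sigma> i) (\<sigma> k)"
      unfolding integral_pair_mult[OF integrable_X_mult intll] by (simp add: cov[symmetric] expectation_lin_mult)
  qed
  then show "(LINT \<omega>|(M \<Otimes>\<^sub>M M). (cross_form (\<lambda>k\<in>I \<union> J. decouple m X k \<omega>))\<^sup>2) \<le> \<Lambda>\<^sup>2 * cross_norm_sq"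
    using sum_cov_bil_le by simp
qed

text \<open>Integrating the quadratic form \<open>cross_form\<close> against the difference of the two laws yields the
  squared Hilbert--Schmidt norm \<open>cross_norm_sq\<close>; its second moments allow truncation at height \<open>2 * (cross_norm_sq + 3 * \<Lambda>\<^sup>2)\<close>.\<close>

lemma cross_norm_sq_le_total_variation:
  assumes b: "0 \<le> b" "b \<le> 1 / 16"
    and diff: "\<And>B. B \<in> sets (\<Pi>\<^sub>M k\<in>I \<union> J. borel) \<Longrightarrow>
      measure M ((\<lambda>\<omega>. \<lambda>k\<in>I \<union> J. X k \<omega>) -` B \<inter> space M) -
      measure (M \<Otimes>\<^sub>M M) ((\<lambda>\<omega>. \<lambda>k\<in>I \<union> J. decouple m X k \<omega>) -` B \<inter> space (M \<Otimes>\<^sub>M M)) \<le> b"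
  shows "cross_norm_sq \<le> 48 * \<Lambda>\<^sup>2 * b"
proof -
  interpret MM: prob_space "M \<Otimes>\<^sub>M M" by (rule prob_space_pair)
  interpret bl: covariance_form "block m \<sigma>" \<mu> \<Lambda> by (rule covariance_form_block)
  let ?T = "I \<union> J"
  let ?L = "\<Pi>\<^sub>M k\<in>?T. (lborel :: real measure)" and ?N = "\<Pi>\<^sub>M k\<in>?T. (borel :: real measure)"
  let ?X = "\<lambda>\<omega>. \<lambda>k\<in>?T. X k \<omega>" and ?X' = "\<lambda>\<omega>. \<lambda>k\<in>?T. decouple m X k \<omega>"
  have T: "finite ?T" by (rule IJ(1))
  have "\<forall>k. \<exists>v. innovation \<sigma> ?T k v" using exists_innovation[OF T] by blast
  then obtain e where e: "\<And>k. innovation \<sigma> ?T k (e k)" by metis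
  have "\<forall>k. \<exists>v. innovation (block m \<sigma>) ?T k v" using bl.exists_innovation[OF T] by blast
  then obtain e' where e': "\<And>k. innovation (block m \<sigma>) ?T k (e' k)" by metis
  define f where "f = innovation_density e (\<lambda>k. sqrt (bil \<sigma> ?T (e k) (e k))) ?T"
  define g where "g = innovation_density e' (\<lambda>k. sqrt (bil (block m \<sigma>) ?T (e' k) (e' k))) ?T"
  have P: "distr M ?N ?X = density ?L (\<lambda>y. ennreal (f y))" unfolding f_def by (rule joint_density[OF T e])
  have Q: "distr (M \<Otimes>\<^sub>M M) ?N ?X' = density ?L (\<lambda>y. ennreal (g y))" unfolding g_def by (rule decouple_density[OF T e'])
  have fg0: "0 \<le> f y" "0 \<le> g y" for y by (simp_all add: f_def g_def innovation_density_nonneg)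
  have fm[measurable]: "f \<in> borel_measurable ?L" "g \<in> borel_measurable ?L" by (simp_all add: f_def g_def)
  have Xm[measurable]: "?X \<in> measurable M ?N" and X'm[measurable]: "?X' \<in> measurable (M \<Otimes>\<^sub>M M) ?N"
    by (auto intro!: measurable_restrict)
  have sets_eq: "sets ?L = sets ?N" by (intro sets_PiM_cong) auto
  have meas_eq: "h \<in> borel_measurable ?L \<longleftrightarrow> h \<in> borel_measurable ?N" for h :: "(int \<Rightarrow> real) \<Rightarrow> real"
    by (rule arg_cong[where f = "\<lambda>S. h \<in> S"]) (intro measurable_cong_sets sets_eq refl)
  have transP: "integrable ?L (\<lambda>y. f y * h y)" "(LINT y|?L. f y * h y) = expectation (\<lambda>\<omega>. h (?X \<omega>))"
    if h: "h \<in> borel_measurable ?N" and i: "integrable M (\<lambda>\<omega>. h (?X \<omega>))" for h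
  proof -
    have hL: "h \<in> borel_measurable ?L" using h meas_eq by simp
    have "integrable (distr M ?N ?X) h" using i h by (simp add: integrable_distr_eq)
    then show "integrable ?L (\<lambda>y. f y * h y)"
      unfolding P using hL fm fg0 by (simp add: integrable_density)
    have "expectation (\<lambda>\<omega>. h (?X \<omega>)) = (LINT y|distr M ?N ?X. h y)" using h by (simp add: integral_distr)
    then show "(LINT y|?L. f y * h y) = expectation (\<lambda>\<omega>. h (?X \<omega>))"
      unfolding P using hL fm fg0 by (simp add: integral_density)
  qed
  have transQ: "integrable ?L (\<lambda>y. g y * h y)" "(LINT y|?L. g y * h y) = (LINT \<omega>|(M \<Otimes>\<^sub>M M). h (?X' \<omega>))"
    if h: "h \<in> borel_measurable ?N" and i: "integrable (M \<Otimes>\<^sub>M M) (\<lambda>\<omega>. h (?X' \<omega>))" for h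
  proof -
    have hL: "h \<in> borel_measurable ?L" using h meas_eq by simp
    have "integrable (distr (M \<Otimes>\<^sub>M M) ?N ?X') h" using i h by (simp add: integrable_distr_eq)
    then show "integrable ?L (\<lambda>y. g y * h y)"
      unfolding Q using hL fm fg0 by (simp add: integrable_density)
    have "(LINT \<omega>|(M \<Otimes>\<^sub>M M). h (?X' \<omega>)) = (LINT y|distr (M \<Otimes>\<^sub>M M) ?N ?X'. h y)" using h by (simp add: integral_distr)
    then show "(LINT y|?L. g y * h y) = (LINT \<omega>|(M \<Otimes>\<^sub>M M). h (?X' \<omega>))"
      unfolding Q using hL fm fg0 by (simp add: integral_density)
  qed
  have Wm: "cross_form \<in> borel_measurable ?N"
    unfolding cross_form_def[abs_def] by measurable
  have W2m: "(\<lambda>y. (cross_form y)\<^sup>2) \<in> borel_measurable ?N" using Wm by measurable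
  note WP = transP[OF Wm cross_form_joint_moments(1)] and W2P = transP[OF W2m cross_form_joint_moments(3)]
  note WQ = transQ[OF Wm cross_form_decouple_moments(1)] and W2Q = transQ[OF W2m cross_form_decouple_moments(3)]
  have one: "(\<lambda>y. 1 :: real) \<in> borel_measurable ?N" by simp
  have f1: "integrable ?L f" "(LINT y|?L. f y) = 1" using transP[OF one] prob_space by simp_all
  have g1: "integrable ?L g" "(LINT y|?L. g y) = 1" using transQ[OF one] MM.prob_space by simp_all
  have TV: "(LINT y|?L. \<bar>f y - g y\<bar>) \<le> 2 * b"
  proof -
    \<comment> \<open>The event where the excess of the joint over the product law is largest. Both
      densities have mass 1, so the integral of |f - g| is twice this excess.\<close>
    let ?B = "{y \<in> space ?L. g y < f y}"
    have BL: "?B \<in> sets ?L" by measurable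
    then have B: "?B \<in> sets ?N" by (simp add: sets_eq)
    have iB: "(indicator ?B :: _ \<Rightarrow> real) \<in> borel_measurable ?N" using B by simp
    have intP: "integrable M (\<lambda>\<omega>. indicator ?B (?X \<omega>) :: real)"
      using iB by (intro integrable_const_bound[of _ 1]) (auto intro: measurable_compose[OF Xm])
    have intQ: "integrable (M \<Otimes>\<^sub>M M) (\<lambda>\<omega>. indicator ?B (?X' \<omega>) :: real)"
      using iB by (intro MM.integrable_const_bound[of _ 1]) (auto intro: measurable_compose[OF X'm])
    have eP: "expectation (\<lambda>\<omega>. indicat_real ?B (?X \<omega>)) = measure M (?X -` ?B \<inter> space M)"
    proof -
      have "expectation (\<lambda>\<omega>. indicat_real ?B (?X \<omega>)) = (LINT y|distr M ?N ?X. indicator ?B y)"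
        by (rule integral_distr[OF Xm iB, symmetric])
      also have "\<dots> = measure (distr M ?N ?X) ?B" using B by simp
      finally show ?thesis by (simp only: measure_distr[OF Xm B])
    qed
    have eQ: "(LINT \<omega>|(M \<Otimes>\<^sub>M M). indicat_real ?B (?X' \<omega>)) = measure (M \<Otimes>\<^sub>M M) (?X' -` ?B \<inter> space (M \<Otimes>\<^sub>M M))"
    proof -
      have "(LINT \<omega>|(M \<Otimes>\<^sub>M M). indicat_real ?B (?X' \<omega>)) = (LINT y|distr (M \<Otimes>\<^sub>M M) ?N ?X'. indicator ?B y)"
        by (rule integral_distr[OF X'm iB, symmetric])
      also have "\<dots> = measure (distr (M \<Otimes>\<^sub>M M) ?N ?X') ?B" using B by simp
      finally show ?thesis by (simp only: measure_distr[OF X'm B])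
    qed
    note BP = transP[OF iB intP] and BQ = transQ[OF iB intQ]
    have "(LINT y|?L. \<bar>f y - g y\<bar>) = (LINT y|?L. 2 * (f y * indicator ?B y - g y * indicator ?B y) - (f y - g y))"
      by (intro Bochner_Integration.integral_cong refl) (auto simp: indicator_def)
    also have "\<dots> = 2 * ((LINT y|?L. f y * indicator ?B y) - (LINT y|?L. g y * indicator ?B y)) - (1 - 1)"
      using f1 g1 BP(1) BQ(1) by simp
    also have "\<dots> \<le> 2 * b" using diff[OF B] unfolding BP(2) BQ(2) eP eQ by simp
    finally show ?thesis .
  qed
  have cross_norm_sq_nonneg: "0 \<le> cross_norm_sq" by (simp add: cross_norm_sq_def sum_nonneg)
  \<comment> \<open>With h = \<open>cross_norm_sq\<close>, the second moments add up to at most h (h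
    + 3 \<Lambda>^2), so dividing by \<open>K\<close> leaves h / 2, which can be absorbed.\<close>
  define K where "K = 2 * (cross_norm_sq + 3 * \<Lambda>\<^sup>2)"
  have K: "K > 0" using cross_norm_sq_nonneg \<Lambda>_pos by (simp add: K_def add_nonneg_pos)
  \<comment> \<open>Truncation by cases: either |w| \<le> K, or |w| \<le> w^2 / K.\<close>
  have point: "w * (x - y) \<le> K * \<bar>x - y\<bar> + (x * w\<^sup>2 + y * w\<^sup>2) / K" if "0 \<le> x" "0 \<le> y" for w x y :: real
  proof (cases "\<bar>w\<bar> \<le> K")
    case True
    have "w * (x - y) \<le> \<bar>w\<bar> * \<bar>x - y\<bar>" by (metis abs_ge_self abs_mult)
    also have "\<dots> \<le> K * \<bar>x - y\<bar>" using True by (intro mult_right_mono) auto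
    finally show ?thesis using that K by (smt (verit) divide_nonneg_pos mult_nonneg_nonneg zero_le_power2)
  next
    case False
    have "\<bar>w\<bar> * K \<le> \<bar>w\<bar> * \<bar>w\<bar>" using False by (intro mult_left_mono) auto
    then have w: "\<bar>w\<bar> \<le> w\<^sup>2 / K" using K by (simp add: field_simps power2_eq_square)
    have "w * (x - y) \<le> \<bar>w\<bar> * \<bar>x - y\<bar>" by (metis abs_ge_self abs_mult)
    also have "\<dots> \<le> \<bar>w\<bar> * (x + y)" using that by (intro mult_left_mono) auto
    also have "\<dots> \<le> (w\<^sup>2 / K) * (x + y)" using w that by (intro mult_right_mono) auto
    also have "\<dots> = (x * w\<^sup>2 + y * w\<^sup>2) / K" by (simp add: algebra_simps add_divide_distrib)
    finally show ?thesis using K by (smt (verit) mult_nonneg_nonneg abs_ge_zero)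
  qed
  have "cross_norm_sq = (LINT y|?L. f y * cross_form y) - (LINT y|?L. g y * cross_form y)"
    unfolding WP(2) WQ(2) cross_form_joint_moments(2) cross_form_decouple_moments(2) by simp
  also have "\<dots> = (LINT y|?L. cross_form y * (f y - g y))"
    using WP(1) WQ(1) by (subst Bochner_Integration.integral_diff[symmetric]) (auto simp: algebra_simps)
  also have "\<dots> \<le> (LINT y|?L. K * \<bar>f y - g y\<bar> + (f y * (cross_form y)\<^sup>2 + g y * (cross_form y)\<^sup>2) / K)"
  proof (rule integral_mono)
    show "integrable ?L (\<lambda>y. cross_form y * (f y - g y))"
      using Bochner_Integration.integrable_diff[OF WP(1) WQ(1)] by (simp add: algebra_simps)
    show "integrable ?L (\<lambda>y. K * \<bar>f y - g y\<bar> + (f y * (cross_form y)\<^sup>2 + g y * (cross_form y)\<^sup>2) / K)"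
      using f1(1) g1(1) W2P(1) W2Q(1) by simp
  qed (use point fg0 in auto)
  also have "\<dots> = K * (LINT y|?L. \<bar>f y - g y\<bar>) +
      ((LINT y|?L. f y * (cross_form y)\<^sup>2) + (LINT y|?L. g y * (cross_form y)\<^sup>2)) / K"
    using f1(1) g1(1) W2P(1) W2Q(1) by simp
  also have "\<dots> \<le> K * (2 * b) + ((cross_norm_sq\<^sup>2 + 2 * \<Lambda>\<^sup>2 * cross_norm_sq) + \<Lambda>\<^sup>2 * cross_norm_sq) / K"
    unfolding W2P(2) W2Q(2) using K TV cross_form_joint_moments(4) cross_form_decouple_moments(4)
    by (intro add_mono mult_left_mono divide_right_mono) auto
  also have "((cross_norm_sq\<^sup>2 + 2 * \<Lambda>\<^sup>2 * cross_norm_sq) + \<Lambda>\<^sup>2 * cross_norm_sq) / K = cross_norm_sq / 2"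
    using K by (simp add: K_def field_simps power2_eq_square)
  \<comment> \<open>Since \<open>b\<close> is at most 1/16, the first term on the right is at most a
    quarter of \<open>cross_norm_sq\<close>; what remains is a quarter of it below 12 \<Lambda>^2 b,
    whence the constant 48.\<close>
  finally have "cross_norm_sq / 2 \<le> 4 * (b * cross_norm_sq) + 12 * \<Lambda>\<^sup>2 * b" by (simp add: K_def algebra_simps)
  moreover have "b * cross_norm_sq \<le> 1 / 16 * cross_norm_sq" using b cross_norm_sq_nonneg by (intro mult_right_mono) auto
  ultimately show ?thesis by linarith
qed

end

end

section \<open>From finite blocks to the limit in p\<close>

lemma tendsto_0_ennreal_iff:
  fixes f :: "'a \<Rightarrow> ennreal"
  shows "(f \<longlongrightarrow> 0) F \<longleftrightarrow> (\<forall>\<epsilon>::real. \<epsilon> > 0 \<longrightarrow> (\<forall>\<^sub>F x in F. f x \<le> ennreal \<epsilon>))"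
proof
  assume f: "(f \<longlongrightarrow> 0) F"
  show "\<forall>\<epsilon>::real. \<epsilon> > 0 \<longrightarrow> (\<forall>\<^sub>F x in F. f x \<le> ennreal \<epsilon>)"
  proof (intro allI impI)
    fix \<epsilon> :: real assume "\<epsilon> > 0"
    then have "\<forall>\<^sub>F x in F. f x < ennreal \<epsilon>" by (intro order_tendstoD(2)[OF f]) simp
    then show "\<forall>\<^sub>F x in F. f x \<le> ennreal \<epsilon>" by eventually_elim simp
  qed
next
  assume f: "\<forall>\<epsilon>::real. \<epsilon> > 0 \<longrightarrow> (\<forall>\<^sub>F x in F. f x \<le> ennreal \<epsilon>)"
  show "(f \<longlongrightarrow> 0) F"
  proof (rule order_tendstoI)
    fix a :: ennreal assume "0 < a"
    then obtain y where y: "0 < y" "y < a" using dense by blast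
    then obtain r where r: "y = ennreal r" "0 \<le> r" by (cases y) auto
    have "r > 0" using y(1) r by simp
    then have "\<forall>\<^sub>F x in F. f x \<le> ennreal r" using f by blast
    then show "\<forall>\<^sub>F x in F. f x < a" by eventually_elim (use y r in auto)
  qed auto
qed

lemma infsum_ennreal_sum:
  fixes f :: "'i \<Rightarrow> 'j \<Rightarrow> ennreal"
  assumes "finite I"
  shows "(\<Sum>i\<in>I. infsum (f i) A) = infsum (\<lambda>j. \<Sum>i\<in>I. f i j) A"
  using assms
proof (induction I rule: finite_induct)
  case (insert i I)
  have "(f i) summable_on A" "(\<lambda>j. \<Sum>i\<in>I. f i j) summable_on A"
    by (rule nonneg_summable_on_complete, simp)+
  then show ?case using insert by (simp add: infsum_add)
qed simp

text \<open>Sums of nonnegative extended reals are suprema of their finite partial sums. Both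
  estimates concern finite index sets and reach the double series through this equivalence.\<close>

lemma double_infsum_le_iff:
  fixes f :: "'i \<Rightarrow> 'j \<Rightarrow> real"
  assumes f: "\<And>i j. 0 \<le> f i j" and c: "0 \<le> c"
  shows "(\<Sum>\<^sub>\<infinity>i\<in>A. \<Sum>\<^sub>\<infinity>j\<in>B. ennreal (f i j)) \<le> ennreal c \<longleftrightarrow>
    (\<forall>I J. finite I \<longrightarrow> finite J \<longrightarrow> I \<subseteq> A \<longrightarrow> J \<subseteq> B \<longrightarrow> (\<Sum>i\<in>I. \<Sum>j\<in>J. f i j) \<le> c)"
    (is "?S \<le> _ \<longleftrightarrow> ?R")
proof
  assume S: "?S \<le> ennreal c"
  have upper: "sum g F \<le> infsum g D" if "finite F" "F \<subseteq> D" for g :: "'x \<Rightarrow> ennreal" and F D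
    using that by (subst nonneg_infsum_complete) (auto intro!: SUP_upper)
  show ?R
  proof (intro allI impI)
    fix I J assume IJ: "finite I" "finite J" "I \<subseteq> A" "J \<subseteq> B"
    have "ennreal (\<Sum>i\<in>I. \<Sum>j\<in>J. f i j) = (\<Sum>i\<in>I. \<Sum>j\<in>J. ennreal (f i j))"
      using f by (simp add: sum_nonneg)
    also have "\<dots> \<le> (\<Sum>i\<in>I. \<Sum>\<^sub>\<infinity>j\<in>B. ennreal (f i j))" using IJ by (intro sum_mono upper)
    also have "\<dots> \<le> ?S" using IJ by (intro upper)
    finally show "(\<Sum>i\<in>I. \<Sum>j\<in>J. f i j) \<le> c" using S c by (auto simp: ennreal_le_iff dest: order_trans)
  qed
next
  assume R: ?R
  show "?S \<le> ennreal c"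
  proof (rule infsum_le_finite_sums)
    fix I assume I: "finite I" "I \<subseteq> A"
    have "(\<Sum>i\<in>I. \<Sum>\<^sub>\<infinity>j\<in>B. ennreal (f i j)) = (\<Sum>\<^sub>\<infinity>j\<in>B. \<Sum>i\<in>I. ennreal (f i j))"
      by (rule infsum_ennreal_sum[OF I(1)])
    also have "\<dots> \<le> ennreal c"
    proof (rule infsum_le_finite_sums)
      fix J assume J: "finite J" "J \<subseteq> B"
      have "(\<Sum>j\<in>J. \<Sum>i\<in>I. ennreal (f i j)) = ennreal (\<Sum>i\<in>I. \<Sum>j\<in>J. f i j)"
        using f by (subst sum.swap) (simp add: sum_nonneg)
      also have "\<dots> \<le> ennreal c" using R I J by (intro ennreal_leI) blast
      finally show "(\<Sum>j\<in>J. \<Sum>i\<in>I. ennreal (f i j)) \<le> ennreal c" .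
    qed (rule nonneg_summable_on_complete, simp)
    finally show "(\<Sum>i\<in>I. \<Sum>\<^sub>\<infinity>j\<in>B. ennreal (f i j)) \<le> ennreal c" .
  qed (rule nonneg_summable_on_complete, simp)
qed

context coercive_gaussian
begin

text \<open>For \<open>1 \<le> p\<close> the future lies strictly after \<open>m\<close>, where a
  conditional law was constructed, so the choice returns one.\<close>

lemma future_cond_law_regular:
  assumes "1 \<le> p"
  shows "is_regular_cond_law M (generated_field M X {..m}) (\<Pi>\<^sub>M j\<in>{m + int p..}. borel)
    (\<lambda>\<omega>. \<lambda>j\<in>{m + int p..}. X j \<omega>) (future_cond_law M X m p)"
  unfolding future_cond_law_def
  using assms by (intro someI_ex[OF exists_regular_cond_law]) auto

text \<open>The factor 2 reflects the normalisation of total variation, which reaches 2 for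
  probability measures.\<close>

lemma beta_coeff_upper:
  assumes p: "1 \<le> p" and u: "0 < u" "u \<le> 1" and c: "0 \<le> c"
    and sum_le: "(\<Sum>\<^sub>\<infinity>i\<in>{..m}. \<Sum>\<^sub>\<infinity>j\<in>{int p + m..}. ennreal ((\<sigma> i j)\<^sup>2)) \<le> ennreal c"
  shows "beta_coeff M X m p \<le> 2 * ennreal (\<Lambda> / \<mu> ^ 3 * c / u + u)"
  unfolding beta_coeff_def
proof (rule total_variation_integral_upper[OF _ future_cond_law_regular[OF p]])
  show J: "{m + int p..} \<subseteq> {m<..}" using p by auto
  fix E :: "('a \<times> (int \<Rightarrow> real)) set"
  assume "E \<in> sets (generated_field M X {..m} \<Otimes>\<^sub>M (\<Pi>\<^sub>M j\<in>{m + int p..}. borel))"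
  then show "measure M {\<omega> \<in> space M. (\<omega>, \<lambda>j\<in>{m + int p..}. X j \<omega>) \<in> E} -
      measure (M \<Otimes>\<^sub>M M) {\<omega> \<in> space (M \<Otimes>\<^sub>M M). (fst \<omega>, \<lambda>j\<in>{m + int p..}. X j (snd \<omega>)) \<in> E}
    \<le> \<Lambda> / \<mu> ^ 3 * c / u + u"
  proof (rule past_future_decoupling_bound[OF J _ u])
    fix I K assume IK: "finite I" "finite K" "I \<subseteq> {..m}" "K \<subseteq> {m + int p..}"
    have "(\<Sum>i\<in>I. \<Sum>j\<in>K. (\<sigma> i j)\<^sup>2) \<le> c"
      using sum_le IK c by (subst (asm) double_infsum_le_iff) (auto simp: add.commute)
    then show "\<Lambda> / \<mu> ^ 3 * (\<Sum>i\<in>I. \<Sum>j\<in>K. (\<sigma> i j)\<^sup>2) \<le> \<Lambda> / \<mu> ^ 3 * c"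
      using \<Lambda>_pos \<mu>_pos by (intro mult_left_mono) auto
  qed
qed

lemma beta_coeff_lower:
  assumes p: "1 \<le> p" and b: "0 \<le> b" "b \<le> 1 / 16" and beta: "beta_coeff M X m p \<le> ennreal b"
  shows "(\<Sum>\<^sub>\<infinity>i\<in>{..m}. \<Sum>\<^sub>\<infinity>j\<in>{int p + m..}. ennreal ((\<sigma> i j)\<^sup>2)) \<le> ennreal (48 * \<Lambda>\<^sup>2 * b)"
proof (subst double_infsum_le_iff)
  show "\<forall>I J. finite I \<longrightarrow> finite J \<longrightarrow> I \<subseteq> {..m} \<longrightarrow> J \<subseteq> {int p + m..} \<longrightarrow>
      (\<Sum>i\<in>I. \<Sum>j\<in>J. (\<sigma> i j)\<^sup>2) \<le> 48 * \<Lambda>\<^sup>2 * b"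
  proof (intro allI impI)
    fix I J assume IJ: "finite I" "finite J" "I \<subseteq> {..m}" "J \<subseteq> {int p + m..}"
    have J: "J \<subseteq> {m<..}" using IJ(4) p by auto
    have F: "{m + int p..} \<subseteq> {m<..}" using p by auto
    have sub: "I \<union> J \<subseteq> {..m} \<union> {m + int p..}" using IJ by auto
    have "cross_norm_sq I J \<le> 48 * \<Lambda>\<^sup>2 * b"
    proof (rule cross_norm_sq_le_total_variation[OF IJ(1) IJ(3) IJ(2) J b])
      fix B assume B: "B \<in> sets (\<Pi>\<^sub>M k\<in>I \<union> J. (borel :: real measure))"
      have "ennreal (measure M ((\<lambda>\<omega>. \<lambda>k\<in>I \<union> J. X k \<omega>) -` B \<inter> space M) -
          measure (M \<Otimes>\<^sub>M M) ((\<lambda>\<omega>. \<lambda>k\<in>I \<union> J. decouple m X k \<omega>) -` B \<inter> space (M \<Otimes>\<^sub>M M))) \<le> beta_coeff M X m p"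
        unfolding beta_coeff_def by (rule total_variation_integral_lower[OF F future_cond_law_regular[OF p] sub B])
      from order_trans[OF this beta]
      show "measure M ((\<lambda>\<omega>. \<lambda>k\<in>I \<union> J. X k \<omega>) -` B \<inter> space M) -
          measure (M \<Otimes>\<^sub>M M) ((\<lambda>\<omega>. \<lambda>k\<in>I \<union> J. decouple m X k \<omega>) -` B \<inter> space (M \<Otimes>\<^sub>M M)) \<le> b"
        using ennreal_le_iff[OF b(1)] by blast
    qed
    then show "(\<Sum>i\<in>I. \<Sum>j\<in>J. (\<sigma> i j)\<^sup>2) \<le> 48 * \<Lambda>\<^sup>2 * b"
      by (simp add: cross_norm_sq_def[OF IJ(1) IJ(3) IJ(2) J])
  qed
qed (use b in auto)

theorem beta_mixing_iff:
  "beta_mixing M X \<longleftrightarrow>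
    (\<lambda>p::nat. SUP n::int. \<Sum>\<^sub>\<infinity>i\<in>{..n}. \<Sum>\<^sub>\<infinity>j\<in>{int p + n..}. ennreal ((\<sigma> i j)\<^sup>2)) \<longlonglongrightarrow> 0"
  (is "_ \<longleftrightarrow> (\<lambda>p. SUP n. ?H n p) \<longlonglongrightarrow> 0")
proof
  assume "beta_mixing M X"
  then have beta: "\<And>b::real. b > 0 \<Longrightarrow> \<forall>\<^sub>F p in sequentially. (SUP m. beta_coeff M X m p) \<le> ennreal b"
    unfolding beta_mixing_def tendsto_0_ennreal_iff by blast
  show "(\<lambda>p. SUP n. ?H n p) \<longlonglongrightarrow> 0"
    unfolding tendsto_0_ennreal_iff
  proof (intro allI impI)
    fix \<epsilon> :: real assume \<epsilon>: "\<epsilon> > 0"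
    \<comment> \<open>The first term meets the hypothesis of \<open>beta_coeff_lower\<close>, the
      second brings its conclusion below \<epsilon>.\<close>
    define b where "b = min (1 / 16) (\<epsilon> / (48 * \<Lambda>\<^sup>2))"
    have b: "b > 0" "b \<le> 1 / 16" using \<epsilon> \<Lambda>_pos by (auto simp: b_def)
    have "b \<le> \<epsilon> / (48 * \<Lambda>\<^sup>2)" by (simp add: b_def)
    then have b\<epsilon>: "48 * \<Lambda>\<^sup>2 * b \<le> \<epsilon>" using \<Lambda>_pos by (simp add: field_simps)
    show "\<forall>\<^sub>F p in sequentially. (SUP n. ?H n p) \<le> ennreal \<epsilon>"
      \<comment> \<open>The value p = 0, where past and future share the index m, is excluded; the
        limit does not see it.\<close>
      using beta[OF b(1)] eventually_ge_at_top[of 1]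
    proof eventually_elim
      case (elim p)
      show ?case
      proof (rule SUP_least)
        fix n
        have "beta_coeff M X n p \<le> ennreal b" using elim(1) by (meson SUP_upper UNIV_I order_trans)
        then have "?H n p \<le> ennreal (48 * \<Lambda>\<^sup>2 * b)" using beta_coeff_lower[OF elim(2)] b by simp
        also have "\<dots> \<le> ennreal \<epsilon>" by (rule ennreal_leI[OF b\<epsilon>])
        finally show "?H n p \<le> ennreal \<epsilon>" .
      qed
    qed
  qed
next
  assume "(\<lambda>p. SUP n. ?H n p) \<longlonglongrightarrow> 0"
  then have H: "\<And>c::real. c > 0 \<Longrightarrow> \<forall>\<^sub>F p in sequentially. (SUP n. ?H n p) \<le> ennreal c"
    unfolding tendsto_0_ennreal_iff by blast
  show "beta_mixing M X"
    unfolding beta_mixing_def tendsto_0_ennreal_iff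
  proof (intro allI impI)
    fix \<epsilon> :: real assume \<epsilon>: "\<epsilon> > 0"
    define u where "u = min 1 (\<epsilon> / 4)"
    have u: "0 < u" "u \<le> 1" "4 * u \<le> \<epsilon>" using \<epsilon> by (auto simp: u_def)
    \<comment> \<open>Balances the two terms of \<open>beta_coeff_upper\<close>: the first also
      becomes \<open>u\<close>, so the bound is 2 * (2 * u), at most \<epsilon>.\<close>
    define c where "c = u\<^sup>2 * \<mu> ^ 3 / \<Lambda>"
    have c: "c > 0" using u \<mu>_pos \<Lambda>_pos by (simp add: c_def)
    have cu: "\<Lambda> / \<mu> ^ 3 * c / u + u = 2 * u"
      using u \<mu>_pos \<Lambda>_pos by (simp add: c_def power2_eq_square)
    show "\<forall>\<^sub>F p in sequentially. (SUP m. beta_coeff M X m p) \<le> ennreal \<epsilon>"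
      using H[OF c] eventually_ge_at_top[of 1]
    proof eventually_elim
      case (elim p)
      show ?case
      proof (rule SUP_least)
        fix m
        have "?H m p \<le> ennreal c" using elim(1) by (meson SUP_upper UNIV_I order_trans)
        then have "beta_coeff M X m p \<le> 2 * ennreal (2 * u)"
          unfolding cu[symmetric] by (rule beta_coeff_upper[OF elim(2) u(1) u(2) less_imp_le[OF c]])
        also have "\<dots> = ennreal (2 * (2 * u))" using u by (simp only: numeral_mult_ennreal)
        also have "2 * (2 * u) = 4 * u" by simp
        also have "\<dots> \<le> ennreal \<epsilon>" by (rule ennreal_leI[OF u(3)])
        finally show "beta_coeff M X m p \<le> ennreal \<epsilon>" .
      qed
    qed
  qed
qed

end

theorem theorem5p4:
  fixes M :: "'a measure" and X :: "int \<Rightarrow> 'a \<Rightarrow> real" and \<sigma> :: "int \<Rightarrow> int \<Rightarrow> real"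
  assumes "gaussian_process M X"
    and "\<And>j. integral\<^sup>L M (X j) = 0"
    and "\<And>i j. \<sigma> i j = integral\<^sup>L M (\<lambda>\<omega>. X i \<omega> * X j \<omega>)"
    and "bounded_on_ell2 \<sigma>"
    and "invertible_on_ell2 \<sigma>"
  shows "beta_mixing M X \<longleftrightarrow>
    (\<lambda>p::nat. SUP n::int. \<Sum>\<^sub>\<infinity>i\<in>{..n}. \<Sum>\<^sub>\<infinity>j\<in>{int p + n..}. ennreal ((\<sigma> i j)\<^sup>2)) \<longlonglongrightarrow> 0"
proof -
  interpret centred_gaussian M X \<sigma>
  proof (rule gaussian_process_imp_centred)
    show "gaussian_process M X" by (rule assms(1))
  qed (rule assms(2) assms(3))+
  obtain \<Lambda> where \<Lambda>: "\<Lambda> > 0" "\<forall>F a. finite F \<longrightarrow> bil \<sigma> F a a \<le> \<Lambda> * (\<Sum>i\<in>F. (a i)\<^sup>2)"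
    using bounded_on_ell2_quad_upper[OF assms(4)] by (elim exE conjE)
  have "\<exists>\<mu>>0. \<forall>F a. finite F \<longrightarrow> \<mu> * (\<Sum>i\<in>F. (a i)\<^sup>2) \<le> bil \<sigma> F a a"
  proof (rule bounded_invertible_coercive[OF assms(4,5)])
    show "\<sigma> i j = \<sigma> j i" for i j by (rule cov_sym)
    show "0 \<le> bil \<sigma> F a a" for F a by (rule bil_nonneg)
  qed
  then obtain \<mu> where \<mu>: "\<mu> > 0" "\<forall>F a. finite F \<longrightarrow> \<mu> * (\<Sum>i\<in>F. (a i)\<^sup>2) \<le> bil \<sigma> F a a"
    by (elim exE conjE)
  interpret covariance_form \<sigma> \<mu> \<Lambda>
  proof
    show "\<sigma> i j = \<sigma> j i" for i j by (rule cov_sym)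
    show "0 < \<mu>" "0 < \<Lambda>" by (rule \<mu>(1) \<Lambda>(1))+
    show "\<mu> * (\<Sum>i\<in>F. (a i)\<^sup>2) \<le> bil \<sigma> F a a" if "finite F" for F a using \<mu>(2) that by blast
    show "bil \<sigma> F a a \<le> \<Lambda> * (\<Sum>i\<in>F. (a i)\<^sup>2)" if "finite F" for F a using \<Lambda>(2) that by blast
  qed
  interpret coercive_gaussian M X \<sigma> \<mu> \<Lambda> ..
  show ?thesis by (rule beta_mixing_iff)
qed

end
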